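(* Let $\Omega$ be a bounded domain in $M$ with smooth boundary $\partial\Omega$. If $f\in C^1(\overline{\Omega},\mathbb{A})$, then $$f(x)=\int_{\partial\Omega}E_y(x)\,(n(y)f(y))\,dS(y)-\int_{\Omega}E_y(x)\,(\overline{\partial}_{\mathcal{B}}f(y))\,dV(y),\qquad x\in\Omega,$$ where $n(y)\in M$ is the unit exterior normal to $\partial\Omega$ at $y$, and $dS$ and $dV$ are the classical Lebesgue surface element and volume element in $\mathbb{R}^{m+1}$, respectively.
   Context: $\mathbb{A}$ is a real algebra with unity (with $\mathbb{R}$ identified with $\mathbb{R}\cdot 1$), of finite real dimension greater than $1$, which is alternative (not necessarily associative or commutative): the associator $[a,b,c]=(ab)c-a(bc)$ is an alternating trilinear function. It is equipped with an anti-involution $a\mapsto a^{c}$, i.e. a real linear map with $a^{c}=a$ for $a\in\mathbb{R}$, $(a^{c})^{c}=a$, $(ab)^{c}=b^{c}a^{c}$. Put $t(x)=x+x^{c}$, $n(x)=xx^{c}$, $\mathbb{S}_{\mathbb{A}}=\{x\in\mathbb{A}: t(x)=0,\ n(x)=1\}$ (assumed nonempty), and $Q_{\mathbb{A}}=\mathbb{R}\cup\{x\in\mathbb{A}: t(x)\in\mathbb{R},\ n(x)\in\mathbb{R},\ 4n(x)>t(x)^2\}$. $M$ is a fixed hypercomplex subspace of $\mathbb{A}$, i.e. a real vector subspace with $\mathbb{R}\subsetneq M\subseteq Q_{\mathbb{A}}$, with a fixed hypercomplex basis $\mathcal{B}=(v_0,v_1,\ldots,v_m)$, $m\ge 1$: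 a real vector basis of $M$ with $v_0=1$, $v_s\in\mathbb{S}_{\mathbb{A}}$ for $1\le s\le m$ and $v_sv_t=-v_tv_s$ for distinct $s,t\in\{1,\ldots,m\}$. The basis $\mathcal{B}$ is completed to a real vector basis of $\mathbb{A}$, and $\mathbb{A}$ carries the Euclidean scalar product and norm $|\cdot|$ for which that basis is orthonormal. $\mathbb{R}^{m+1}$ is identified with $M$ via $(x_0,\ldots,x_m)\mapsto x=\sum_{s=0}^m x_sv_s$. A domain is a connected open set. Differentiability classes and integrals of $\mathbb{A}$-valued functions are understood componentwise; $\partial_s=\partial/\partial x_s$ and $\overline{\partial}_{\mathcal{B}}f=\sum_{s=0}^m v_s\,\partial_s f$. The Cauchy kernel is $E(x)=\frac{1}{\sigma_m}\frac{x^c}{|x|^{m+1}}$ for $x\in M\setminus\{0\}$, where $\sigma_m=2\frac{\Gamma(1/2)^{m+1}}{\Gamma((m+1)/2)}$, and $E_y(x):=E(y-x)$. *)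

theory Defs
  imports "HOL-Analysis.Analysis"
begin

section \<open>Alternative algebras with an anti-involution\<close>

definition associator :: "('a::real_vector \<Rightarrow> 'a \<Rightarrow> 'a) \<Rightarrow> 'a \<Rightarrow> 'a \<Rightarrow> 'a \<Rightarrow> 'a" where
  "associator mul a b c = mul (mul a b) c - mul a (mul b c)"

text \<open>
  The algebra is the type \<open>'a\<close> with product \<open>mul\<close>, unity \<open>e\<close> and anti-involution \<open>star\<close>;
  a real number \<open>r\<close> is identified with \<open>r *\<^sub>R e\<close>. The inner product of the class
  \<open>euclidean_space\<close> is not assumed to interact with the product: it is tied to the
  hypercomplex basis in the locale \<open>hypercomplex_subspace\<close> below.
\<close>

definition unit_sphere :: "('a::real_vector \<Rightarrow> 'a \<Rightarrow> 'a) \<Rightarrow> 'a \<Rightarrow> ('a \<Rightarrow> 'a) \<Rightarrow> 'a set" where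
  "unit_sphere mul e star = {x. x + star x = 0 \<and> mul x (star x) = e}"

definition quadratic_cone :: "('a::real_vector \<Rightarrow> 'a \<Rightarrow> 'a) \<Rightarrow> 'a \<Rightarrow> ('a \<Rightarrow> 'a) \<Rightarrow> 'a set" where
  "quadratic_cone mul e star =
     range (\<lambda>r. r *\<^sub>R e) \<union>
     {x. \<exists>t n. x + star x = t *\<^sub>R e \<and> mul x (star x) = n *\<^sub>R e \<and> 4 * n > t\<^sup>2}"

locale alternative_star_algebra =
  fixes mul :: "'a::euclidean_space \<Rightarrow> 'a \<Rightarrow> 'a"
    and e :: 'a
    and star :: "'a \<Rightarrow> 'a"
  assumes dim_gt_1: "DIM('a) > 1"
    and bilinear_mul: "bilinear mul"
    and unit_left: "mul e a = a"
    and unit_right: "mul a e = a"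
    and associator_alternating:
      "a = b \<or> b = c \<or> a = c \<Longrightarrow> associator mul a b c = 0"
    and linear_star: "linear star"
    and star_real: "star (r *\<^sub>R e) = r *\<^sub>R e"
    and star_star: "star (star a) = a"
    and star_mul: "star (mul a b) = mul (star b) (star a)"
    and unit_sphere_nonempty: "unit_sphere mul e star \<noteq> {}"

definition vector_basis :: "'i set \<Rightarrow> ('i \<Rightarrow> 'a::real_vector) \<Rightarrow> 'a set \<Rightarrow> bool" where
  "vector_basis I v V \<longleftrightarrow> inj_on v I \<and> independent (v ` I) \<and> span (v ` I) = V"

text \<open>
  \<open>v 0, \<dots>, v m\<close> is the hypercomplex basis of \<open>M\<close>, and \<open>v 0, \<dots>, v (DIM('a) - 1)\<close> is its
  completion to a basis of the whole algebra; the ambient inner product is the one that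
  makes the completed basis orthonormal. In particular \<open>x \<bullet> v s\<close> is the coordinate \<open>x\<^sub>s\<close>.
\<close>

locale hypercomplex_subspace = alternative_star_algebra mul e star
  for mul :: "'a::euclidean_space \<Rightarrow> 'a \<Rightarrow> 'a" and e :: 'a and star :: "'a \<Rightarrow> 'a" +
  fixes M :: "'a set"
    and m :: nat
    and v :: "nat \<Rightarrow> 'a"
  assumes subspace_M: "subspace M"
    and real_psubset_M: "range (\<lambda>r. r *\<^sub>R e) \<subset> M"
    and M_subset_cone: "M \<subseteq> quadratic_cone mul e star"
    and m_ge_1: "m \<ge> 1"
    and basis_M: "vector_basis {..m} v M"
    and v_0: "v 0 = e"
    and v_unit_sphere: "1 \<le> s \<Longrightarrow> s \<le> m \<Longrightarrow> v s \<in> unit_sphere mul e star"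
    and v_anticommute:
      "1 \<le> s \<Longrightarrow> s \<le> m \<Longrightarrow> 1 \<le> t \<Longrightarrow> t \<le> m \<Longrightarrow> s \<noteq> t \<Longrightarrow> mul (v s) (v t) = - mul (v t) (v s)"
    and basis_algebra: "vector_basis {..<DIM('a)} v UNIV"
    and orthonormal:
      "i < DIM('a) \<Longrightarrow> j < DIM('a) \<Longrightarrow> v i \<bullet> v j = (if i = j then 1 else 0)"

section \<open>Differentiability in the coordinates of M\<close>

definition partial :: "(nat \<Rightarrow> 'a::real_vector) \<Rightarrow> nat \<Rightarrow> ('a \<Rightarrow> 'b::real_normed_vector) \<Rightarrow> 'a \<Rightarrow> 'b" where
  "partial v s f x = vector_derivative (\<lambda>t. f (x + t *\<^sub>R v s)) (at 0)"

text \<open>\<open>Ck_on v m k U f\<close>: \<open>f\<close> is of class \<open>C\<^sup>k\<close> on \<open>U\<close>, a relatively open subset of \<open>M\<close>.\<close>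

primrec Ck_on :: "(nat \<Rightarrow> 'a::real_normed_vector) \<Rightarrow> nat \<Rightarrow> nat \<Rightarrow> 'a set \<Rightarrow>
    ('a \<Rightarrow> 'b::real_normed_vector) \<Rightarrow> bool" where
  "Ck_on v m 0 U f \<longleftrightarrow> continuous_on U f"
| "Ck_on v m (Suc k) U f \<longleftrightarrow> continuous_on U f \<and>
     (\<forall>s\<le>m. (\<forall>x\<in>U. (\<lambda>t. f (x + t *\<^sub>R v s)) differentiable (at 0)) \<and>
            Ck_on v m k U (partial v s f))"

definition smooth_on :: "(nat \<Rightarrow> 'a::real_normed_vector) \<Rightarrow> nat \<Rightarrow> 'a set \<Rightarrow>
    ('a \<Rightarrow> 'b::real_normed_vector) \<Rightarrow> bool" where
  "smooth_on v m U f \<longleftrightarrow> (\<forall>k. Ck_on v m k U f)"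

text \<open>
  \<open>C\<^sup>1(closure \<Omega>)\<close>: \<open>f\<close> is continuous on the closure, \<open>C\<^sup>1\<close> on \<open>\<Omega>\<close>, and each first partial
  derivative has a continuous extension \<open>g\<close> to the closure.
\<close>

definition C1_closure :: "(nat \<Rightarrow> 'a::real_normed_vector) \<Rightarrow> nat \<Rightarrow> 'a set \<Rightarrow>
    ('a \<Rightarrow> 'b::real_normed_vector) \<Rightarrow> bool" where
  "C1_closure v m \<Omega> f \<longleftrightarrow> continuous_on (closure \<Omega>) f \<and> Ck_on v m 1 \<Omega> f \<and>
     (\<forall>s\<le>m. \<exists>g. continuous_on (closure \<Omega>) g \<and> (\<forall>x\<in>\<Omega>. g x = partial v s f x))"

definition dbar :: "('a::real_normed_vector \<Rightarrow> 'a \<Rightarrow> 'a) \<Rightarrow> (nat \<Rightarrow> 'a) \<Rightarrow> nat \<Rightarrow> ('a \<Rightarrow> 'a) \<Rightarrow> 'a \<Rightarrow> 'a" where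
  "dbar mul v m f x = (\<Sum>s\<le>m. mul (v s) (partial v s f x))"

section \<open>Domains with smooth boundary\<close>

definition boundary_in :: "'a::topological_space set \<Rightarrow> 'a set \<Rightarrow> 'a set" where
  "boundary_in M \<Omega> = (top_of_set M) frontier_of \<Omega>"

definition bounded_domain :: "'a::euclidean_space set \<Rightarrow> 'a set \<Rightarrow> bool" where
  "bounded_domain M \<Omega> \<longleftrightarrow> openin (top_of_set M) \<Omega> \<and> connected \<Omega> \<and> bounded \<Omega>"

text \<open>
  A function of the coordinates \<open>x\<^sub>s\<close> with \<open>s \<noteq> k\<close> is represented by a function on \<open>M\<close>
  that does not depend on \<open>x\<^sub>k\<close>.
\<close>

definition indep_coord :: "'a::real_vector set \<Rightarrow> (nat \<Rightarrow> 'a) \<Rightarrow> nat \<Rightarrow> ('a \<Rightarrow> real) \<Rightarrow> bool" where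
  "indep_coord M v k \<gamma> \<longleftrightarrow> (\<forall>z\<in>M. \<forall>t. \<gamma> (z + t *\<^sub>R v k) = \<gamma> z)"

text \<open>
  Near each boundary point, up to the choice and the orientation of one coordinate axis,
  \<open>\<Omega>\<close> is the region above the graph of a \<open>C\<^sup>\<infinity>\<close> function of the other \<open>m\<close> coordinates.
\<close>

definition smooth_boundary ::
    "'a::euclidean_space set \<Rightarrow> (nat \<Rightarrow> 'a) \<Rightarrow> nat \<Rightarrow> 'a set \<Rightarrow> bool" where
  "smooth_boundary M v m \<Omega> \<longleftrightarrow>
     (\<forall>p\<in>boundary_in M \<Omega>. \<exists>r>0. \<exists>k\<le>m. \<exists>\<sigma>\<in>{1, -1::real}. \<exists>\<gamma>.
        smooth_on v m M \<gamma> \<and> indep_coord M v k \<gamma> \<and>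
        \<Omega> \<inter> ball p r = {z \<in> M \<inter> ball p r. \<sigma> * (z \<bullet> v k - \<gamma> z) > 0})"

text \<open>Velocities at \<open>y\<close> of the curves in \<open>\<Gamma>\<close> through \<open>y\<close>.\<close>

definition tangent_vectors :: "'a::real_normed_vector set \<Rightarrow> 'a \<Rightarrow> 'a set" where
  "tangent_vectors \<Gamma> y = {w. \<exists>c::real \<Rightarrow> 'a. c 0 = y \<and>
     (\<forall>\<^sub>F t in at 0. c t \<in> \<Gamma>) \<and> (c has_vector_derivative w) (at 0)}"

definition exterior_normal :: "'a::euclidean_space set \<Rightarrow> 'a set \<Rightarrow> 'a \<Rightarrow> 'a" where
  "exterior_normal M \<Omega> y = (THE \<nu>. \<nu> \<in> M \<and> norm \<nu> = 1 \<and>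
     (\<forall>w\<in>tangent_vectors (boundary_in M \<Omega>) y. \<nu> \<bullet> w = 0) \<and>
     (\<exists>\<epsilon>>0. \<forall>t. 0 < t \<and> t < \<epsilon> \<longrightarrow> y - t *\<^sub>R \<nu> \<in> \<Omega> \<and> y + t *\<^sub>R \<nu> \<notin> closure \<Omega>))"

section \<open>Volume and surface measure\<close>

text \<open>
  Lebesgue measure on the span of \<open>v s\<close>, \<open>s \<in> I\<close>, as a Borel measure on the whole algebra:
  the image of the product Lebesgue measure on \<open>\<real>\<^sup>I\<close> under \<open>x \<mapsto> (\<Sum>s\<in>I. x\<^sub>s v\<^sub>s)\<close>.
\<close>

definition coord_lebesgue :: "(nat \<Rightarrow> 'a::euclidean_space) \<Rightarrow> nat set \<Rightarrow> 'a measure" where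
  "coord_lebesgue v I = distr (PiM I (\<lambda>_. lborel)) borel (\<lambda>x. \<Sum>s\<in>I. x s *\<^sub>R v s)"

definition volume_measure :: "(nat \<Rightarrow> 'a::euclidean_space) \<Rightarrow> nat \<Rightarrow> 'a measure" where
  "volume_measure v m = coord_lebesgue v {..m}"

text \<open>
  The surface measure of a hypersurface \<open>\<Gamma>\<close> of \<open>M\<close> is the Borel measure concentrated on \<open>\<Gamma>\<close>
  whose element on every piece \<open>\<Gamma> \<inter> U\<close> that is the graph \<open>x\<^sub>k = \<gamma>(x')\<close> of a \<open>C\<^sup>1\<close> function
  of the other coordinates is \<open>sqrt (1 + |grad \<gamma>|\<^sup>2) dx'\<close>. The point of the graph over a point
  \<open>z\<close> of the hyperplane \<open>x\<^sub>k = 0\<close> is \<open>z + \<gamma> z *\<^sub>R v k\<close>.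
\<close>

definition is_surface_measure ::
    "'a::euclidean_space set \<Rightarrow> (nat \<Rightarrow> 'a) \<Rightarrow> nat \<Rightarrow> 'a set \<Rightarrow> 'a measure \<Rightarrow> bool" where
  "is_surface_measure M v m \<Gamma> \<mu> \<longleftrightarrow>
     sets \<mu> = sets borel \<and> emeasure \<mu> (- \<Gamma>) = 0 \<and>
     (\<forall>k\<le>m. \<forall>\<gamma> U B.
        Ck_on v m 1 M \<gamma> \<and> indep_coord M v k \<gamma> \<and> open U \<and>
        \<Gamma> \<inter> U = {z \<in> M \<inter> U. z \<bullet> v k = \<gamma> z} \<and> B \<in> sets borel \<and> B \<subseteq> \<Gamma> \<inter> U \<longrightarrow>
        emeasure \<mu> B =
          (\<integral>\<^sup>+ z. indicator B (z + \<gamma> z *\<^sub>R v k) *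
                  ennreal (sqrt (1 + (\<Sum>s\<in>{..m} - {k}. (partial v s \<gamma> z)\<^sup>2)))
            \<partial>coord_lebesgue v ({..m} - {k})))"

definition surface_measure ::
    "'a::euclidean_space set \<Rightarrow> (nat \<Rightarrow> 'a) \<Rightarrow> nat \<Rightarrow> 'a set \<Rightarrow> 'a measure" where
  "surface_measure M v m \<Gamma> = (THE \<mu>. is_surface_measure M v m \<Gamma> \<mu>)"

section \<open>The Cauchy kernel\<close>

definition sigma :: "nat \<Rightarrow> real" where
  "sigma m = 2 * Gamma (1/2) ^ (m + 1) / Gamma ((real m + 1) / 2)"

definition cauchy_kernel :: "('a::real_normed_vector \<Rightarrow> 'a) \<Rightarrow> nat \<Rightarrow> 'a \<Rightarrow> 'a" where
  "cauchy_kernel star m x = (1 / sigma m) *\<^sub>R ((1 / norm x ^ (m + 1)) *\<^sub>R star x)"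

definition cauchy_kernel_at :: "('a::real_normed_vector \<Rightarrow> 'a) \<Rightarrow> nat \<Rightarrow> 'a \<Rightarrow> 'a \<Rightarrow> 'a" where
  "cauchy_kernel_at star m y x = cauchy_kernel star m (y - x)"

end

(*
The divergence theorem for G_s(y) = E(y - x) (v_s f(y)) gives the formula, because alternativity
yields star w (w a) = |w|^2 a for w in M, so that sum_s (d_s E) (v_s a) = 0 away from 0. The
singularity is removed by replacing 1/|w|^(m+1) inside the ball of radius epsilon by a C^1 radial
profile for which sum_s (d_s E) (v_s a) = rho a with a probability density rho supported in that
ball; then epsilon tends to 0.

The divergence theorem is proved by a partition of unity. In a chart, the domain lies above a graph
x_k = gamma; the k-th partial derivative is integrated along the x_k-axis, and the others after the
measure preserving shear z -> z + gamma(z) v_k. The surface measure is well defined because the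
representations of a piece as a graph over two different coordinate planes are related, with the
remaining coordinates frozen, by a change of variables in dimension one.
*)
theory Submission
  imports Defs
begin

section \<open>Orthonormal frames\<close>

text \<open>Smoothing replaces the usual excision of a small ball, so the divergence theorem is
  applied to \<open>\<Omega>\<close> alone and no sphere has to be parametrised. With u = |w|^2 /
  \<epsilon>^2 and n = m + 1, the power u^(-n/2) is continued below u = 1 by its tangent there; the
  density this produces is a multiple of 1 - u, whose mass needs only the volume and the second
  moment of a ball. The constant sigma_m enters as n times the volume of the unit ball.

  Two features shape the rest. \<open>f\<close> is given only on the closure of
  \<open>\<Omega>\<close>, so integration by parts must use one-sided data: continuity up to the
  graph, derivatives strictly inside. The surface measure and the exterior normal are definite
  descriptions, so nothing can be computed from them before existence and uniqueness are proved; for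
  the measure this rests on the agreement of overlapping graphs, for the normal on the rejection of
  the opposite sign.

  Alternativity enters through \<open>mul x (mul x a) = mul (mul x x) a\<close>, which fits the
  bracketing of the formula: the kernel acts on the product of the normal and
  \<open>f\<close>.\<close>

lemma has_vector_derivative_line_shift:
  fixes F :: "'a::real_normed_vector \<Rightarrow> 'b::real_normed_vector"
  assumes "((\<lambda>u. F ((b + t *\<^sub>R w) + u *\<^sub>R w)) has_vector_derivative D) (at 0)"
  shows "((\<lambda>u. F (b + u *\<^sub>R w)) has_vector_derivative D) (at t)"
proof -
  have "((\<lambda>u. u - t) has_vector_derivative 1) (at t)"
    by (auto intro!: derivative_eq_intros simp: has_vector_derivative_def)
  from vector_diff_chain_at[OF this, of "\<lambda>u. F ((b + t *\<^sub>R w) + u *\<^sub>R w)" D] assms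
  show ?thesis by (simp add: o_def algebra_simps)
qed

text \<open>The measure theory and the divergence theorem see only an orthonormal system spanning
  \<open>M\<close>. As \<open>M\<close> may be a proper subspace of the ambient space, openness,
  derivatives and measures are all taken relative to \<open>M\<close>.\<close>

locale orthonormal_frame =
  fixes M :: "'a::euclidean_space set" and m :: nat and v :: "nat \<Rightarrow> 'a"
  assumes frame_orthonormal: "i \<le> m \<Longrightarrow> j \<le> m \<Longrightarrow> v i \<bullet> v j = (if i = j then 1 else 0)"
    and frame_span: "M = span (v ` {..m})"
begin

text \<open>The orthogonal projection onto \<open>M\<close>. Composing with it extends a function
  given on \<open>M\<close> to the whole space.\<close>

definition proj :: "'a \<Rightarrow> 'a" where
  "proj z = (\<Sum>s\<le>m. (z \<bullet> v s) *\<^sub>R v s)"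

lemma subspace_frame: "subspace M"
  by (simp add: frame_span)

lemma closed_frame: "closed M"
  using subspace_frame closed_subspace by blast

lemma frame_in [simp, intro]: "s \<le> m \<Longrightarrow> v s \<in> M"
  by (auto simp: frame_span intro: span_base)

lemma frame_add [intro]: "x \<in> M \<Longrightarrow> y \<in> M \<Longrightarrow> x + y \<in> M"
  and frame_diff [intro]: "x \<in> M \<Longrightarrow> y \<in> M \<Longrightarrow> x - y \<in> M"
  and frame_scale [intro]: "x \<in> M \<Longrightarrow> c *\<^sub>R x \<in> M"
  and frame_zero [simp, intro]: "0 \<in> M"
  using subspace_frame by (auto simp: subspace_add subspace_diff subspace_scale subspace_0)

lemma frame_shift_iff [simp]: "s \<le> m \<Longrightarrow> x + t *\<^sub>R v s \<in> M \<longleftrightarrow> x \<in> M"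
  by (metis frame_in frame_scale add_diff_cancel_right' frame_diff frame_add)

lemma frame_sum: "I \<subseteq> {..m} \<Longrightarrow> (\<Sum>s\<in>I. c s *\<^sub>R v s) \<in> M"
  by (auto intro!: subspace_sum[OF subspace_frame])

lemma inner_sum_frame:
  assumes "I \<subseteq> {..m}" "j \<le> m"
  shows "(\<Sum>s\<in>I. c s *\<^sub>R v s) \<bullet> v j = (if j \<in> I then c j else 0)"
proof -
  have fin: "finite I" using assms(1) finite_subset by blast
  have "(\<Sum>s\<in>I. c s *\<^sub>R v s) \<bullet> v j = (\<Sum>s\<in>I. if s = j then c s else 0)"
    unfolding inner_sum_left
    using assms by (intro sum.cong) (auto simp: frame_orthonormal subset_iff)
  then show ?thesis using fin by simp
qed

lemma norm_frame [simp]: "s \<le> m \<Longrightarrow> norm (v s) = 1"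
  by (simp add: norm_eq_1 frame_orthonormal)

lemma proj_in [simp, intro]: "proj z \<in> M"
  unfolding proj_def by (rule frame_sum) simp

lemma proj_id: "z \<in> M \<Longrightarrow> proj z = z"
proof -
  assume "z \<in> M"
  then have "z \<in> span (v ` {..m})" by (simp add: frame_span)
  then show "proj z = z"
  proof (induction rule: span_induct_alt)
    case base
    show ?case by (simp add: proj_def)
  next
    case (step c x y)
    then obtain s where s: "s \<le> m" "x = v s" by auto
    have 1: "(v s \<bullet> v i) *\<^sub>R v i = (if i = s then v s else 0)" if "i \<le> m" for i
      using that s by (simp add: frame_orthonormal)
    have "proj x = (\<Sum>i\<le>m. if i = s then v s else 0)"
      unfolding proj_def s(2) by (intro sum.cong) (simp_all add: 1)
    then have "proj x = x" using s by simp
    moreover have "proj (c *\<^sub>R x + y) = c *\<^sub>R proj x + proj y"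
      by (simp add: proj_def inner_add_left scaleR_add_left sum.distrib scaleR_sum_right)
    ultimately show ?case using step by simp
  qed
qed

lemma frame_expand: "z \<in> M \<Longrightarrow> (\<Sum>s\<le>m. (z \<bullet> v s) *\<^sub>R v s) = z"
  using proj_id by (simp add: proj_def)

lemma proj_shift: "s \<le> m \<Longrightarrow> proj (z + t *\<^sub>R v s) = proj z + t *\<^sub>R v s"
proof -
  assume "s \<le> m"
  have "proj (z + t *\<^sub>R v s) = proj z + t *\<^sub>R proj (v s)"
    by (simp add: proj_def inner_add_left scaleR_add_left sum.distrib scaleR_sum_right)
  then show ?thesis using proj_id[of "v s"] \<open>s \<le> m\<close> by simp
qed

lemma continuous_on_proj [continuous_intros]: "continuous_on S f \<Longrightarrow> continuous_on S (\<lambda>x. proj (f x))"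
  unfolding proj_def by (intro continuous_intros)

lemma norm_frame_sum:
  assumes "I \<subseteq> {..m}"
  shows "(norm (\<Sum>s\<in>I. c s *\<^sub>R v s))\<^sup>2 = (\<Sum>s\<in>I. (c s)\<^sup>2)"
proof -
  have "(norm (\<Sum>s\<in>I. c s *\<^sub>R v s))\<^sup>2 = (\<Sum>s\<in>I. (\<Sum>s\<in>I. c s *\<^sub>R v s) \<bullet> (c s *\<^sub>R v s))"
    by (simp add: power2_norm_eq_inner inner_sum_right)
  also have "\<dots> = (\<Sum>s\<in>I. (c s)\<^sup>2)"
  proof (rule sum.cong[OF refl])
    fix i assume "i \<in> I"
    then show "(\<Sum>s\<in>I. c s *\<^sub>R v s) \<bullet> (c i *\<^sub>R v i) = (c i)\<^sup>2"
      using assms inner_sum_frame[of I i c] by (auto simp: power2_eq_square)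
  qed
  finally show ?thesis .
qed

lemma norm_sq_frame: "z \<in> M \<Longrightarrow> (norm z)\<^sup>2 = (\<Sum>s\<le>m. (z \<bullet> v s)\<^sup>2)"
  using norm_frame_sum[of "{..m}" "\<lambda>s. z \<bullet> v s"] frame_expand[of z] by simp

lemma abs_inner_frame_le: "s \<le> m \<Longrightarrow> \<bar>z \<bullet> v s\<bar> \<le> norm z"
  using Cauchy_Schwarz_ineq2[of z "v s"] by simp

text \<open>Moving from y to z one coordinate at a time reduces the claim to the mean value
  inequality on m + 1 segments. The derivative is taken within \<open>M\<close> because nothing is
  known about f off \<open>M\<close>.\<close>

lemma C1_frame_has_derivative:
  fixes f :: "'a \<Rightarrow> 'b::real_normed_vector"
  assumes U: "openin (top_of_set M) U" and y: "y \<in> U"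
    and der: "\<And>s z. s \<le> m \<Longrightarrow> z \<in> U \<Longrightarrow> ((\<lambda>t. f (z + t *\<^sub>R v s)) has_vector_derivative f' s z) (at 0)"
    and cont: "\<And>s. s \<le> m \<Longrightarrow> continuous_on U (f' s)"
  shows "(f has_derivative (\<lambda>w. \<Sum>s\<le>m. (w \<bullet> v s) *\<^sub>R f' s y)) (at y within M)"
  unfolding has_derivative_within_alt
proof (intro conjI allI impI)
  show "bounded_linear (\<lambda>w. \<Sum>s\<le>m. (w \<bullet> v s) *\<^sub>R f' s y)"
    by (intro bounded_linear_sum bounded_linear_scaleR_const bounded_linear_inner_left)
next
  fix e :: real assume e: "0 < e"
  \<comment> \<open>The error is shared by m + 1 segments, each of length at most |z - y|.\<close>
  define e' where "e' = e / (real m + 1)"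
  have e': "e' > 0" using e by (simp add: e'_def)
  have UM: "U \<subseteq> M" using U openin_imp_subset by blast
  obtain d0 where d0: "d0 > 0" "ball y d0 \<inter> M \<subseteq> U"
    using U y unfolding openin_contains_ball by blast
  have "\<forall>s\<in>{..m}. \<exists>d>0. \<forall>z\<in>U. dist z y < d \<longrightarrow> dist (f' s z) (f' s y) < e'"
    using cont y e' unfolding continuous_on_iff by blast
  then obtain d where d: "\<And>s. s \<le> m \<Longrightarrow> d s > 0 \<and> (\<forall>z\<in>U. dist z y < d s \<longrightarrow> dist (f' s z) (f' s y) < e')"
    by (metis atMost_iff)
  define \<delta> where "\<delta> = Min (insert d0 (d ` {..m}))"
  have \<delta>: "\<delta> > 0" "\<delta> \<le> d0" "\<And>s. s \<le> m \<Longrightarrow> \<delta> \<le> d s"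
      using d0 d by (auto simp: \<delta>_def intro: min.coboundedI2 Min_le)
  show "\<exists>d>0. \<forall>z\<in>M. norm (z - y) < d \<longrightarrow>
      norm (f z - f y - (\<Sum>s\<le>m. ((z - y) \<bullet> v s) *\<^sub>R f' s y)) \<le> e * norm (z - y)"
  proof (intro exI conjI ballI impI)
    show "\<delta> > 0" by fact
  next
    fix z assume z: "z \<in> M" "norm (z - y) < \<delta>"
    define c where "c s = (z - y) \<bullet> v s" for s
    \<comment> \<open>Vertices of the path from y = \<open>p 0\<close> to z =
      \<open>p (Suc m)\<close>; the segment from \<open>p j\<close> to \<open>p (Suc j)\<close> is
      parallel to \<open>v j\<close>.\<close>
    define p where "p j = y + (\<Sum>s<j. c s *\<^sub>R v s)" for j
    have yM: "y \<in> M" using y UM by blast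
    \<comment> \<open>By orthonormality, dropping or shrinking coordinates of z - y does not
      increase its norm, so the path stays in the ball around y.\<close>
    have near: "p j + t *\<^sub>R v j \<in> U \<and> dist (p j + t *\<^sub>R v j) y < \<delta>" 
      if j: "j \<le> m" and t: "\<bar>t\<bar> \<le> \<bar>c j\<bar>" for j t
    proof -
      have eq: "p j + t *\<^sub>R v j - y = (\<Sum>s\<in>{..j}. (if s = j then t else c s) *\<^sub>R v s)"
        by (simp add: p_def lessThan_Suc_atMost[symmetric])
      have "(norm (p j + t *\<^sub>R v j - y))\<^sup>2 = (\<Sum>s\<le>j. (if s = j then t else c s)\<^sup>2)"
        unfolding eq by (rule norm_frame_sum) (use j in auto)
      also have "\<dots> \<le> (\<Sum>s\<le>j. (c s)\<^sup>2)"
        using t by (intro sum_mono) (auto simp: abs_le_square_iff)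
      also have "\<dots> \<le> (\<Sum>s\<le>m. (c s)\<^sup>2)"
        using j by (intro sum_mono2) auto
      also have "\<dots> = (norm (z - y))\<^sup>2"
        using norm_sq_frame[OF frame_diff[OF z(1) yM]] by (simp add: c_def)
      finally have "norm (p j + t *\<^sub>R v j - y) \<le> norm (z - y)"
        by (simp add: power2_le_iff_abs_le)
      then have "dist (p j + t *\<^sub>R v j) y < \<delta>" using z by (simp add: dist_norm)
      moreover have "p j + t *\<^sub>R v j \<in> M"
        unfolding p_def using j yM frame_sum[of "{..<j}" c] by (auto simp: subset_iff)
      ultimately show ?thesis using d0 \<delta> by (auto simp: dist_commute)
    qed
    have step: "norm (f (p (Suc j)) - f (p j) - c j *\<^sub>R f' j y) \<le> \<bar>c j\<bar> * e'" if j: "j \<le> m" for j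
    proof -
      define S where "S = {t. \<bar>t\<bar> \<le> \<bar>c j\<bar>}"
      have pS: "p (Suc j) = p j + c j *\<^sub>R v j" by (simp add: p_def add.assoc)
      \<comment> \<open>Subtracting the linear function with slope \<open>f' j y\<close> leaves a
        derivative that is small by continuity of \<open>f' j\<close>.\<close>
      have dg: "((\<lambda>t. f (p j + t *\<^sub>R v j) - t *\<^sub>R f' j y) has_derivative
          (\<lambda>h. h *\<^sub>R (f' j (p j + t *\<^sub>R v j) - f' j y))) (at t within S)" if "t \<in> S" for t
      proof -
        have "((\<lambda>u. f ((p j + t *\<^sub>R v j) + u *\<^sub>R v j)) has_vector_derivative f' j (p j + t *\<^sub>R v j)) (at 0)"
          using der near j that by (auto simp: S_def)
        then have "((\<lambda>u. f (p j + u *\<^sub>R v j)) has_vector_derivative f' j (p j + t *\<^sub>R v j)) (at t)"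
          by (rule has_vector_derivative_line_shift)
        then have "((\<lambda>u. f (p j + u *\<^sub>R v j)) has_derivative (\<lambda>h. h *\<^sub>R f' j (p j + t *\<^sub>R v j))) (at t within S)"
          using has_derivative_at_withinI has_vector_derivative_def by blast
        then show ?thesis
          by (auto intro!: derivative_eq_intros simp: scaleR_diff_right)
      qed
      have "norm ((f (p j + c j *\<^sub>R v j) - c j *\<^sub>R f' j y) - (f (p j + 0 *\<^sub>R v j) - 0 *\<^sub>R f' j y)) \<le> e' * norm (c j - 0)"
      proof (rule differentiable_bound[of S _ "\<lambda>t h. h *\<^sub>R (f' j (p j + t *\<^sub>R v j) - f' j y)"])
        show "convex S"
        proof -
          have "S = {- \<bar>c j\<bar> .. \<bar>c j\<bar>}" by (auto simp: S_def)
          then show ?thesis by simp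
        qed
        show "onorm (\<lambda>h. h *\<^sub>R (f' j (p j + t *\<^sub>R v j) - f' j y)) \<le> e'" if "t \<in> S" for t
        proof (rule onorm_le)
          fix h :: real
          have "p j + t *\<^sub>R v j \<in> U" "dist (p j + t *\<^sub>R v j) y < \<delta>"
            using near j that by (auto simp: S_def)
          then have "dist (f' j (p j + t *\<^sub>R v j)) (f' j y) < e'"
            using d[OF j] \<delta>(3)[OF j] by fastforce
          then have "norm (f' j (p j + t *\<^sub>R v j) - f' j y) \<le> e'" by (simp add: dist_norm)
          from mult_right_mono[OF this, of "\<bar>h\<bar>"] 
          show "norm (h *\<^sub>R (f' j (p j + t *\<^sub>R v j) - f' j y)) \<le> e' * norm h"
            by (simp add: mult.commute)
        qed
      qed (use dg in \<open>auto simp: S_def\<close>)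
      then show ?thesis unfolding pS by (simp add: algebra_simps)
    qed
    have pend: "p (Suc m) = z"
    proof -
      have "(\<Sum>s\<le>m. c s *\<^sub>R v s) = z - y" unfolding c_def by (rule frame_expand) (use z yM in auto)
      then show ?thesis by (simp add: p_def lessThan_Suc_atMost)
    qed
    have p0: "p 0 = y" by (simp add: p_def)
    have "f z - f y - (\<Sum>s\<le>m. c s *\<^sub>R f' s y) = (\<Sum>j<Suc m. f (p (Suc j)) - f (p j) - c j *\<^sub>R f' j y)"
      using sum_lessThan_telescope[of "\<lambda>j. f (p j)" "Suc m"] 
      by (simp only: sum_subtractf pend p0) (simp add: lessThan_Suc_atMost)
    also have "norm \<dots> \<le> (\<Sum>j<Suc m. norm (z - y) * e')"
    proof (rule order_trans[OF norm_sum], rule sum_mono)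
      fix j assume "j \<in> {..<Suc m}"
      then have j: "j \<le> m" by simp
      have "\<bar>c j\<bar> \<le> norm (z - y)" unfolding c_def by (rule abs_inner_frame_le[OF j])
      with step[OF j] e' show "norm (f (p (Suc j)) - f (p j) - c j *\<^sub>R f' j y) \<le> norm (z - y) * e'"
        by (meson less_imp_le mult_right_mono order_trans)
    qed
    also have "\<dots> = e * norm (z - y)" by (simp add: e'_def field_simps)
    finally show "norm (f z - f y - (\<Sum>s\<le>m. ((z - y) \<bullet> v s) *\<^sub>R f' s y)) \<le> e * norm (z - y)"
      by (simp add: c_def)
  qed
qed

text \<open>The chain rule needs the curve to stay in \<open>M\<close> only near t: on an open S
  around t that it maps into \<open>M\<close>, differentiability within \<open>M\<close> is
  enough.\<close>

lemma vector_derivative_along_curve: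
  fixes f :: "'a \<Rightarrow> 'b::real_normed_vector"
  assumes f: "(f has_derivative (\<lambda>w. \<Sum>s\<le>m. (w \<bullet> v s) *\<^sub>R f' s)) (at (c t) within M)"
    and c: "(c has_vector_derivative w) (at t)" and cM: "eventually (\<lambda>u. c u \<in> M) (at t)" "c t \<in> M"
  shows "((\<lambda>u. f (c u)) has_vector_derivative (\<Sum>s\<le>m. (w \<bullet> v s) *\<^sub>R f' s)) (at t)"
proof -
  obtain S where S: "open S" "t \<in> S" "\<And>u. u \<in> S \<Longrightarrow> c u \<in> M"
  proof -
    obtain S where "open S" "t \<in> S" "\<forall>u\<in>S. u \<noteq> t \<longrightarrow> c u \<in> M"
      using cM(1) unfolding eventually_at_topological by blast
    then show thesis using that[of S] cM(2) by metis
  qed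
  have "(c has_vector_derivative w) (at t within S)"
    using c has_vector_derivative_at_within by blast
  moreover have "(f has_derivative (\<lambda>w. \<Sum>s\<le>m. (w \<bullet> v s) *\<^sub>R f' s)) (at (c t) within c ` S)"
    using f by (rule has_derivative_subset) (use S in auto)
  ultimately have "(f \<circ> c has_derivative (\<lambda>w. \<Sum>s\<le>m. (w \<bullet> v s) *\<^sub>R f' s) \<circ> (\<lambda>h. h *\<^sub>R w)) (at t within S)"
    unfolding has_vector_derivative_def by (rule diff_chain_within)
  then have "((\<lambda>u. f (c u)) has_vector_derivative (\<Sum>s\<le>m. (w \<bullet> v s) *\<^sub>R f' s)) (at t within S)"
    by (simp add: has_vector_derivative_def o_def scaleR_sum_right mult.commute)
  then show ?thesis using S at_within_open by metis
qed

end

section \<open>Lebesgue measure in coordinates\<close>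

lemma sets_coord_lebesgue [simp, measurable_cong]: "sets (coord_lebesgue v I) = sets borel"
  and space_coord_lebesgue [simp]: "space (coord_lebesgue v I) = UNIV"
  by (auto simp: coord_lebesgue_def)

interpretation lborel_product: product_sigma_finite "\<lambda>_::nat. lborel :: real measure"
  by standard

lemma coord_sum_measurable [measurable]:
  "(\<lambda>x. \<Sum>s\<in>I. x s *\<^sub>R v s) \<in> PiM I (\<lambda>_. lborel) \<rightarrow>\<^sub>M (borel :: 'a::euclidean_space measure)"
  by measurable

lemma coord_sum_insert:
  fixes v :: "nat \<Rightarrow> 'a::real_vector"
  assumes "finite I" "k \<notin> I"
  shows "(\<Sum>s\<in>insert k I. (x(k := t)) s *\<^sub>R v s) = (\<Sum>s\<in>I. x s *\<^sub>R v s) + t *\<^sub>R v k"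
proof -
  have "(\<Sum>s\<in>I. (x(k := t)) s *\<^sub>R v s) = (\<Sum>s\<in>I. x s *\<^sub>R v s)"
    using assms by (intro sum.cong) auto
  then show ?thesis using assms by simp
qed

text \<open>Tonelli with the line integral along \<open>v k\<close> inside; graphs over the
  hyperplane orthogonal to \<open>v k\<close> are always treated in this order.\<close>

lemma nn_integral_coord_insert:
  fixes F :: "'a::euclidean_space \<Rightarrow> ennreal"
  assumes "finite I" "k \<notin> I" and [measurable]: "F \<in> borel_measurable borel"
  shows "(\<integral>\<^sup>+ z. F z \<partial>coord_lebesgue v (insert k I)) =
         (\<integral>\<^sup>+ z. \<integral>\<^sup>+ t. F (z + t *\<^sub>R v k) \<partial>lborel \<partial>coord_lebesgue v I)"
proof -
  have "(\<integral>\<^sup>+ z. F z \<partial>coord_lebesgue v (insert k I)) =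
      (\<integral>\<^sup>+ x. F (\<Sum>s\<in>insert k I. x s *\<^sub>R v s) \<partial>PiM (insert k I) (\<lambda>_. lborel))"
    unfolding coord_lebesgue_def by (subst nn_integral_distr) auto
  also have "\<dots> = (\<integral>\<^sup>+ x. \<integral>\<^sup>+ t. F (\<Sum>s\<in>insert k I. (x(k := t)) s *\<^sub>R v s) \<partial>lborel \<partial>PiM I (\<lambda>_. lborel))"
    by (rule lborel_product.product_nn_integral_insert) (use assms in measurable)
  also have "\<dots> = (\<integral>\<^sup>+ x. \<integral>\<^sup>+ t. F ((\<Sum>s\<in>I. x s *\<^sub>R v s) + t *\<^sub>R v k) \<partial>lborel \<partial>PiM I (\<lambda>_. lborel))"
    by (simp only: coord_sum_insert[OF assms(1,2)])
  also have "\<dots> = (\<integral>\<^sup>+ z. \<integral>\<^sup>+ t. F (z + t *\<^sub>R v k) \<partial>lborel \<partial>coord_lebesgue v I)"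
    unfolding coord_lebesgue_def by (subst nn_integral_distr) auto
  finally show ?thesis .
qed

lemma integral_coord_insert:
  fixes F :: "'a::euclidean_space \<Rightarrow> 'b::{banach, second_countable_topology}"
  assumes "finite I" "k \<notin> I" and int: "integrable (coord_lebesgue v (insert k I)) F"
  shows "(\<integral> z. F z \<partial>coord_lebesgue v (insert k I)) =
         (\<integral> z. (\<integral> t. F (z + t *\<^sub>R v k) \<partial>lborel) \<partial>coord_lebesgue v I)"
proof -
  have [measurable]: "F \<in> borel_measurable borel" 
    using borel_measurable_integrable[OF int] by simp
  have "(\<integral> z. F z \<partial>coord_lebesgue v (insert k I)) =
      (\<integral> x. F (\<Sum>s\<in>insert k I. x s *\<^sub>R v s) \<partial>PiM (insert k I) (\<lambda>_. lborel))"
    unfolding coord_lebesgue_def by (subst integral_distr) auto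
  also have "\<dots> = (\<integral> x. \<integral> t. F (\<Sum>s\<in>insert k I. (x(k := t)) s *\<^sub>R v s) \<partial>lborel \<partial>PiM I (\<lambda>_. lborel))"
  proof (rule lborel_product.product_integral_insert[OF assms(1,2)])
    show "integrable (PiM (insert k I) (\<lambda>_. lborel)) (\<lambda>x. F (\<Sum>s\<in>insert k I. x s *\<^sub>R v s))"
      using int unfolding coord_lebesgue_def by (subst (asm) integrable_distr_eq) auto
  qed
  also have "\<dots> = (\<integral> x. \<integral> t. F ((\<Sum>s\<in>I. x s *\<^sub>R v s) + t *\<^sub>R v k) \<partial>lborel \<partial>PiM I (\<lambda>_. lborel))"
    by (simp only: coord_sum_insert[OF assms(1,2)])
  also have "\<dots> = (\<integral> z. (\<integral> t. F (z + t *\<^sub>R v k) \<partial>lborel) \<partial>coord_lebesgue v I)"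
    unfolding coord_lebesgue_def by (subst integral_distr) auto
  finally show ?thesis .
qed

lemma nn_integral_lborel_shift:
  assumes [measurable]: "f \<in> borel_measurable borel"
  shows "(\<integral>\<^sup>+ t. f (t + c) \<partial>lborel) = (\<integral>\<^sup>+ t. f t \<partial>(lborel::real measure))"
  using nn_integral_real_affine[of f 1 c] by (simp add: add.commute)

text \<open>The value at 0 is set to \<infinity> because \<open>0 powr - a\<close> is 0 in HOL;
  products of these weights then still dominate 1 / |z|^m where a coordinate vanishes. A single
  point does not affect the integral.\<close>

lemma nn_integral_abs_powr_finite:
  fixes a R :: real
  assumes a: "a < 1"
  shows "(\<integral>\<^sup>+ t. indicator {-R..R} t * (if t = 0 then \<infinity> else ennreal (\<bar>t\<bar> powr - a)) \<partial>lborel) < \<infinity>"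
proof (cases "R \<ge> 0")
  case True
  define g where "g t = indicator {0..R} t * ennreal (t powr - a)" for t
  have [measurable]: "g \<in> borel_measurable borel" unfolding g_def by measurable
  have "integral\<^sup>N lborel (\<lambda>x. ennreal (x powr - a) * indicator {0..R} x) = ennreal (R powr (- a + 1) / (- a + 1))"
    by (rule nn_integral_has_integral_lebesgue') (use a True has_integral_powr_from_0[of "-a" R] in auto)
  then have g: "(\<integral>\<^sup>+ t. g t \<partial>lborel) < \<infinity>" by (simp add: g_def mult.commute)
  have "(\<integral>\<^sup>+ t. indicator {-R..R} t * (if t = 0 then \<infinity> else ennreal (\<bar>t\<bar> powr - a)) \<partial>lborel)
     \<le> (\<integral>\<^sup>+ t. g t + g (0 + (-1) * t) \<partial>lborel)"
  proof (rule nn_integral_mono_AE)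
    have "AE t in lborel. t \<noteq> (0::real)" by (rule AE_lborel_singleton)
    then show "AE t in lborel. indicator {-R..R} t * (if t = 0 then \<infinity> else ennreal (\<bar>t\<bar> powr - a)) \<le> g t + g (0 + (-1) * t)"
      by (rule AE_mp) (auto intro!: AE_I2 simp: g_def abs_if split: split_indicator)
  qed
  also have "\<dots> = (\<integral>\<^sup>+ t. g t \<partial>lborel) + (\<integral>\<^sup>+ t. g (0 + (-1) * t) \<partial>lborel)"
    by (rule nn_integral_add) auto
  also have "(\<integral>\<^sup>+ t. g (0 + (-1) * t) \<partial>lborel) = (\<integral>\<^sup>+ t. g t \<partial>lborel)"
    using nn_integral_real_affine[of g "-1" 0] by simp
  also have "(\<integral>\<^sup>+ t. g t \<partial>lborel) + (\<integral>\<^sup>+ t. g t \<partial>lborel) < \<infinity>" using g by simp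
  finally show ?thesis .
qed auto

section \<open>Coordinate subspaces, shears, and integrability of the kernel singularity\<close>

context orthonormal_frame
begin

text \<open>The subspace that carries \<open>coord_lebesgue v I\<close>. That measure lives on the
  ambient space, so identities relying on membership in \<open>M\<close> or on vanishing coordinates
  hold almost everywhere only.\<close>

definition coord_space :: "nat set \<Rightarrow> 'a set" where
  "coord_space I = {z \<in> M. \<forall>j\<le>m. j \<notin> I \<longrightarrow> z \<bullet> v j = 0}"

lemma coord_sum_in_coord_space: "I \<subseteq> {..m} \<Longrightarrow> (\<Sum>s\<in>I. c s *\<^sub>R v s) \<in> coord_space I"
  by (simp add: coord_space_def frame_sum inner_sum_frame)

lemma coord_spaceD: "z \<in> coord_space I \<Longrightarrow> z \<in> M" "z \<in> coord_space I \<Longrightarrow> j \<le> m \<Longrightarrow> j \<notin> I \<Longrightarrow> z \<bullet> v j = 0"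
  by (auto simp: coord_space_def)

lemma closed_coord_space: "closed (coord_space I)"
proof -
  have "coord_space I = M \<inter> (\<Inter>j\<in>{..m} - I. {z. v j \<bullet> z = 0})"
    by (auto simp: coord_space_def inner_commute)
  then show ?thesis by (auto intro!: closed_Int closed_frame closed_hyperplane)
qed

lemma borel_frame [measurable, simp]: "M \<in> sets borel"
  by (simp add: borel_closed closed_frame)

lemma AE_coord_space:
  assumes "I \<subseteq> {..m}"
  shows "AE z in coord_lebesgue v I. z \<in> coord_space I"
proof -
  have [measurable]: "coord_space I \<in> sets borel" by (simp add: borel_closed closed_coord_space)
  have "{z. z \<in> coord_space I} \<in> sets borel" by simp
  then show ?thesis unfolding coord_lebesgue_def
    by (subst AE_distr_iff) (auto simp: coord_sum_in_coord_space[OF assms])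
qed

lemma emeasure_coord_cball_finite:
  assumes "I \<subseteq> {..m}"
  shows "emeasure (coord_lebesgue v I) (cball 0 R) < \<infinity>"
proof -
  have fin: "finite I" using assms finite_subset by blast
  have "emeasure (coord_lebesgue v I) (cball 0 R) =
     emeasure (PiM I (\<lambda>_. lborel)) ((\<lambda>x. \<Sum>s\<in>I. x s *\<^sub>R v s) -` cball 0 R \<inter> space (PiM I (\<lambda>_. lborel)))"
    unfolding coord_lebesgue_def by (rule emeasure_distr) auto
  also have "\<dots> \<le> emeasure (PiM I (\<lambda>_. lborel)) (Pi\<^sub>E I (\<lambda>_. {-R..R}))"
  proof (rule emeasure_mono)
    show "(\<lambda>x. \<Sum>s\<in>I. x s *\<^sub>R v s) -` cball 0 R \<inter> space (PiM I (\<lambda>_. lborel)) \<subseteq> Pi\<^sub>E I (\<lambda>_. {-R..R})"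
    proof (rule subsetI)
      fix x assume "x \<in> (\<lambda>x. \<Sum>s\<in>I. x s *\<^sub>R v s) -` cball 0 R \<inter> space (PiM I (\<lambda>_. lborel))"
      then have x: "(\<Sum>s\<in>I. x s *\<^sub>R v s) \<in> cball 0 R" "x \<in> space (PiM I (\<lambda>_. lborel))" by auto
      have "\<bar>x s\<bar> \<le> R" if "s \<in> I" for s
        using abs_inner_frame_le[of s "\<Sum>s\<in>I. x s *\<^sub>R v s"] inner_sum_frame[OF assms, of s x] x that assms by auto
      then show "x \<in> Pi\<^sub>E I (\<lambda>_. {-R..R})" using x
        by (auto simp: space_PiM PiE_iff abs_le_iff minus_le_iff)
    qed
    show "Pi\<^sub>E I (\<lambda>_. {-R..R}) \<in> sets (PiM I (\<lambda>_. lborel))" using fin by (intro sets_PiM_I_finite) auto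
  qed
  also have "\<dots> = (\<Prod>i\<in>I. emeasure lborel {-R..R})"
    using fin by (intro lborel_product.emeasure_PiM) auto
  also have "\<dots> < \<infinity>"
    by (auto simp: less_top[symmetric] power_eq_top_ennreal emeasure_lborel_Icc_eq)
  finally show ?thesis .
qed

lemma integrable_coord_bounded:
  fixes F :: "'a \<Rightarrow> 'b::{banach, second_countable_topology}"
  assumes "I \<subseteq> {..m}" "F \<in> borel_measurable borel" "\<And>z. norm (F z) \<le> C" "\<And>z. norm z > R \<Longrightarrow> F z = 0"
  shows "integrable (coord_lebesgue v I) F"
proof (rule integrableI_bounded_set[of "cball 0 R" _ _ C])
  show "emeasure (coord_lebesgue v I) (cball 0 R) < \<infinity>"
    by (rule emeasure_coord_cball_finite) fact
qed (use assms in \<open>auto simp: not_le measurable_def\<close>)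

lemma atMost_insert: "k \<le> m \<Longrightarrow> insert k ({..m} - {k}) = {..m}"
  by auto

text \<open>On each line parallel to \<open>v k\<close> the map is a translation, since w is
  constant there; Tonelli along \<open>v k\<close> gives the rest. Measurability of w is the only
  regularity used.\<close>

lemma distr_volume_shear:
  assumes k: "k \<le> m" and [measurable]: "w \<in> borel_measurable borel" and w: "\<And>z t. w (z + t *\<^sub>R v k) = w z"
  shows "distr (coord_lebesgue v {..m}) borel (\<lambda>z. z + w z *\<^sub>R v k) = coord_lebesgue v {..m}"
proof (rule measure_eqI)
  fix B assume "B \<in> sets (distr (coord_lebesgue v {..m}) borel (\<lambda>z. z + w z *\<^sub>R v k))"
  then have [measurable]: "B \<in> sets borel" by simp
  let ?I = "{..m} - {k}"
  have fk: "finite ?I" "k \<notin> ?I" by auto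
  have "emeasure (distr (coord_lebesgue v {..m}) borel (\<lambda>z. z + w z *\<^sub>R v k)) B
     = (\<integral>\<^sup>+z. indicator B z \<partial>distr (coord_lebesgue v {..m}) borel (\<lambda>z. z + w z *\<^sub>R v k))"
    by simp
  also have "\<dots> = (\<integral>\<^sup>+z. indicator B (z + w z *\<^sub>R v k) \<partial>coord_lebesgue v (insert k ?I))"
    unfolding atMost_insert[OF k] by (rule nn_integral_distr) auto
  also have "\<dots> = (\<integral>\<^sup>+z. \<integral>\<^sup>+t. indicator B ((z + t *\<^sub>R v k) + w (z + t *\<^sub>R v k) *\<^sub>R v k) \<partial>lborel \<partial>coord_lebesgue v ?I)"
    by (rule nn_integral_coord_insert[OF fk]) measurable
  also have "\<dots> = (\<integral>\<^sup>+z. \<integral>\<^sup>+t. indicator B (z + (t + w z) *\<^sub>R v k) \<partial>lborel \<partial>coord_lebesgue v ?I)"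
    by (simp add: w scaleR_add_left add.assoc)
  also have "\<dots> = (\<integral>\<^sup>+z. \<integral>\<^sup>+t. indicator B (z + t *\<^sub>R v k) \<partial>lborel \<partial>coord_lebesgue v ?I)"
    by (intro nn_integral_cong nn_integral_lborel_shift) measurable
  also have "\<dots> = (\<integral>\<^sup>+z. indicator B z \<partial>coord_lebesgue v (insert k ?I))"
    by (rule nn_integral_coord_insert[OF fk, symmetric]) measurable
  finally show "emeasure (distr (coord_lebesgue v {..m}) borel (\<lambda>z. z + w z *\<^sub>R v k)) B = emeasure (coord_lebesgue v {..m}) B"
    unfolding atMost_insert[OF k] by simp
qed simp

text \<open>A translation by a vector of \<open>M\<close> is a composition of shears with constant
  w, one for each coordinate.\<close>

lemma distr_volume_translation:
  assumes "x \<in> M"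
  shows "distr (coord_lebesgue v {..m}) borel (\<lambda>z. z + x) = coord_lebesgue v {..m}"
proof -
  have "distr (coord_lebesgue v {..m}) borel (\<lambda>z. z + (\<Sum>s\<in>I. (x \<bullet> v s) *\<^sub>R v s)) = coord_lebesgue v {..m}"
    if "finite I" "I \<subseteq> {..m}" for I
    using that
  proof (induction I)
    case empty
    show ?case by (simp add: distr_id2)
  next
    case (insert k I)
    let ?y = "\<Sum>s\<in>I. (x \<bullet> v s) *\<^sub>R v s"
    have "coord_lebesgue v {..m} = distr (distr (coord_lebesgue v {..m}) borel (\<lambda>z. z + ?y)) borel (\<lambda>z. z + (x \<bullet> v k) *\<^sub>R v k)"
      using insert distr_volume_shear[of k "\<lambda>_. x \<bullet> v k"] by simp
    also have "\<dots> = distr (coord_lebesgue v {..m}) borel (\<lambda>z. z + (\<Sum>s\<in>insert k I. (x \<bullet> v s) *\<^sub>R v s))"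
      using insert by (subst distr_distr) (auto simp: o_def add_ac)
    finally show ?case by simp
  qed
  from this[of "{..m}"] show ?thesis using frame_expand[OF assms] by simp
qed

lemma emeasure_volume_cball:
  assumes "r > 0"
  shows "emeasure (coord_lebesgue v {..m}) (cball 0 r) = ennreal (unit_ball_vol (real m + 1) * r ^ (m + 1))"
proof -
  have "emeasure (coord_lebesgue v {..m}) (cball 0 r) =
     emeasure (PiM {..m} (\<lambda>_. lborel)) ((\<lambda>x. \<Sum>s\<le>m. x s *\<^sub>R v s) -` cball 0 r \<inter> space (PiM {..m} (\<lambda>_. lborel)))"
    unfolding coord_lebesgue_def by (rule emeasure_distr) auto
  also have "(\<lambda>x. \<Sum>s\<le>m. x s *\<^sub>R v s) -` cball 0 r = {f. sqrt (\<Sum>i\<in>{..m}. (f i)\<^sup>2) \<le> r}"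
  proof -
    have "sqrt (\<Sum>i\<le>m. (f i)\<^sup>2) = norm (\<Sum>s\<le>m. f s *\<^sub>R v s)" for f
      using norm_frame_sum[of "{..m}" f] by (simp add: real_sqrt_unique)
    then show ?thesis by auto
  qed
  also have "emeasure (PiM {..m} (\<lambda>_. lborel)) ({f. sqrt (\<Sum>i\<in>{..m}. (f i)\<^sup>2) \<le> r} \<inter> space (PiM {..m} (\<lambda>_. lborel)))
     = ennreal (unit_ball_vol (real m + 1) * r ^ (m + 1))"
    using emeasure_cball_aux[of "{..m}" r] assms by (simp add: add.commute)
  finally show ?thesis .
qed

text \<open>By \<open>\<bar>z\<bar> \<ge> \<bar>z\<^sub>s\<bar>\<close> for all \<open>s\<close>, \<open>1 / \<bar>z\<bar>\<^sup>m \<le> (\<Prod>s\<le>m. \<bar>z\<^sub>s\<bar> powr - (m / (m + 1)))\<close>,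
  a product of locally integrable functions of one variable.\<close>

lemma nn_integral_inverse_norm_power_finite:
  "(\<integral>\<^sup>+ z. indicator (cball 0 R) z * ennreal (1 / norm z ^ m) \<partial>coord_lebesgue v {..m}) < \<infinity>"
proof -
  define a where "a = real m / (real m + 1)"
  have a: "a < 1" "0 \<le> a" by (auto simp: a_def field_simps)
  define g where "g t = indicator {-R..R} t * (if t = 0 then \<infinity> else ennreal (\<bar>t\<bar> powr - a))" for t :: real
  have [measurable]: "g \<in> borel_measurable borel" unfolding g_def by measurable
  have "(\<integral>\<^sup>+ z. indicator (cball 0 R) z * ennreal (1 / norm z ^ m) \<partial>coord_lebesgue v {..m})
     = (\<integral>\<^sup>+ x. indicator (cball 0 R) (\<Sum>s\<le>m. x s *\<^sub>R v s) * ennreal (1 / norm (\<Sum>s\<le>m. x s *\<^sub>R v s) ^ m) \<partial>PiM {..m} (\<lambda>_. lborel))"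
  proof -
    have [measurable]: "cball (0::'a) R \<in> sets borel" by simp
    show ?thesis unfolding coord_lebesgue_def by (subst nn_integral_distr) measurable
  qed
  also have "\<dots> \<le> (\<integral>\<^sup>+ x. (\<Prod>s\<le>m. g (x s)) \<partial>PiM {..m} (\<lambda>_. lborel))"
  proof (rule nn_integral_mono)
    fix x :: "nat \<Rightarrow> real"
    define z where "z = (\<Sum>s\<le>m. x s *\<^sub>R v s)"
    have xz: "\<bar>x s\<bar> \<le> norm z" if "s \<le> m" for s
      using abs_inner_frame_le[OF that, of z] inner_sum_frame[of "{..m}" s x] that by (simp add: z_def)
    show "indicator (cball 0 R) z * ennreal (1 / norm z ^ m) \<le> (\<Prod>s\<le>m. g (x s))"
    proof (cases "norm z \<le> R")
      case True
      then have ind: "x s \<in> {-R..R}" if "s \<le> m" for s using xz[OF that] by auto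
      show ?thesis
      proof (cases "\<exists>s\<le>m. x s = 0")
        case True
        then obtain s where s: "s \<le> m" "x s = 0" by blast
        \<comment> \<open>All coordinates lie in [-R, R], so no factor vanishes and the infinite
          factor makes the whole product infinite.\<close>
        have "g (x i) \<noteq> 0" if "i \<le> m" for i
          using ind[OF that] by (auto simp: g_def)
        moreover have "g (x s) = top" using ind[OF s(1)] s by (simp add: g_def)
        ultimately have "(\<Prod>s\<le>m. g (x s)) = top"
          using s by (subst ennreal_prod_eq_top) (auto intro!: bexI[of _ s])
        then show ?thesis by simp
      next
        case False
        then have nz: "x s \<noteq> 0" if "s \<le> m" for s using that by auto
        have zpos: "norm z > 0" using xz[of 0] nz[of 0] by auto
        have "1 / norm z ^ m = (norm z powr - a) ^ (m + 1)"
        proof -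
          have "(norm z powr - a) ^ (m + 1) = (norm z powr - a) powr real (m + 1)"
            by (subst powr_realpow) (use zpos in auto)
          also have "\<dots> = norm z powr (- a * real (m + 1))" by (rule powr_powr)
          also have "- a * real (m + 1) = - real m" by (simp add: a_def add.commute)
          finally show ?thesis using zpos by (simp add: powr_minus powr_realpow divide_inverse)
        qed
        also have "\<dots> = (\<Prod>s\<le>m. norm z powr - a)" by simp
        also have "\<dots> \<le> (\<Prod>s\<le>m. \<bar>x s\<bar> powr - a)"
        proof (rule prod_mono, safe)
          fix s assume "s \<le> m"
          then show "norm z powr - a \<le> \<bar>x s\<bar> powr - a"
            using nz xz a by (intro powr_mono2') auto
        qed auto
        finally have "ennreal (1 / norm z ^ m) \<le> ennreal (\<Prod>s\<le>m. \<bar>x s\<bar> powr - a)"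
          by (rule ennreal_leI)
        also have "\<dots> = (\<Prod>s\<le>m. ennreal (\<bar>x s\<bar> powr - a))"
          by (subst prod_ennreal) auto
        also have "\<dots> = (\<Prod>s\<le>m. g (x s))"
          using nz ind by (intro prod.cong) (auto simp: g_def)
        finally show ?thesis using \<open>norm z \<le> R\<close> by (simp split: split_indicator)
      qed
    qed (simp split: split_indicator)
  qed
  also have "\<dots> = (\<Prod>s\<le>m. \<integral>\<^sup>+ t. g t \<partial>lborel)"
    by (rule lborel_product.product_nn_integral_prod) auto
  also have "\<dots> < \<infinity>"
  proof -
    have "(\<integral>\<^sup>+ t. g t \<partial>lborel) \<noteq> top"
      using nn_integral_abs_powr_finite[OF a(1), of R] by (simp add: g_def less_top)
    then have "(\<integral>\<^sup>+ t. g t \<partial>lborel) ^ card {..m} \<noteq> top"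
      by (subst power_eq_top_ennreal) auto
    then show ?thesis unfolding prod_constant by (simp only: less_top infinity_ennreal_def)
  qed
  finally show ?thesis .
qed

end

section \<open>The divergence theorem above a graph\<close>

text \<open>The fundamental theorem of calculus with one-sided data: g is only continuous at the end
  point a. The sign \<sigma> selects [a, \<infinity>) or (-\<infinity>, a]; the far end contributes
  nothing because g vanishes there.\<close>

lemma half_line_integral:
  fixes g g' :: "real \<Rightarrow> 'b::euclidean_space"
  assumes \<sigma>: "\<sigma> = 1 \<or> \<sigma> = (-1::real)"
    and g: "continuous_on {t. \<sigma> * (t - a) \<ge> 0} g" and g': "continuous_on {t. \<sigma> * (t - a) \<ge> 0} g'"
    and der: "\<And>t. \<sigma> * (t - a) > 0 \<Longrightarrow> (g has_vector_derivative g' t) (at t)"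
    and zero: "\<And>t. \<bar>t\<bar> > R \<Longrightarrow> \<sigma> * (t - a) \<ge> 0 \<Longrightarrow> g t = 0 \<and> g' t = 0"
  shows "(\<integral>t. indicator {t. \<sigma> * (t - a) > 0} t *\<^sub>R g' t \<partial>lborel) = - \<sigma> *\<^sub>R g a"
proof -
  \<comment> \<open>Larger than |a| and |R|, so g vanishes at whichever of b, -b is the far
    end.\<close>
  define b where "b = \<bar>a\<bar> + \<bar>R\<bar> + 1"
  define l u where "l = (if \<sigma> = 1 then a else - b)" and "u = (if \<sigma> = 1 then b else a)"
  have lu: "l \<le> u" by (auto simp: l_def u_def b_def)
  have sub: "{l..u} \<subseteq> {t. \<sigma> * (t - a) \<ge> 0}" using \<sigma> by (auto simp: l_def u_def)
  have meas1: "(\<lambda>t. indicator {t. \<sigma> * (t - a) > 0} t *\<^sub>R g' t) \<in> borel_measurable borel"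
  proof (rule borel_measurable_continuous_on_indicator)
    show "continuous_on {t. \<sigma> * (t - a) > 0} g'" using g' by (rule continuous_on_subset) auto
    show "{t. \<sigma> * (t - a) > 0} \<in> sets borel" by measurable
  qed
  have meas2: "(\<lambda>t. indicator {l..u} t *\<^sub>R g' t) \<in> borel_measurable borel"
    by (rule borel_measurable_continuous_on_indicator) (auto intro: continuous_on_subset[OF g' sub])
  have "(\<integral>t. indicator {t. \<sigma> * (t - a) > 0} t *\<^sub>R g' t \<partial>lborel) = (\<integral>t. indicator {l..u} t *\<^sub>R g' t \<partial>lborel)"
  proof (rule integral_cong_AE)
    have "AE t in lborel. t \<noteq> a" by (rule AE_lborel_singleton)
    then show "AE t in lborel. indicator {t. \<sigma> * (t - a) > 0} t *\<^sub>R g' t = indicator {l..u} t *\<^sub>R g' t"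
    proof (rule AE_mp, intro AE_I2 impI)
      fix t assume "t \<noteq> a"
      then show "indicator {t. \<sigma> * (t - a) > 0} t *\<^sub>R g' t = indicator {l..u} t *\<^sub>R g' t"
        using zero[of t] \<sigma> by (auto simp: l_def u_def b_def split: split_indicator)
    qed
  qed (use meas1 meas2 in auto)
  also have "\<dots> = integral {l..u} g'"
    using set_borel_integral_eq_integral(2)[OF borel_integrable_atLeastAtMost'[OF continuous_on_subset[OF g' sub]]]
    by (simp add: set_lebesgue_integral_def)
  also have "\<dots> = g u - g l"
  proof (rule integral_unique, rule fundamental_theorem_of_calculus_interior[OF lu])
    show "continuous_on {l..u} g" by (rule continuous_on_subset[OF g sub])
    show "(g has_vector_derivative g' t) (at t)" if "t \<in> {l<..<u}" for t
      using that \<sigma> by (intro der) (auto simp: l_def u_def)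
  qed
  also have "\<dots> = - \<sigma> *\<^sub>R g a"
    using \<sigma> zero[of b] zero[of "-b"] by (auto simp: l_def u_def b_def)
  finally show ?thesis .
qed

lemma line_integral_derivative_eq_0:
  fixes g g' :: "real \<Rightarrow> 'b::euclidean_space"
  assumes g': "continuous_on UNIV g'"
    and der: "\<And>t. (g has_vector_derivative g' t) (at t)"
    and zero: "\<And>t. \<bar>t\<bar> > R \<Longrightarrow> g t = 0 \<and> g' t = 0"
  shows "(\<integral>t. g' t \<partial>lborel) = 0"
proof -
  \<comment> \<open>A starting point left of the support: the half line carries the whole integral
    and the boundary term is 0.\<close>
  define a where "a = - \<bar>R\<bar> - 1"
  have "continuous_on UNIV g"
    by (intro continuous_at_imp_continuous_on ballI) (rule has_vector_derivative_continuous[OF der])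
  then have "(\<integral>t. indicator {t. 1 * (t - a) > 0} t *\<^sub>R g' t \<partial>lborel) = - 1 *\<^sub>R g a"
    using der zero continuous_on_subset[OF g'] continuous_on_subset[of UNIV g]
    by (intro half_line_integral[of 1 a g g' R]) simp_all
  also have "(\<lambda>t. indicator {t. 1 * (t - a) > 0} t *\<^sub>R g' t) = g'"
    using zero by (auto simp: fun_eq_iff a_def split: split_indicator)
  finally show ?thesis using zero[of a] by (simp add: a_def)
qed

text \<open>The function may jump across the boundary of C, as an extension by zero does; it is
  still Borel, and bounded by compactness of the relevant part of C.\<close>

lemma supported_continuous:
  fixes h :: "'a::euclidean_space \<Rightarrow> 'b::euclidean_space"
  assumes C: "closed C" and h: "continuous_on C h" and zero: "\<And>z. z \<notin> C \<or> norm z > R \<Longrightarrow> h z = 0"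
  shows "h \<in> borel_measurable borel" "\<exists>B. \<forall>z. norm (h z) \<le> B"
proof -
  have "(\<lambda>z. indicator C z *\<^sub>R h z) = h" using zero by (auto simp: fun_eq_iff split: split_indicator)
  then show "h \<in> borel_measurable borel"
    using borel_measurable_continuous_on_indicator[OF _ h] C by (auto simp: borel_closed)
  have "compact (C \<inter> cball 0 R)" using C by (simp add: closed_Int_compact)
  then have "bounded (h ` (C \<inter> cball 0 R))"
    by (intro compact_imp_bounded compact_continuous_image continuous_on_subset[OF h]) auto
  then obtain B where B: "\<And>z. z \<in> C \<inter> cball 0 R \<Longrightarrow> norm (h z) \<le> B"
    unfolding bounded_iff by blast
  have "norm (h z) \<le> max B 0" for z
    using B[of z] zero[of z] by (cases "z \<in> C \<inter> cball 0 R") auto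
  then show "\<exists>B. \<forall>z. norm (h z) \<le> B" by blast
qed

section \<open>Integration over one side of a graph\<close>

context orthonormal_frame
begin

text \<open>Continuity is required on the whole space, which gives Borel measurability for measures
  on the ambient type; differentiability is required on \<open>M\<close> only. The derivatives are
  an explicit argument, and like \<gamma> they do not see \<open>v k\<close>, so passing from a base
  point to the graph point above it leaves them unchanged.\<close>

definition C1_graph :: "nat \<Rightarrow> ('a \<Rightarrow> real) \<Rightarrow> (nat \<Rightarrow> 'a \<Rightarrow> real) \<Rightarrow> bool" where
  "C1_graph k \<gamma> \<gamma>' \<longleftrightarrow> k \<le> m \<and> continuous_on UNIV \<gamma> \<and> (\<forall>z t. \<gamma> (z + t *\<^sub>R v k) = \<gamma> z) \<and>
     (\<forall>s\<le>m. continuous_on UNIV (\<gamma>' s) \<and> (\<forall>z t. \<gamma>' s (z + t *\<^sub>R v k) = \<gamma>' s z) \<and>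
        (\<forall>z\<in>M. ((\<lambda>t. \<gamma> (z + t *\<^sub>R v s)) has_vector_derivative \<gamma>' s z) (at 0)))"

lemma C1_graphD:
  assumes "C1_graph k \<gamma> \<gamma>'"
  shows "k \<le> m" "continuous_on S \<gamma>" "\<gamma> (z + t *\<^sub>R v k) = \<gamma> z"
    "s \<le> m \<Longrightarrow> continuous_on S (\<gamma>' s)" "s \<le> m \<Longrightarrow> \<gamma>' s (z + t *\<^sub>R v k) = \<gamma>' s z"
    "s \<le> m \<Longrightarrow> z \<in> M \<Longrightarrow> ((\<lambda>t. \<gamma> (z + t *\<^sub>R v s)) has_vector_derivative \<gamma>' s z) (at 0)"
  using assms by (auto simp: C1_graph_def intro: continuous_on_subset)

lemma C1_graph_has_derivative:
  assumes "C1_graph k \<gamma> \<gamma>'" "z \<in> M"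
  shows "(\<gamma> has_derivative (\<lambda>w. \<Sum>s\<le>m. (w \<bullet> v s) *\<^sub>R \<gamma>' s z)) (at z within M)"
  by (rule C1_frame_has_derivative[of M]) (use assms in \<open>auto intro: C1_graphD\<close>)

lemma C1_graph_self_derivative:
  assumes "C1_graph k \<gamma> \<gamma>'" "z \<in> M"
  shows "\<gamma>' k z = 0"
proof -
  have "((\<lambda>t. \<gamma> (z + t *\<^sub>R v k)) has_vector_derivative \<gamma>' k z) (at 0)"
    using C1_graphD(6)[OF assms(1) C1_graphD(1)[OF assms(1)] assms(2)] .
  moreover have "((\<lambda>t. \<gamma> (z + t *\<^sub>R v k)) has_vector_derivative 0) (at 0)"
    by (simp add: C1_graphD(3)[OF assms(1)])
  ultimately show ?thesis using vector_derivative_unique_at by blast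
qed

definition side :: "nat \<Rightarrow> real \<Rightarrow> ('a \<Rightarrow> real) \<Rightarrow> 'a set" where
  "side k \<sigma> \<gamma> = {z \<in> M. \<sigma> * (z \<bullet> v k - \<gamma> z) > 0}"

definition closed_side :: "nat \<Rightarrow> real \<Rightarrow> ('a \<Rightarrow> real) \<Rightarrow> 'a set" where
  "closed_side k \<sigma> \<gamma> = {z \<in> M. \<sigma> * (z \<bullet> v k - \<gamma> z) \<ge> 0}"

lemma side_subset: "side k \<sigma> \<gamma> \<subseteq> closed_side k \<sigma> \<gamma>" "closed_side k \<sigma> \<gamma> \<subseteq> M" "side k \<sigma> \<gamma> \<subseteq> M"
  by (auto simp: side_def closed_side_def)

lemma openin_side:
  assumes "continuous_on UNIV \<gamma>"
  shows "openin (top_of_set M) (side k \<sigma> \<gamma>)"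
proof -
  have "open {z. \<sigma> * (z \<bullet> v k - \<gamma> z) > 0}"
    by (intro open_Collect_less continuous_intros assms)
  moreover have "side k \<sigma> \<gamma> = M \<inter> {z. \<sigma> * (z \<bullet> v k - \<gamma> z) > 0}" by (auto simp: side_def)
  ultimately show ?thesis by (simp add: openin_open_Int)
qed

lemma closed_closed_side:
  assumes "continuous_on UNIV \<gamma>"
  shows "closed (closed_side k \<sigma> \<gamma>)"
proof -
  have "closed {z. \<sigma> * (z \<bullet> v k - \<gamma> z) \<ge> 0}"
    by (intro closed_Collect_le continuous_intros assms)
  moreover have "closed_side k \<sigma> \<gamma> = M \<inter> {z. \<sigma> * (z \<bullet> v k - \<gamma> z) \<ge> 0}" by (auto simp: closed_side_def)
  ultimately show ?thesis by (simp add: closed_Int closed_frame)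
qed

lemma borel_side:
  assumes "continuous_on UNIV \<gamma>"
  shows "side k \<sigma> \<gamma> \<in> sets borel"
proof -
  obtain T where "open T" "side k \<sigma> \<gamma> = M \<inter> T"
    using openin_side[OF assms] unfolding openin_open by blast
  then show ?thesis by auto
qed

lemma graph_side_iff:
  assumes "C1_graph k \<gamma> \<gamma>'" "z \<in> M" "z \<bullet> v k = 0"
  shows "z + t *\<^sub>R v k \<in> side k \<sigma> \<gamma> \<longleftrightarrow> \<sigma> * (t - \<gamma> z) > 0"
    "z + t *\<^sub>R v k \<in> closed_side k \<sigma> \<gamma> \<longleftrightarrow> \<sigma> * (t - \<gamma> z) \<ge> 0"
  using assms C1_graphD(1,3)[OF assms(1)]
  by (auto simp: side_def closed_side_def inner_add_left frame_orthonormal)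

text \<open>On a line parallel to \<open>v k\<close> the domain is a half line starting at the
  graph, so \<open>half_line_integral\<close> evaluates the inner integral; the weight is constant
  on the line and factors out. A weight is included because the tangential case calls this lemma
  with the weight \<open>\<gamma>' s\<close>.\<close>

lemma integral_side_normal_weighted:
  fixes h h' :: "'a \<Rightarrow> 'b::euclidean_space"
  assumes G: "C1_graph k \<gamma> \<gamma>'" and \<sigma>: "\<sigma> = 1 \<or> \<sigma> = -1"
    and w: "continuous_on UNIV w" "\<And>z t. w (z + t *\<^sub>R v k) = w z"
    and h: "continuous_on (closed_side k \<sigma> \<gamma>) h" "\<And>z. z \<notin> closed_side k \<sigma> \<gamma> \<or> norm z > R \<Longrightarrow> h z = 0"
    and h': "continuous_on (closed_side k \<sigma> \<gamma>) h'" "\<And>z. z \<notin> closed_side k \<sigma> \<gamma> \<or> norm z > R \<Longrightarrow> h' z = 0"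
    and der: "\<And>z. z \<in> side k \<sigma> \<gamma> \<Longrightarrow> ((\<lambda>t. h (z + t *\<^sub>R v k)) has_vector_derivative h' z) (at 0)"
  shows "(\<integral>z. indicator (side k \<sigma> \<gamma>) z *\<^sub>R (w z *\<^sub>R h' z) \<partial>coord_lebesgue v {..m}) =
     - \<sigma> *\<^sub>R (\<integral>z. w z *\<^sub>R h (z + \<gamma> z *\<^sub>R v k) \<partial>coord_lebesgue v ({..m} - {k}))"
proof -
  let ?I = "{..m} - {k}"
  let ?D = "side k \<sigma> \<gamma>" and ?C = "closed_side k \<sigma> \<gamma>"
  have k: "k \<le> m" and \<gamma>: "continuous_on UNIV \<gamma>" using C1_graphD[OF G] by blast+
  have C: "closed ?C" by (rule closed_closed_side[OF \<gamma>])
  have [measurable]: "?D \<in> sets borel" by (rule borel_side[OF \<gamma>])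
  have [measurable]: "h \<in> borel_measurable borel" "h' \<in> borel_measurable borel"
    "w \<in> borel_measurable borel" "\<gamma> \<in> borel_measurable borel"
    using supported_continuous(1)[OF C h] supported_continuous(1)[OF C h'] w(1) \<gamma>
    by (auto intro: borel_measurable_continuous_onI)
  define F where "F z = indicator ?D z *\<^sub>R (w z *\<^sub>R h' z)" for z
  have [measurable]: "F \<in> borel_measurable borel" unfolding F_def by measurable
  have "\<exists>B. \<forall>z. norm (w z *\<^sub>R h' z) \<le> B"
  proof (rule supported_continuous(2)[OF C])
    show "continuous_on ?C (\<lambda>z. w z *\<^sub>R h' z)"
      using h'(1) w(1) by (auto intro!: continuous_intros intro: continuous_on_subset)
  qed (use h'(2) in auto)
  then obtain B where B: "\<And>z. norm (w z *\<^sub>R h' z) \<le> B" by blast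
  have B0: "B \<ge> 0" using B[of 0] norm_ge_zero order_trans by blast
  have "integrable (coord_lebesgue v {..m}) F"
  proof (rule integrable_coord_bounded[of _ _ B R])
    show "norm (F z) \<le> B" for z using B[of z] B0 by (auto simp: F_def split: split_indicator)
  qed (use h'(2) in \<open>auto simp: F_def\<close>)
  then have int: "integrable (coord_lebesgue v (insert k ?I)) F" by (simp only: atMost_insert[OF k])
  have "(\<integral>z. F z \<partial>coord_lebesgue v {..m}) = (\<integral>z. F z \<partial>coord_lebesgue v (insert k ?I))"
    by (simp only: atMost_insert[OF k])
  also have "\<dots> = (\<integral>z. (\<integral>t. F (z + t *\<^sub>R v k) \<partial>lborel) \<partial>coord_lebesgue v ?I)"
    by (rule integral_coord_insert[OF _ _ int]) auto
  also have "\<dots> = (\<integral>z. - \<sigma> *\<^sub>R (w z *\<^sub>R h (z + \<gamma> z *\<^sub>R v k)) \<partial>coord_lebesgue v ?I)"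
  proof (rule integral_cong_AE)
    show "AE z in coord_lebesgue v ?I. (\<integral>t. F (z + t *\<^sub>R v k) \<partial>lborel) = - \<sigma> *\<^sub>R (w z *\<^sub>R h (z + \<gamma> z *\<^sub>R v k))"
    proof (rule AE_mp[OF AE_coord_space[of ?I]], simp, intro AE_I2 impI)
      fix z assume "z \<in> coord_space ?I"
      then have z: "z \<in> M" "z \<bullet> v k = 0" using coord_spaceD k by auto
      have cl: "continuous_on {t. \<sigma> * (t - \<gamma> z) \<ge> 0} (\<lambda>t. q (z + t *\<^sub>R v k))" if "continuous_on ?C q" for q :: "'a \<Rightarrow> 'b"
        by (rule continuous_on_compose2[OF that]) (auto intro!: continuous_intros simp: graph_side_iff[OF G z])
      have "(\<integral>t. F (z + t *\<^sub>R v k) \<partial>lborel) = (\<integral>t. w z *\<^sub>R (indicator {t. \<sigma> * (t - \<gamma> z) > 0} t *\<^sub>R h' (z + t *\<^sub>R v k)) \<partial>lborel)"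
        by (intro Bochner_Integration.integral_cong) (auto simp: F_def w(2) graph_side_iff[OF G z] split: split_indicator)
      also have "\<dots> = w z *\<^sub>R (\<integral>t. indicator {t. \<sigma> * (t - \<gamma> z) > 0} t *\<^sub>R h' (z + t *\<^sub>R v k) \<partial>lborel)"
        by (rule integral_scaleR_right)
      also have "(\<integral>t. indicator {t. \<sigma> * (t - \<gamma> z) > 0} t *\<^sub>R h' (z + t *\<^sub>R v k) \<partial>lborel) = - \<sigma> *\<^sub>R h (z + \<gamma> z *\<^sub>R v k)"
      proof (rule half_line_integral[OF \<sigma>, where R = R])
        show "((\<lambda>t. h (z + t *\<^sub>R v k)) has_vector_derivative h' (z + t *\<^sub>R v k)) (at t)" if "0 < \<sigma> * (t - \<gamma> z)" for t
          by (rule has_vector_derivative_line_shift[OF der]) (simp add: graph_side_iff[OF G z] that)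
        fix t assume "\<bar>t\<bar> > R"
        moreover have "\<bar>t\<bar> \<le> norm (z + t *\<^sub>R v k)"
          using abs_inner_frame_le[OF k, of "z + t *\<^sub>R v k"] z k by (simp add: inner_add_left frame_orthonormal)
        ultimately show "h (z + t *\<^sub>R v k) = 0 \<and> h' (z + t *\<^sub>R v k) = 0" using h(2) h'(2) by auto
      qed (use cl h h' in auto)
      finally show "(\<integral>t. F (z + t *\<^sub>R v k) \<partial>lborel) = - \<sigma> *\<^sub>R (w z *\<^sub>R h (z + \<gamma> z *\<^sub>R v k))"
        by (simp add: scaleR_left_commute)
    qed
  qed measurable
  also have "\<dots> = - \<sigma> *\<^sub>R (\<integral>z. w z *\<^sub>R h (z + \<gamma> z *\<^sub>R v k) \<partial>coord_lebesgue v ?I)"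
    by (rule integral_scaleR_right)
  finally show ?thesis by (simp add: F_def)
qed

text \<open>A line parallel to \<open>v s\<close> may cross the graph many times. The shear \<Phi>
  flattens the graph to x_k = 0, and each line parallel to \<open>v s\<close> is then either inside
  or outside. By the chain rule the derivative of h o \<Phi> along \<open>v s\<close> is (h'_s +
  \<gamma>'_s h'_k) o \<Phi>, with integral 0 over the line. As \<Phi> preserves volume, the
  integral of h'_s is minus that of \<gamma>'_s h'_k, which is the weighted normal case. No
  derivative of \<gamma>' occurs.\<close>

lemma integral_side_tangential:
  fixes h :: "'a \<Rightarrow> 'b::euclidean_space" and h' :: "nat \<Rightarrow> 'a \<Rightarrow> 'b"
  assumes G: "C1_graph k \<gamma> \<gamma>'" and \<sigma>: "\<sigma> = 1 \<or> \<sigma> = -1" and s: "s \<le> m" "s \<noteq> k"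
    and h: "continuous_on (closed_side k \<sigma> \<gamma>) h" "\<And>z. z \<notin> closed_side k \<sigma> \<gamma> \<or> norm z > R \<Longrightarrow> h z = 0"
    and h': "\<And>s. s \<le> m \<Longrightarrow> continuous_on (closed_side k \<sigma> \<gamma>) (h' s)" 
      "\<And>s z. s \<le> m \<Longrightarrow> z \<notin> closed_side k \<sigma> \<gamma> \<or> norm z > R \<Longrightarrow> h' s z = 0"
    and der: "\<And>s z. s \<le> m \<Longrightarrow> z \<in> side k \<sigma> \<gamma> \<Longrightarrow> ((\<lambda>t. h (z + t *\<^sub>R v s)) has_vector_derivative h' s z) (at 0)"
  shows "(\<integral>z. indicator (side k \<sigma> \<gamma>) z *\<^sub>R h' s z \<partial>coord_lebesgue v {..m}) =
     \<sigma> *\<^sub>R (\<integral>z. \<gamma>' s z *\<^sub>R h (z + \<gamma> z *\<^sub>R v k) \<partial>coord_lebesgue v ({..m} - {k}))"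
proof -
  let ?D = "side k \<sigma> \<gamma>" and ?C = "closed_side k \<sigma> \<gamma>" and ?vol = "coord_lebesgue v {..m}"
  have k: "k \<le> m" and \<gamma>: "continuous_on UNIV \<gamma>" using C1_graphD[OF G] by blast+
  have C: "closed ?C" by (rule closed_closed_side[OF \<gamma>])
  have [measurable]: "?D \<in> sets borel" by (rule borel_side[OF \<gamma>])
  have \<gamma>'c: "continuous_on UNIV (\<gamma>' s)" using C1_graphD(4)[OF G s(1)] .
  have [measurable]: "h' s \<in> borel_measurable borel" "h' k \<in> borel_measurable borel"
    "\<gamma>' s \<in> borel_measurable borel" "\<gamma> \<in> borel_measurable borel"
    using supported_continuous(1)[OF C h'(1,2)[OF s(1)]] supported_continuous(1)[OF C h'(1,2)[OF k]] \<gamma>'c \<gamma>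
    by (auto intro: borel_measurable_continuous_onI)
  define \<Phi> where "\<Phi> z = z + \<gamma> z *\<^sub>R v k" for z
  have [measurable]: "\<Phi> \<in> borel_measurable borel" unfolding \<Phi>_def by measurable
  have shear: "distr ?vol borel \<Phi> = ?vol"
    unfolding \<Phi>_def by (rule distr_volume_shear[OF k]) (auto simp: C1_graphD(3)[OF G])
  define P where "P z = indicator ?D z *\<^sub>R h' s z" for z
  define Q where "Q z = indicator ?D z *\<^sub>R (\<gamma>' s z *\<^sub>R h' k z)" for z
  have [measurable]: "P \<in> borel_measurable borel" "Q \<in> borel_measurable borel" 
    unfolding P_def Q_def by measurable
  have int: "integrable ?vol (\<lambda>z. indicator ?D z *\<^sub>R q z)"
    if q: "continuous_on ?C q" "\<And>z. z \<notin> ?C \<or> norm z > R \<Longrightarrow> q z = 0" for q :: "'a \<Rightarrow> 'b"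
  proof -
    obtain B where B: "\<And>z. norm (q z) \<le> B" using supported_continuous(2)[OF C q] by blast
    have B0: "B \<ge> 0" using B[of 0] norm_ge_zero order_trans by blast
    have [measurable]: "q \<in> borel_measurable borel" by (rule supported_continuous(1)[OF C q])
    show ?thesis
      by (rule integrable_coord_bounded[of _ _ B R]) (use B B0 q(2) in \<open>auto split: split_indicator\<close>)
  qed
  have intP: "integrable ?vol P" unfolding P_def by (rule int) (use h' s in auto)
  have intQ: "integrable ?vol Q" unfolding Q_def
    by (rule int) (use h' k \<gamma>'c in \<open>auto intro!: continuous_intros intro: continuous_on_subset\<close>)
  have shift: "integrable ?vol (\<lambda>z. F (\<Phi> z)) \<and> (\<integral>z. F z \<partial>?vol) = (\<integral>z. F (\<Phi> z) \<partial>?vol)"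
    if "integrable ?vol F" for F :: "'a \<Rightarrow> 'b"
  proof -
    have [measurable]: "F \<in> borel_measurable borel" using borel_measurable_integrable[OF that] by simp
    have "integrable (distr ?vol borel \<Phi>) F" using that by (simp add: shear)
    then have "integrable ?vol (\<lambda>z. F (\<Phi> z))" by (subst (asm) integrable_distr_eq) auto
    moreover have "(\<integral>z. F z \<partial>distr ?vol borel \<Phi>) = (\<integral>z. F (\<Phi> z) \<partial>?vol)" by (rule integral_distr) auto
    ultimately show ?thesis by (simp add: shear)
  qed
  \<comment> \<open>On the flattened side this is the derivative of h o \<Phi> in the direction
    \<open>v s\<close>; elsewhere it is 0.\<close>
  define H where "H z = P (\<Phi> z) + Q (\<Phi> z)" for z
  have [measurable]: "H \<in> borel_measurable borel" unfolding H_def by measurable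
  have intH: "integrable ?vol H" unfolding H_def using shift intP intQ by blast
  have "(\<integral>z. H z \<partial>?vol) = (\<integral>z. H z \<partial>coord_lebesgue v (insert s ({..m} - {s})))"
    by (simp only: atMost_insert[OF s(1)])
  also have "\<dots> = (\<integral>z. (\<integral>t. H (z + t *\<^sub>R v s) \<partial>lborel) \<partial>coord_lebesgue v ({..m} - {s}))"
    by (rule integral_coord_insert) (simp_all only: atMost_insert[OF s(1)] intH finite_Diff finite_atMost Diff_iff, simp)
  also have "\<dots> = (\<integral>z. 0 \<partial>coord_lebesgue v ({..m} - {s}))"
  proof (rule integral_cong_AE)
    show "AE z in coord_lebesgue v ({..m} - {s}). (\<integral>t. H (z + t *\<^sub>R v s) \<partial>lborel) = 0"
    proof (rule AE_mp[OF AE_coord_space[of "{..m} - {s}"]], simp, intro AE_I2 impI)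
      fix z assume "z \<in> coord_space ({..m} - {s})"
      then have z: "z \<in> M" "z \<bullet> v s = 0" using coord_spaceD s by auto
      define c where "c t = \<Phi> (z + t *\<^sub>R v s)" for t
      have cM: "c t \<in> M" for t using z k s by (simp add: c_def \<Phi>_def)
      \<comment> \<open>The height above the graph is constant along the sheared line, so the line
        lies entirely in the side or entirely outside it.\<close>
      have ck: "c t \<bullet> v k - \<gamma> (c t) = z \<bullet> v k" for t
        using k s by (simp add: c_def \<Phi>_def inner_add_left frame_orthonormal C1_graphD(3)[OF G])
      have cs: "c t \<bullet> v s = t" for t
        using k s z by (simp add: c_def \<Phi>_def inner_add_left frame_orthonormal)
      show "(\<integral>t. H (z + t *\<^sub>R v s) \<partial>lborel) = 0"
      proof (cases "\<sigma> * (z \<bullet> v k) > 0")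
        case False
        then have "c t \<notin> ?D" for t by (simp add: side_def ck)
        then show ?thesis by (simp add: H_def P_def Q_def c_def[symmetric])
      next
        case True
        have cD: "c t \<in> ?D" for t using True cM by (simp add: side_def ck)
        then have cC: "c t \<in> ?C" for t using side_subset by blast
        have contc: "continuous_on UNIV c"
          unfolding c_def \<Phi>_def by (intro continuous_intros continuous_on_compose2[OF \<gamma>]) auto
        have Heq: "H (z + t *\<^sub>R v s) = h' s (c t) + \<gamma>' s (z + t *\<^sub>R v s) *\<^sub>R h' k (c t)" for t
        proof -
          have "H (z + t *\<^sub>R v s) = h' s (c t) + \<gamma>' s (c t) *\<^sub>R h' k (c t)"
            using cD by (simp add: H_def P_def Q_def c_def[symmetric])
          also have "\<gamma>' s (c t) = \<gamma>' s (z + t *\<^sub>R v s)"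
            unfolding c_def \<Phi>_def by (rule C1_graphD(5)[OF G s(1)])
          finally show ?thesis .
        qed
        show ?thesis
        proof (rule line_integral_derivative_eq_0[where R = R])
          show "continuous_on UNIV (\<lambda>t. H (z + t *\<^sub>R v s))" unfolding Heq
            by (intro continuous_intros continuous_on_compose2[OF h'(1) contc] continuous_on_compose2[OF \<gamma>'c])
              (use s k cC in auto)
          fix t
          have dz: "((\<lambda>u. \<gamma> (z + u *\<^sub>R v s)) has_vector_derivative \<gamma>' s (z + t *\<^sub>R v s)) (at t)"
            by (rule has_vector_derivative_line_shift, rule C1_graphD(6)[OF G s(1)]) (use z s in auto)
          have dc: "(c has_vector_derivative (v s + \<gamma>' s (z + t *\<^sub>R v s) *\<^sub>R v k)) (at t)"
          proof -
            have "((\<lambda>u. \<gamma> (z + u *\<^sub>R v s)) has_real_derivative \<gamma>' s (z + t *\<^sub>R v s)) (at t)"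
              using dz by (simp add: has_real_derivative_iff_has_vector_derivative)
            from has_vector_derivative_scaleR[OF this has_vector_derivative_const[of "v k"]]
            have "((\<lambda>u. \<gamma> (z + u *\<^sub>R v s) *\<^sub>R v k) has_vector_derivative \<gamma>' s (z + t *\<^sub>R v s) *\<^sub>R v k) (at t)"
              by simp
            moreover have "((\<lambda>u. z + u *\<^sub>R v s) has_vector_derivative v s) (at t)"
              by (auto intro!: derivative_eq_intros simp: has_vector_derivative_def)
            ultimately show ?thesis unfolding c_def \<Phi>_def by (rule has_vector_derivative_add[rotated])
          qed
          have "(h has_derivative (\<lambda>w. \<Sum>j\<le>m. (w \<bullet> v j) *\<^sub>R h' j (c t))) (at (c t) within M)"
            by (rule C1_frame_has_derivative[OF openin_side[OF \<gamma>] cD der])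
              (auto intro!: continuous_on_subset[OF h'(1) side_subset(1)])
          from vector_derivative_along_curve[OF this dc]
          have "((\<lambda>u. h (c u)) has_vector_derivative
              (\<Sum>j\<le>m. ((v s + \<gamma>' s (z + t *\<^sub>R v s) *\<^sub>R v k) \<bullet> v j) *\<^sub>R h' j (c t))) (at t)"
            using cM by simp
          also have "(\<Sum>j\<le>m. ((v s + \<gamma>' s (z + t *\<^sub>R v s) *\<^sub>R v k) \<bullet> v j) *\<^sub>R h' j (c t)) =
             (\<Sum>j\<le>m. (if j = s then h' s (c t) else 0) + (if j = k then \<gamma>' s (z + t *\<^sub>R v s) *\<^sub>R h' k (c t) else 0))"
            using s k by (intro sum.cong) (auto simp: inner_add_left frame_orthonormal)
          also have "\<dots> = H (z + t *\<^sub>R v s)" using s k by (simp add: sum.distrib Heq)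
          finally show "((\<lambda>u. h (c u)) has_vector_derivative H (z + t *\<^sub>R v s)) (at t)" .
          assume "\<bar>t\<bar> > R"
          then have "norm (c t) > R" using abs_inner_frame_le[OF s(1), of "c t"] cs[of t] by simp
          then show "h (c t) = 0 \<and> H (z + t *\<^sub>R v s) = 0" unfolding Heq using h h' s k by simp
        qed
      qed
    qed
  qed measurable
  finally have "(\<integral>z. P (\<Phi> z) \<partial>?vol) + (\<integral>z. Q (\<Phi> z) \<partial>?vol) = 0"
    unfolding H_def using shift intP intQ by (simp add: Bochner_Integration.integral_add)
  then have "(\<integral>z. P z \<partial>?vol) = - (\<integral>z. Q z \<partial>?vol)"
    using shift[OF intP] shift[OF intQ] by (simp add: eq_neg_iff_add_eq_0)
  also have "(\<integral>z. Q z \<partial>?vol) = - \<sigma> *\<^sub>R (\<integral>z. \<gamma>' s z *\<^sub>R h (z + \<gamma> z *\<^sub>R v k) \<partial>coord_lebesgue v ({..m} - {k}))"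
    unfolding Q_def
    by (rule integral_side_normal_weighted[OF G \<sigma> \<gamma>'c _ h h'(1,2)[OF k] der[OF k], where R = R])
      (use C1_graphD(5)[OF G s(1)] k in auto)
  finally show ?thesis by (simp add: P_def)
qed

end

section \<open>Surface measure of graphs\<close>

lemma nn_integral_substitution_inj:
  fixes g g' b :: "real \<Rightarrow> real"
  assumes S: "S \<in> sets borel" and gS: "g ` S \<in> sets borel" "g ` S \<subseteq> {-R..R}"
    and der: "\<And>t. t \<in> S \<Longrightarrow> (g has_real_derivative g' t) (at t)" and inj: "inj_on g S"
    and b: "continuous_on UNIV b" "\<And>t. 0 \<le> b t"
  shows "(\<integral>\<^sup>+ t. ennreal (\<bar>g' t\<bar> * b (g t)) * indicator S t \<partial>lborel) = (\<integral>\<^sup>+ t. ennreal (b t) * indicator (g ` S) t \<partial>lborel)"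
proof -
  have [measurable]: "b \<in> borel_measurable borel" "g ` S \<in> sets borel"
    using b(1) gS(1) by (auto intro: borel_measurable_continuous_onI)
  have "set_integrable lborel {-R..R} b"
    by (rule borel_integrable_atLeastAtMost') (rule continuous_on_subset[OF b(1)], simp)
  then have "set_integrable lborel (g ` S) b" by (rule set_integrable_subset) (use gS in auto)
  then have "set_integrable lebesgue (g ` S) b"
    unfolding set_integrable_def by (rule integrable_completion[THEN iffD2, rotated]) measurable
  moreover define c where "c = integral (g ` S) b"
  ultimately have *: "(\<lambda>x. \<bar>g' x\<bar> * b (g x)) absolutely_integrable_on S \<and> integral S (\<lambda>x. \<bar>g' x\<bar> * b (g x)) = c"
    using has_absolute_integral_change_of_variables_1'[of S g g' b c] S der inj
    by (auto intro: has_field_derivative_at_within simp: sets_completionI_sets)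
  then have 1: "((\<lambda>x. \<bar>g' x\<bar> * b (g x)) has_integral c) S"
    using set_lebesgue_integral_eq_integral(1) integrable_integral by blast
  have 2: "(b has_integral c) (g ` S)"
    using \<open>set_integrable lebesgue (g ` S) b\<close> set_lebesgue_integral_eq_integral(1) integrable_integral 
    unfolding c_def by blast
  show ?thesis
    using nn_integral_has_integral_lebesgue'[OF _ 1] nn_integral_has_integral_lebesgue'[OF _ 2] b(2) by simp
qed

section \<open>Graph measures and their independence of the chosen coordinate\<close>

context orthonormal_frame
begin

text \<open>Links the notions of the statement, which live on \<open>M\<close>, with
  \<open>C1_graph\<close>: \<open>proj\<close> is the identity on \<open>M\<close> and commutes with
  shifts along the frame.\<close>

lemma C1_graph_extend:
  assumes k: "k \<le> m" and C: "Ck_on v m 1 M \<gamma>" and ind: "indep_coord M v k \<gamma>"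
  shows "C1_graph k (\<lambda>z. \<gamma> (proj z)) (\<lambda>s z. partial v s \<gamma> (proj z))"
proof -
  have c: "continuous_on M \<gamma>" "\<And>s. s \<le> m \<Longrightarrow> continuous_on M (partial v s \<gamma>)"
    and d: "\<And>s x. s \<le> m \<Longrightarrow> x \<in> M \<Longrightarrow> (\<lambda>t. \<gamma> (x + t *\<^sub>R v s)) differentiable (at 0)"
    using C by auto
  have i: "\<gamma> (z + t *\<^sub>R v k) = \<gamma> z" if "z \<in> M" for z t using ind that by (auto simp: indep_coord_def)
  have "partial v s \<gamma> (z + t *\<^sub>R v k) = partial v s \<gamma> z" if "s \<le> m" "z \<in> M" for s z t
  proof -
    have "\<gamma> (z + t *\<^sub>R v k + u *\<^sub>R v s) = \<gamma> (z + u *\<^sub>R v s)" for u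
      using i[of "z + u *\<^sub>R v s" t] that by (simp add: add_ac)
    then show ?thesis by (simp add: partial_def)
  qed
  moreover have "((\<lambda>t. \<gamma> (z + t *\<^sub>R v s)) has_vector_derivative partial v s \<gamma> z) (at 0)" if "s \<le> m" "z \<in> M" for s z
    unfolding partial_def by (rule iffD1[OF vector_derivative_works d[OF that]])
  moreover have "continuous_on UNIV (\<lambda>z. q (proj z))" if "continuous_on M q" for q :: "'a \<Rightarrow> real"
    by (rule continuous_on_compose2[OF that]) (auto intro!: continuous_intros)
  ultimately show ?thesis using k i c unfolding C1_graph_def
    by (auto simp: proj_shift proj_id)
qed

lemma C1_graph_partial:
  assumes "C1_graph k \<gamma> \<gamma>'" "s \<le> m" "z \<in> M"
  shows "partial v s \<gamma> z = \<gamma>' s z"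
  unfolding partial_def using C1_graphD(6)[OF assms] by (rule vector_derivative_at)

lemma C1_graph_Ck_on:
  assumes "C1_graph k \<gamma> \<gamma>'"
  shows "Ck_on v m 1 M \<gamma>" "indep_coord M v k \<gamma>"
proof -
  have "continuous_on M (partial v s \<gamma>)" if "s \<le> m" for s
    using C1_graphD(4)[OF assms that, of M] C1_graph_partial[OF assms that] by (simp cong: continuous_on_cong)
  moreover have "(\<lambda>t. \<gamma> (z + t *\<^sub>R v s)) differentiable (at 0)" if "s \<le> m" "z \<in> M" for s z
    by (rule differentiableI_vector[OF C1_graphD(6)[OF assms that]])
  ultimately show "Ck_on v m 1 M \<gamma>" using C1_graphD(2)[OF assms] by simp
  show "indep_coord M v k \<gamma>" using C1_graphD(3)[OF assms] by (simp add: indep_coord_def)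
qed

definition graph_density :: "nat \<Rightarrow> (nat \<Rightarrow> 'a \<Rightarrow> real) \<Rightarrow> 'a \<Rightarrow> real" where
  "graph_density k \<gamma>' z = sqrt (1 + (\<Sum>s\<in>{..m} - {k}. (\<gamma>' s z)\<^sup>2))"

definition graph_measure :: "nat \<Rightarrow> ('a \<Rightarrow> real) \<Rightarrow> (nat \<Rightarrow> 'a \<Rightarrow> real) \<Rightarrow> 'a measure" where
  "graph_measure k \<gamma> \<gamma>' =
     distr (density (coord_lebesgue v ({..m} - {k})) (\<lambda>z. ennreal (graph_density k \<gamma>' z))) borel
       (\<lambda>z. z + \<gamma> z *\<^sub>R v k)"

lemma graph_density_ge_1: "1 \<le> graph_density k \<gamma>' z"
  by (simp add: graph_density_def sum_nonneg)

lemma continuous_on_graph_density: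
  assumes "C1_graph k \<gamma> \<gamma>'"
  shows "continuous_on UNIV (graph_density k \<gamma>')"
proof -
  have "continuous_on UNIV (\<gamma>' s)" if "s \<in> {..m} - {k}" for s
    using that by (intro C1_graphD(4)[OF assms]) simp
  then show ?thesis unfolding graph_density_def by (intro continuous_intros)
qed

lemma C1_graph_measurable:
  assumes "C1_graph k \<gamma> \<gamma>'"
  shows "\<gamma> \<in> borel_measurable borel" "graph_density k \<gamma>' \<in> borel_measurable borel"
  using continuous_on_graph_density[OF assms] C1_graphD(2)[OF assms, of UNIV]
  by (auto intro: borel_measurable_continuous_onI)

lemma sets_graph_measure [simp, measurable_cong]: "sets (graph_measure k \<gamma> \<gamma>') = sets borel"
  and space_graph_measure [simp]: "space (graph_measure k \<gamma> \<gamma>') = UNIV"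
  by (auto simp: graph_measure_def)

lemma emeasure_graph_measure:
  assumes "C1_graph k \<gamma> \<gamma>'" and [measurable]: "B \<in> sets borel"
  shows "emeasure (graph_measure k \<gamma> \<gamma>') B =
    (\<integral>\<^sup>+ z. indicator B (z + \<gamma> z *\<^sub>R v k) * ennreal (graph_density k \<gamma>' z) \<partial>coord_lebesgue v ({..m} - {k}))"
proof -
  note [measurable] = C1_graph_measurable[OF assms(1)]
  let ?X = "\<lambda>z. z + \<gamma> z *\<^sub>R v k"
  have "emeasure (graph_measure k \<gamma> \<gamma>') B =
      emeasure (density (coord_lebesgue v ({..m} - {k})) (\<lambda>z. ennreal (graph_density k \<gamma>' z))) (?X -` B \<inter> UNIV)"
    unfolding graph_measure_def by (subst emeasure_distr) auto
  also have "\<dots> = (\<integral>\<^sup>+ z. ennreal (graph_density k \<gamma>' z) * indicator (?X -` B \<inter> UNIV) z \<partial>coord_lebesgue v ({..m} - {k}))"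
  proof (rule emeasure_density)
    have "?X -` B \<inter> space borel \<in> sets borel" by measurable
    then show "?X -` B \<inter> UNIV \<in> sets (coord_lebesgue v ({..m} - {k}))" by simp
  qed simp
  also have "\<dots> = (\<integral>\<^sup>+ z. indicator B (z + \<gamma> z *\<^sub>R v k) * ennreal (graph_density k \<gamma>' z) \<partial>coord_lebesgue v ({..m} - {k}))"
    by (intro nn_integral_cong) (auto simp: mult.commute split: split_indicator)
  finally show ?thesis .
qed

lemma graph_point:
  assumes "C1_graph k \<gamma> \<gamma>'" "z \<in> M" "z \<bullet> v k = 0"
  shows "z + \<gamma> z *\<^sub>R v k \<in> M" "(z + \<gamma> z *\<^sub>R v k) \<bullet> v k = \<gamma> z" "\<gamma> (z + \<gamma> z *\<^sub>R v k) = \<gamma> z"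
  using assms C1_graphD(1,3)[OF assms(1)] by (auto simp: inner_add_left frame_orthonormal)

text \<open>A point z with x_k = 0 is no longer than the graph point above it, so the preimage of a
  bounded set is bounded, and there the density is bounded by continuity.\<close>

lemma emeasure_graph_measure_bounded:
  assumes G: "C1_graph k \<gamma> \<gamma>'" and B: "B \<in> sets borel" "bounded B"
  shows "emeasure (graph_measure k \<gamma> \<gamma>') B < \<infinity>"
proof -
  note k = C1_graphD(1)[OF G]
  obtain R where R: "\<And>z. z \<in> B \<Longrightarrow> norm z \<le> R" using B(2) by (auto simp: bounded_iff)
  have "compact (cball (0::'a) R)" by simp
  then have "bounded (graph_density k \<gamma>' ` cball 0 R)"
    by (intro compact_imp_bounded compact_continuous_image continuous_on_subset[OF continuous_on_graph_density[OF G]]) auto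
  then obtain D where "\<forall>z\<in>cball 0 R. \<bar>graph_density k \<gamma>' z\<bar> \<le> D"
    unfolding bounded_iff by auto
  then have D: "\<And>z. norm z \<le> R \<Longrightarrow> \<bar>graph_density k \<gamma>' z\<bar> \<le> D" by simp
  have "emeasure (graph_measure k \<gamma> \<gamma>') B \<le> (\<integral>\<^sup>+ z. ennreal D * indicator (cball 0 R) z \<partial>coord_lebesgue v ({..m} - {k}))"
    unfolding emeasure_graph_measure[OF G B(1)]
  proof (rule nn_integral_mono_AE, rule AE_mp[OF AE_coord_space[of "{..m} - {k}"]], simp, intro AE_I2 impI)
    fix z assume "z \<in> coord_space ({..m} - {k})"
    then have z: "z \<in> M" "z \<bullet> v k = 0" using coord_spaceD k by auto
    show "indicator B (z + \<gamma> z *\<^sub>R v k) * ennreal (graph_density k \<gamma>' z) \<le> ennreal D * indicator (cball 0 R) z"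
    proof (cases "z + \<gamma> z *\<^sub>R v k \<in> B")
      case True
      have "(norm z)\<^sup>2 \<le> (norm (z + \<gamma> z *\<^sub>R v k))\<^sup>2"
        using z k by (simp add: power2_norm_eq_inner inner_add inner_commute frame_orthonormal)
      then have "norm z \<le> R" using R[OF True] by (simp add: power2_le_iff_abs_le)
      then show ?thesis using D[of z] True by (auto intro: ennreal_leI)
    qed simp
  qed
  also have "\<dots> = ennreal D * emeasure (coord_lebesgue v ({..m} - {k})) (cball 0 R)"
    by (subst nn_integral_cmult_indicator) auto
  also have "\<dots> < \<infinity>"
    using emeasure_coord_cball_finite[of "{..m} - {k}" R] by (simp add: ennreal_mult_less_top)
  finally show ?thesis .
qed

text \<open>The line p + u v_s is lifted back to the graph by correcting its k-th coordinate. The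
  velocities of these curves are the tangent vectors used both to compare two graphs and to identify
  the normal.\<close>

lemma graph_curve:
  assumes G: "C1_graph k \<gamma> \<gamma>'" and U: "open U" and p: "p \<in> M" "p \<in> U" "p \<bullet> v k = \<gamma> p" and s: "s \<le> m" "s \<noteq> k"
  defines "c \<equiv> \<lambda>u. p + u *\<^sub>R v s + (\<gamma> (p + u *\<^sub>R v s) - \<gamma> p) *\<^sub>R v k"
  shows "c 0 = p" "c u \<in> M" "c u \<bullet> v k = \<gamma> (c u)" "\<gamma> (c u) = \<gamma> (p + u *\<^sub>R v s)" "eventually (\<lambda>u. c u \<in> U) (at 0)"
    "(c has_vector_derivative v s + \<gamma>' s p *\<^sub>R v k) (at 0)"
proof -
  note k = C1_graphD(1)[OF G]
  show "c 0 = p" by (simp add: c_def)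
  show "c u \<in> M" using p s k by (simp add: c_def)
  show 1: "\<gamma> (c u) = \<gamma> (p + u *\<^sub>R v s)" by (simp add: c_def C1_graphD(3)[OF G])
  show "c u \<bullet> v k = \<gamma> (c u)" unfolding 1 using k s p
    by (simp add: c_def inner_add_left frame_orthonormal)
  have d: "((\<lambda>u. \<gamma> (p + u *\<^sub>R v s) - \<gamma> p) has_real_derivative \<gamma>' s p) (at 0)"
    using C1_graphD(6)[OF G s(1) p(1)] 
    by (simp add: has_real_derivative_iff_has_vector_derivative has_vector_derivative_diff_const)
  from has_vector_derivative_scaleR[OF this has_vector_derivative_const[of "v k"]]
  have "((\<lambda>u. (\<gamma> (p + u *\<^sub>R v s) - \<gamma> p) *\<^sub>R v k) has_vector_derivative \<gamma>' s p *\<^sub>R v k) (at 0)"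
    by simp
  moreover have "((\<lambda>u. p + u *\<^sub>R v s) has_vector_derivative v s) (at 0)"
    by (auto intro!: derivative_eq_intros simp: has_vector_derivative_def)
  ultimately show dc: "(c has_vector_derivative v s + \<gamma>' s p *\<^sub>R v k) (at 0)"
    unfolding c_def by (rule has_vector_derivative_add[rotated])
  have "isCont c 0" by (rule has_vector_derivative_continuous[OF dc])
  then have "(c \<longlongrightarrow> p) (at 0)" using \<open>c 0 = p\<close> by (simp add: isCont_def)
  then show "eventually (\<lambda>u. c u \<in> U) (at 0)" using U p(2) by (rule topological_tendstoD)
qed

text \<open>Differentiate the equation x_l = \<delta> of the second graph along a curve in the
  first. One identity covers three cases: l = k gives \<gamma>'_s = \<delta>'_s; s = l \<noteq> k
  gives \<gamma>'_l \<delta>'_k = 1; for s distinct from k and l it gives \<delta>'_s = -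
  \<gamma>'_s \<delta>'_k.\<close>

lemma graph_gradients:
  assumes G1: "C1_graph k \<gamma> \<gamma>'" and G2: "C1_graph l \<delta> \<delta>'" and U: "open U"
    and g1: "\<Gamma> \<inter> U = {z \<in> M \<inter> U. z \<bullet> v k = \<gamma> z}" and g2: "\<Gamma> \<inter> U = {z \<in> M \<inter> U. z \<bullet> v l = \<delta> z}"
    and p: "p \<in> \<Gamma> \<inter> U" and s: "s \<le> m" "s \<noteq> k"
  shows "(v s + \<gamma>' s p *\<^sub>R v k) \<bullet> v l = \<delta>' s p + \<gamma>' s p * \<delta>' k p"
proof -
  note k = C1_graphD(1)[OF G1] and l = C1_graphD(1)[OF G2]
  have pg: "p \<in> M" "p \<in> U" "p \<bullet> v k = \<gamma> p" using p g1 by auto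
  define c where "c u = p + u *\<^sub>R v s + (\<gamma> (p + u *\<^sub>R v s) - \<gamma> p) *\<^sub>R v k" for u
  note c = graph_curve[OF G1 U pg s, folded c_def]
  have ev: "eventually (\<lambda>u. c u \<bullet> v l = \<delta> (c u)) (at 0)"
    using c(5) by eventually_elim (use c(2,3) g1 g2 in auto)
  have "((\<lambda>u. c u \<bullet> v l) has_vector_derivative (v s + \<gamma>' s p *\<^sub>R v k) \<bullet> v l) (at 0)"
    by (rule bounded_linear.has_vector_derivative[OF bounded_linear_inner_left c(6)])
  moreover have "((\<lambda>u. \<delta> (c u)) has_vector_derivative (\<Sum>j\<le>m. ((v s + \<gamma>' s p *\<^sub>R v k) \<bullet> v j) *\<^sub>R \<delta>' j p)) (at 0)"
    by (rule vector_derivative_along_curve[OF _ c(6)]) 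
      (use C1_graph_has_derivative[OF G2 pg(1)] c(1,2) pg in auto)
  then have "((\<lambda>u. c u \<bullet> v l) has_vector_derivative (\<Sum>j\<le>m. ((v s + \<gamma>' s p *\<^sub>R v k) \<bullet> v j) *\<^sub>R \<delta>' j p)) (at 0)"
    unfolding has_vector_derivative_def
    by (rule has_derivative_transform_eventually) (use ev c(1) p g2 in \<open>auto elim: eventually_mono\<close>)
  ultimately have "(v s + \<gamma>' s p *\<^sub>R v k) \<bullet> v l = (\<Sum>j\<le>m. ((v s + \<gamma>' s p *\<^sub>R v k) \<bullet> v j) *\<^sub>R \<delta>' j p)"
    by (rule vector_derivative_unique_at)
  also have "\<dots> = (\<Sum>j\<le>m. (if j = s then \<delta>' s p else 0) + (if j = k then \<gamma>' s p * \<delta>' k p else 0))"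
    using s k by (intro sum.cong) (auto simp: inner_add_left frame_orthonormal)
  also have "\<dots> = \<delta>' s p + \<gamma>' s p * \<delta>' k p" using s k by (simp add: sum.distrib)
  finally show ?thesis .
qed

text \<open>The two functions may differ away from the piece. Below points of B they agree, and so
  do their gradients, because \<Gamma> is both graphs on the open set U around each such
  point.\<close>

lemma graph_measure_consistent_same:
  assumes G1: "C1_graph k \<gamma> \<gamma>'" and G2: "C1_graph k \<delta> \<delta>'" and U: "open U"
    and g1: "\<Gamma> \<inter> U = {z \<in> M \<inter> U. z \<bullet> v k = \<gamma> z}" and g2: "\<Gamma> \<inter> U = {z \<in> M \<inter> U. z \<bullet> v k = \<delta> z}"
    and B: "B \<in> sets borel" "B \<subseteq> \<Gamma> \<inter> U"
  shows "emeasure (graph_measure k \<gamma> \<gamma>') B = emeasure (graph_measure k \<delta> \<delta>') B"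
  unfolding emeasure_graph_measure[OF G1 B(1)] emeasure_graph_measure[OF G2 B(1)]
proof (rule nn_integral_cong_AE, rule AE_mp[OF AE_coord_space[of "{..m} - {k}"]], simp, intro AE_I2 impI)
  note k = C1_graphD(1)[OF G1]
  fix z assume "z \<in> coord_space ({..m} - {k})"
  then have z: "z \<in> M" "z \<bullet> v k = 0" using coord_spaceD k by auto
  have iff: "z + \<gamma> z *\<^sub>R v k \<in> B \<longleftrightarrow> z + \<delta> z *\<^sub>R v k \<in> B"
    if "z + \<gamma> z *\<^sub>R v k \<in> B \<or> z + \<delta> z *\<^sub>R v k \<in> B"
  proof -
    have "\<gamma> z = \<delta> z" using that
    proof
      assume "z + \<gamma> z *\<^sub>R v k \<in> B"
      then have "(z + \<gamma> z *\<^sub>R v k) \<bullet> v k = \<delta> (z + \<gamma> z *\<^sub>R v k)" using B g2 by blast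
      then show ?thesis using graph_point[OF G1 z] C1_graphD(3)[OF G2] by simp
    next
      assume "z + \<delta> z *\<^sub>R v k \<in> B"
      then have "(z + \<delta> z *\<^sub>R v k) \<bullet> v k = \<gamma> (z + \<delta> z *\<^sub>R v k)" using B g1 by blast
      then show ?thesis using graph_point[OF G2 z] C1_graphD(3)[OF G1] by simp
    qed
    then show ?thesis by simp
  qed
  have dens: "graph_density k \<gamma>' z = graph_density k \<delta>' z" if "z + \<gamma> z *\<^sub>R v k \<in> B"
  proof -
    let ?p = "z + \<gamma> z *\<^sub>R v k"
    have p: "?p \<in> \<Gamma> \<inter> U" using that B by blast
    then have pM: "?p \<in> M" using g1 by blast
    have "\<gamma>' s z = \<delta>' s z" if "s \<in> {..m} - {k}" for s
    proof -
      have "(v s + \<gamma>' s ?p *\<^sub>R v k) \<bullet> v k = \<delta>' s ?p + \<gamma>' s ?p * \<delta>' k ?p"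
        using that by (intro graph_gradients[OF G1 G2 U g1 g2 p]) auto
      then show ?thesis
        using that k C1_graph_self_derivative[OF G2 pM] C1_graphD(5)[OF G1] C1_graphD(5)[OF G2]
        by (simp add: inner_add_left frame_orthonormal)
    qed
    then show ?thesis by (simp add: graph_density_def)
  qed
  show "indicator B (z + \<gamma> z *\<^sub>R v k) * ennreal (graph_density k \<gamma>' z) =
      indicator B (z + \<delta> z *\<^sub>R v k) * ennreal (graph_density k \<delta>' z)"
    using iff dens by (auto split: split_indicator)
qed

text \<open>With the coordinates other than \<open>x\<^sub>k\<close> and \<open>x\<^sub>l\<close> frozen, the two graphs are the graphs of
  mutually inverse functions of one variable.\<close>

lemma graph_measure_consistent_distinct:
  assumes G1: "C1_graph k \<gamma> \<gamma>'" and G2: "C1_graph l \<delta> \<delta>'" and kl: "k \<noteq> l" and U: "open U"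
    and g1: "\<Gamma> \<inter> U = {z \<in> M \<inter> U. z \<bullet> v k = \<gamma> z}" and g2: "\<Gamma> \<inter> U = {z \<in> M \<inter> U. z \<bullet> v l = \<delta> z}"
    and B: "B \<in> sets borel" "B \<subseteq> \<Gamma> \<inter> U" "bounded B"
  shows "emeasure (graph_measure k \<gamma> \<gamma>') B = emeasure (graph_measure l \<delta> \<delta>') B"
proof -
  note k = C1_graphD(1)[OF G1] and l = C1_graphD(1)[OF G2]
  note [measurable] = B(1) C1_graph_measurable[OF G1] C1_graph_measurable[OF G2]
  obtain R where R: "\<And>z. z \<in> B \<Longrightarrow> norm z \<le> R" using B(3) by (auto simp: bounded_iff)
  let ?J = "{..m} - {k, l}"
  have J1: "{..m} - {k} = insert l ?J" and J2: "{..m} - {l} = insert k ?J" using k l kl by auto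
  have E1: "emeasure (graph_measure k \<gamma> \<gamma>') B = (\<integral>\<^sup>+ w. \<integral>\<^sup>+ t. indicator B (w + t *\<^sub>R v l + \<gamma> (w + t *\<^sub>R v l) *\<^sub>R v k) *
      ennreal (graph_density k \<gamma>' (w + t *\<^sub>R v l)) \<partial>lborel \<partial>coord_lebesgue v ?J)"
    unfolding emeasure_graph_measure[OF G1 B(1)] J1 by (rule nn_integral_coord_insert) auto
  have E2: "emeasure (graph_measure l \<delta> \<delta>') B = (\<integral>\<^sup>+ w. \<integral>\<^sup>+ t. indicator B (w + t *\<^sub>R v k + \<delta> (w + t *\<^sub>R v k) *\<^sub>R v l) *
      ennreal (graph_density l \<delta>' (w + t *\<^sub>R v k)) \<partial>lborel \<partial>coord_lebesgue v ?J)"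
    unfolding emeasure_graph_measure[OF G2 B(1)] J2 by (rule nn_integral_coord_insert) auto
  show ?thesis unfolding E1 E2
  proof (rule nn_integral_cong_AE, rule AE_mp[OF AE_coord_space[of ?J]], blast, intro AE_I2 impI)
    fix w assume "w \<in> coord_space ?J"
    then have w: "w \<in> M" "w \<bullet> v k = 0" "w \<bullet> v l = 0" using coord_spaceD k l by auto
    define g where "g t = \<gamma> (w + t *\<^sub>R v l)" for t
    define q where "q t = \<delta> (w + t *\<^sub>R v k)" for t
    define p1 where "p1 t = w + t *\<^sub>R v l + g t *\<^sub>R v k" for t
    define p2 where "p2 t = w + t *\<^sub>R v k + q t *\<^sub>R v l" for t
    define S where "S = {t. p1 t \<in> B}"
    define T where "T = {t. p2 t \<in> B}"
    define b where "b t = graph_density l \<delta>' (w + t *\<^sub>R v k)" for t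
    have [measurable]: "p1 \<in> borel_measurable borel" "p2 \<in> borel_measurable borel"
      unfolding p1_def p2_def g_def q_def by measurable
    have ST: "S \<in> sets borel" "T \<in> sets borel"
      using measurable_sets[of p1 borel borel B] measurable_sets[of p2 borel borel B]
      by (auto simp: S_def T_def vimage_def)
    have in1: "p1 t \<bullet> v l = t" "p2 t \<bullet> v k = t" for t
      using w k l kl by (auto simp: p1_def p2_def inner_add_left frame_orthonormal)
    \<comment> \<open>A point of B lies on both graphs, so the second equation recovers t from
      \<open>g t\<close>; hence g is injective on S with inverse q.\<close>
    have S: "q (g t) = t \<and> p2 (g t) = p1 t" if "t \<in> S" for t
    proof -
      have "p1 t \<bullet> v l = \<delta> (p1 t)" using that B(2) g2 by (auto simp: S_def)
      also have "p1 t = (w + g t *\<^sub>R v k) + t *\<^sub>R v l" by (simp add: p1_def add_ac)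
      also have "\<delta> \<dots> = q (g t)" unfolding q_def by (rule C1_graphD(3)[OF G2])
      finally have "q (g t) = t" using in1(1)[of t] by (simp add: p1_def add_ac)
      then show ?thesis by (simp add: p1_def p2_def add_ac)
    qed
    have T: "g (q t) = t \<and> p1 (q t) = p2 t" if "t \<in> T" for t
    proof -
      have "p2 t \<bullet> v k = \<gamma> (p2 t)" using that B(2) g1 by (auto simp: T_def)
      also have "p2 t = (w + q t *\<^sub>R v l) + t *\<^sub>R v k" by (simp add: p2_def add_ac)
      also have "\<gamma> \<dots> = g (q t)" unfolding g_def by (rule C1_graphD(3)[OF G1])
      finally have "g (q t) = t" using in1(2)[of t] by (simp add: p2_def add_ac)
      then show ?thesis by (simp add: p1_def p2_def add_ac)
    qed
    have gS: "g ` S = T"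
    proof
      show "g ` S \<subseteq> T" using S by (auto simp: S_def T_def)
      show "T \<subseteq> g ` S" 
      proof
        fix t assume "t \<in> T"
        with T[OF this] show "t \<in> g ` S" by (intro image_eqI[of _ _ "q t"]) (auto simp: S_def T_def)
      qed
    qed
    have inj: "inj_on g S" using S by (metis inj_onI)
    \<comment> \<open>Boundedness of B enters here, as the substitution lemma asks for a bounded
      image.\<close>
    have TR: "T \<subseteq> {-R..R}"
    proof
      fix t assume "t \<in> T"
      then have "norm (p2 t) \<le> R" using R by (simp add: T_def)
      then show "t \<in> {-R..R}" using abs_inner_frame_le[OF k, of "p2 t"] in1(2)[of t] by auto
    qed
    have der: "(g has_real_derivative \<gamma>' l (w + t *\<^sub>R v l)) (at t)" for t
      unfolding g_def has_real_derivative_iff_has_vector_derivative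
      by (rule has_vector_derivative_line_shift, rule C1_graphD(6)[OF G1 l]) (use w l in simp)
    \<comment> \<open>Put \<alpha> = \<gamma>'_l, \<beta> = \<delta>'_k and let X be the sum of the
      other squares (\<gamma>'_s)^2. From \<alpha> \<beta> = 1 and \<delta>'_s = - \<beta>
      \<gamma>'_s one gets \<alpha>^2 (1 + \<beta>^2 + \<beta>^2 X) = 1 + \<alpha>^2 + X: the
      Jacobian |\<alpha>| turns one density into the other.\<close>
    have jac: "\<bar>\<gamma>' l (w + t *\<^sub>R v l)\<bar> * b (g t) = graph_density k \<gamma>' (w + t *\<^sub>R v l)" if "t \<in> S" for t
    proof -
      have p: "p1 t \<in> \<Gamma> \<inter> U" using that B by (auto simp: S_def)
      then have pM: "p1 t \<in> M" using g1 by blast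
      have e1: "\<gamma>' s (w + t *\<^sub>R v l) = \<gamma>' s (p1 t)" if "s \<le> m" for s
        unfolding p1_def by (simp add: C1_graphD(5)[OF G1 that])
      have e2: "\<delta>' s (w + g t *\<^sub>R v k) = \<delta>' s (p1 t)" if "s \<le> m" for s
        using C1_graphD(5)[OF G2 that, of "w + g t *\<^sub>R v k" t] by (simp add: p1_def add_ac)
      define \<alpha> where "\<alpha> = \<gamma>' l (p1 t)"
      define \<beta> where "\<beta> = \<delta>' k (p1 t)"
      note gg = graph_gradients[OF G1 G2 U g1 g2 p]
      have ab: "\<alpha> * \<beta> = 1"
        using gg[OF l] kl k l C1_graph_self_derivative[OF G2 pM]
        by (simp add: \<alpha>_def \<beta>_def inner_add_left frame_orthonormal)
      have ds: "\<delta>' s (p1 t) = - (\<beta> * \<gamma>' s (p1 t))" if "s \<in> ?J" for s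
      proof -
        have "\<delta>' s (p1 t) + \<gamma>' s (p1 t) * \<delta>' k (p1 t) = 0"
          using gg[of s] kl k l that by (auto simp: inner_add_left frame_orthonormal)
        then show ?thesis by (simp add: \<beta>_def eq_neg_iff_add_eq_0 mult.commute)
      qed
      let ?X = "\<Sum>s\<in>?J. (\<gamma>' s (p1 t))\<^sup>2"
      have "(graph_density k \<gamma>' (w + t *\<^sub>R v l))\<^sup>2 = 1 + (\<Sum>s\<in>insert l ?J. (\<gamma>' s (p1 t))\<^sup>2)"
        unfolding graph_density_def J1 using l by (subst real_sqrt_pow2) (auto simp: sum_nonneg e1 add_nonneg_nonneg)
      also have "\<dots> = 1 + \<alpha>\<^sup>2 + ?X" by (simp add: \<alpha>_def)
      finally have d1: "(graph_density k \<gamma>' (w + t *\<^sub>R v l))\<^sup>2 = 1 + \<alpha>\<^sup>2 + ?X" .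
      have "(b (g t))\<^sup>2 = 1 + (\<Sum>s\<in>insert k ?J. (\<delta>' s (p1 t))\<^sup>2)"
        unfolding b_def graph_density_def J2 using k by (subst real_sqrt_pow2) (auto simp: sum_nonneg e2 add_nonneg_nonneg)
      also have "\<dots> = 1 + \<beta>\<^sup>2 + (\<Sum>s\<in>?J. \<beta>\<^sup>2 * (\<gamma>' s (p1 t))\<^sup>2)"
        by (simp add: \<beta>_def[symmetric] ds power_mult_distrib)
      also have "\<dots> = 1 + \<beta>\<^sup>2 + \<beta>\<^sup>2 * ?X" by (simp add: sum_distrib_left)
      finally have "(\<bar>\<alpha>\<bar> * b (g t))\<^sup>2 = \<alpha>\<^sup>2 * (1 + \<beta>\<^sup>2 + \<beta>\<^sup>2 * ?X)" by (simp add: power_mult_distrib)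
      also have "\<dots> = \<alpha>\<^sup>2 + (\<alpha> * \<beta>)\<^sup>2 + (\<alpha> * \<beta>)\<^sup>2 * ?X" by (simp add: algebra_simps power2_eq_square)
      also have "\<dots> = (graph_density k \<gamma>' (w + t *\<^sub>R v l))\<^sup>2" by (simp add: ab d1)
      finally show ?thesis
        using graph_density_ge_1[of k \<gamma>' "w + t *\<^sub>R v l"] graph_density_ge_1[of l \<delta>' "w + g t *\<^sub>R v k"] l
        by (simp add: power2_eq_iff_nonneg e1 \<alpha>_def b_def)
    qed
    have bc: "continuous_on UNIV b" unfolding b_def
      by (rule continuous_on_compose2[OF continuous_on_graph_density[OF G2]]) (auto intro!: continuous_intros)
    have b0: "0 \<le> b t" for t using graph_density_ge_1[of l \<delta>' "w + t *\<^sub>R v k"] by (simp add: b_def)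
    have "(\<integral>\<^sup>+ t. indicator B (p1 t) * ennreal (graph_density k \<gamma>' (w + t *\<^sub>R v l)) \<partial>lborel) =
       (\<integral>\<^sup>+ t. ennreal (\<bar>\<gamma>' l (w + t *\<^sub>R v l)\<bar> * b (g t)) * indicator S t \<partial>lborel)"
      by (intro nn_integral_cong) (auto simp: S_def jac split: split_indicator)
    also have "\<dots> = (\<integral>\<^sup>+ t. ennreal (b t) * indicator (g ` S) t \<partial>lborel)"
      by (rule nn_integral_substitution_inj[OF ST(1) _ _ der inj bc b0]) (use gS ST TR in auto)
    also have "\<dots> = (\<integral>\<^sup>+ t. indicator B (p2 t) * ennreal (b t) \<partial>lborel)"
      unfolding gS by (intro nn_integral_cong) (auto simp: T_def split: split_indicator)
    finally show "(\<integral>\<^sup>+ t. indicator B (w + t *\<^sub>R v l + \<gamma> (w + t *\<^sub>R v l) *\<^sub>R v k) * ennreal (graph_density k \<gamma>' (w + t *\<^sub>R v l)) \<partial>lborel) =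
       (\<integral>\<^sup>+ t. indicator B (w + t *\<^sub>R v k + \<delta> (w + t *\<^sub>R v k) *\<^sub>R v l) * ennreal (graph_density l \<delta>' (w + t *\<^sub>R v k)) \<partial>lborel)"
      by (simp add: p1_def p2_def g_def q_def b_def)
  qed
qed

lemma graph_measure_consistent:
  assumes G1: "C1_graph k \<gamma> \<gamma>'" and G2: "C1_graph l \<delta> \<delta>'" and U: "open U" "open V"
    and g1: "\<Gamma> \<inter> U = {z \<in> M \<inter> U. z \<bullet> v k = \<gamma> z}" and g2: "\<Gamma> \<inter> V = {z \<in> M \<inter> V. z \<bullet> v l = \<delta> z}"
    and B: "B \<in> sets borel" "B \<subseteq> \<Gamma> \<inter> U \<inter> V" "bounded B"
  shows "emeasure (graph_measure k \<gamma> \<gamma>') B = emeasure (graph_measure l \<delta> \<delta>') B"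
proof -
  have "open (U \<inter> V)" using U by blast
  moreover have "\<Gamma> \<inter> (U \<inter> V) = {z \<in> M \<inter> (U \<inter> V). z \<bullet> v k = \<gamma> z}"
    "\<Gamma> \<inter> (U \<inter> V) = {z \<in> M \<inter> (U \<inter> V). z \<bullet> v l = \<delta> z}" using g1 g2 by blast+
  moreover have "B \<subseteq> \<Gamma> \<inter> (U \<inter> V)" using B by blast
  ultimately show ?thesis
    using graph_measure_consistent_same[of k \<gamma> \<gamma>' \<delta> \<delta>' "U \<inter> V" \<Gamma> B] 
      graph_measure_consistent_distinct[of k \<gamma> \<gamma>' l \<delta> \<delta>' "U \<inter> V" \<Gamma> B] G1 G2 B
    by (cases "k = l") auto
qed

end

section \<open>Existence and uniqueness of the surface measure\<close>

context orthonormal_frame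
begin

definition graph_piece :: "'a set \<Rightarrow> nat \<Rightarrow> ('a \<Rightarrow> real) \<Rightarrow> (nat \<Rightarrow> 'a \<Rightarrow> real) \<Rightarrow> 'a set \<Rightarrow> bool" where
  "graph_piece \<Gamma> k \<gamma> \<gamma>' U \<longleftrightarrow> C1_graph k \<gamma> \<gamma>' \<and> open U \<and> \<Gamma> \<inter> U = {z \<in> M \<inter> U. z \<bullet> v k = \<gamma> z}"

definition compact_hypersurface :: "'a set \<Rightarrow> bool" where
  "compact_hypersurface \<Gamma> \<longleftrightarrow> compact \<Gamma> \<and> (\<forall>p\<in>\<Gamma>. \<exists>U k \<gamma> \<gamma>'. p \<in> U \<and> graph_piece \<Gamma> k \<gamma> \<gamma>' U)"

text \<open>A finite subcover by graph pieces is made disjoint by removing from each set the earlier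
  ones; differences of open sets stay Borel.\<close>

lemma hypersurface_partition:
  assumes "compact_hypersurface \<Gamma>"
  obtains n :: nat and k :: "nat \<Rightarrow> nat" and \<gamma> and \<gamma>' :: "nat \<Rightarrow> nat \<Rightarrow> 'a \<Rightarrow> real" and U P :: "nat \<Rightarrow> 'a set" where
    "\<forall>i<n. graph_piece \<Gamma> (k i) (\<gamma> i) (\<gamma>' i) (U i) \<and> P i \<in> sets borel \<and> P i \<subseteq> \<Gamma> \<inter> U i"
    "disjoint_family_on P {..<n}" "(\<Union>i<n. P i) = \<Gamma>"
proof -
  have cpt: "compact \<Gamma>" using assms by (simp add: compact_hypersurface_def)
  \<comment> \<open>The neighbourhood, coordinate, function and derivatives are packed into one
    tuple so that a single choice suffices.\<close>
  have "\<forall>p\<in>\<Gamma>. \<exists>x. p \<in> fst x \<and> graph_piece \<Gamma> (fst (snd x)) (fst (snd (snd x))) (snd (snd (snd x))) (fst x)"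
    using assms unfolding compact_hypersurface_def by simp
  from bchoice[OF this] obtain X where X: "\<And>p. p \<in> \<Gamma> \<Longrightarrow> p \<in> fst (X p) \<and>
      graph_piece \<Gamma> (fst (snd (X p))) (fst (snd (snd (X p)))) (snd (snd (snd (X p)))) (fst (X p))"
    by blast
  have op: "open (fst (X p))" if "p \<in> \<Gamma>" for p using X[OF that] by (simp add: graph_piece_def)
  have cov: "\<Gamma> \<subseteq> (\<Union>p\<in>\<Gamma>. fst (X p))" using X by blast
  obtain D where D: "D \<subseteq> \<Gamma>" "finite D" "\<Gamma> \<subseteq> (\<Union>p\<in>D. fst (X p))"
    by (rule compactE_image[OF cpt op cov])
  obtain h where h: "bij_betw h {0..<card D} D" using ex_bij_betw_nat_finite[OF D(2)] by blast
  then have hD: "h i \<in> D" if "i < card D" for i using that by (auto simp: bij_betw_def)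
  define U where "U i = fst (X (h i))" for i
  define P where "P i = \<Gamma> \<inter> U i - (\<Union>j<i. U j)" for i
  show thesis
  proof (rule that[of "card D" "\<lambda>i. fst (snd (X (h i)))" "\<lambda>i. fst (snd (snd (X (h i))))" "\<lambda>i. snd (snd (snd (X (h i))))" U P])
    show "\<forall>i<card D. graph_piece \<Gamma> (fst (snd (X (h i)))) (fst (snd (snd (X (h i))))) (snd (snd (snd (X (h i))))) (U i) \<and>
       P i \<in> sets borel \<and> P i \<subseteq> \<Gamma> \<inter> U i"
    proof (intro allI impI conjI)
      fix i assume i: "i < card D"
      show "graph_piece \<Gamma> (fst (snd (X (h i)))) (fst (snd (snd (X (h i))))) (snd (snd (snd (X (h i))))) (U i)"
        using X hD[OF i] D(1) unfolding U_def by blast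
      have "open (U j)" if "j \<le> i" for j unfolding U_def using hD[of j] i that D(1) by (intro op) auto
      then show "P i \<in> sets borel" unfolding P_def using cpt
        by (intro sets.Diff sets.Int borel_closed borel_open open_UN) (auto simp: compact_imp_closed)
      show "P i \<subseteq> \<Gamma> \<inter> U i" by (auto simp: P_def)
    qed
  next
    show "disjoint_family_on P {..<card D}"
      unfolding disjoint_family_on_def
    proof (intro ballI impI)
      fix i j :: nat assume "i \<noteq> j"
      then show "P i \<inter> P j = {}" by (cases "i < j") (auto simp: P_def)
    qed
    show "(\<Union>i<card D. P i) = \<Gamma>"
    proof
      show "\<Gamma> \<subseteq> (\<Union>i<card D. P i)"
      proof
        fix x assume x: "x \<in> \<Gamma>"
        then obtain p where "p \<in> D" "x \<in> fst (X p)" using D(3) by blast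
        then obtain i where i: "i < card D" "x \<in> U i" using h unfolding U_def bij_betw_def
          by (metis atLeastLessThan_iff imageE)
        \<comment> \<open>The first set containing x is the one whose disjoint part keeps x.\<close>
        define j where "j = (LEAST i. x \<in> U i)"
        have "x \<in> U j" "j \<le> i" "\<And>l. l < j \<Longrightarrow> x \<notin> U l"
          unfolding j_def using i(2) by (auto intro: LeastI Least_le dest: not_less_Least)
        then show "x \<in> (\<Union>i<card D. P i)" using i x by (auto simp: P_def intro!: bexI[of _ j])
      qed
    qed (auto simp: P_def)
  qed
qed

lemma graph_piece_measure_eq:
  assumes "C1_graph k \<gamma> \<gamma>'" "B \<in> sets borel"
  shows "(\<integral>\<^sup>+ z. indicator B (z + \<gamma> z *\<^sub>R v k) * ennreal (sqrt (1 + (\<Sum>s\<in>{..m} - {k}. (partial v s \<gamma> z)\<^sup>2)))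
     \<partial>coord_lebesgue v ({..m} - {k})) = emeasure (graph_measure k \<gamma> \<gamma>') B"
  unfolding emeasure_graph_measure[OF assms]
proof (rule nn_integral_cong_AE, rule AE_mp[OF AE_coord_space[of "{..m} - {k}"]], simp, intro AE_I2 impI)
  fix z assume "z \<in> coord_space ({..m} - {k})"
  then have "z \<in> M" using coord_spaceD by blast
  then have "(\<Sum>s\<in>{..m} - {k}. (partial v s \<gamma> z)\<^sup>2) = (\<Sum>s\<in>{..m} - {k}. (\<gamma>' s z)\<^sup>2)"
    by (intro sum.cong) (auto simp: C1_graph_partial[OF assms(1)])
  then show "indicator B (z + \<gamma> z *\<^sub>R v k) * ennreal (sqrt (1 + (\<Sum>s\<in>{..m} - {k}. (partial v s \<gamma> z)\<^sup>2))) =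
     indicator B (z + \<gamma> z *\<^sub>R v k) * ennreal (graph_density k \<gamma>' z)" by (simp add: graph_density_def)
qed

text \<open>Trades functions known on \<open>M\<close> for \<open>C1_graph\<close> data. Extending
  through \<open>proj\<close> changes neither the piece of \<Gamma>, which lies in \<open>M\<close>,
  nor the defining integral, whose measure is carried by \<open>M\<close>.\<close>

lemma is_surface_measure_iff:
  "is_surface_measure M v m \<Gamma> \<mu> \<longleftrightarrow> sets \<mu> = sets borel \<and> emeasure \<mu> (- \<Gamma>) = 0 \<and>
     (\<forall>k \<gamma> \<gamma>' U B. graph_piece \<Gamma> k \<gamma> \<gamma>' U \<and> B \<in> sets borel \<and> B \<subseteq> \<Gamma> \<inter> U \<longrightarrow>
        emeasure \<mu> B = emeasure (graph_measure k \<gamma> \<gamma>') B)" (is "_ \<longleftrightarrow> ?R")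
proof
  assume L: "is_surface_measure M v m \<Gamma> \<mu>"
  have "emeasure \<mu> B = emeasure (graph_measure k \<gamma> \<gamma>') B"
    if "graph_piece \<Gamma> k \<gamma> \<gamma>' U" "B \<in> sets borel" "B \<subseteq> \<Gamma> \<inter> U" for k \<gamma> \<gamma>' U B
  proof -
    have G: "C1_graph k \<gamma> \<gamma>'" and U: "open U" "\<Gamma> \<inter> U = {z \<in> M \<inter> U. z \<bullet> v k = \<gamma> z}"
      using that(1) by (auto simp: graph_piece_def)
    show ?thesis
      using L C1_graph_Ck_on[OF G] C1_graphD(1)[OF G] U that(2,3)
      unfolding is_surface_measure_def graph_piece_measure_eq[OF G that(2), symmetric] by blast
  qed
  then show ?R using L by (auto simp: is_surface_measure_def)
next
  assume R: ?R
  show "is_surface_measure M v m \<Gamma> \<mu>" unfolding is_surface_measure_def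
  proof (intro conjI allI impI)
    fix k \<gamma> U B
    assume k: "k \<le> m" and H: "Ck_on v m 1 M \<gamma> \<and> indep_coord M v k \<gamma> \<and> open U \<and>
      \<Gamma> \<inter> U = {z \<in> M \<inter> U. z \<bullet> v k = \<gamma> z} \<and> B \<in> sets borel \<and> B \<subseteq> \<Gamma> \<inter> U"
    let ?g = "\<lambda>z. \<gamma> (proj z)" and ?g' = "\<lambda>s z. partial v s \<gamma> (proj z)"
    have G: "C1_graph k ?g ?g'" using C1_graph_extend k H by blast
    have "\<Gamma> \<inter> U = {z \<in> M \<inter> U. z \<bullet> v k = ?g z}" using H by (auto simp: proj_id)
    then have "emeasure \<mu> B = emeasure (graph_measure k ?g ?g') B"
      using R H G unfolding graph_piece_def by blast
    also have "\<dots> = (\<integral>\<^sup>+ z. indicator B (z + \<gamma> z *\<^sub>R v k) * ennreal (sqrt (1 + (\<Sum>s\<in>{..m} - {k}. (partial v s \<gamma> z)\<^sup>2)))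
       \<partial>coord_lebesgue v ({..m} - {k}))"
      unfolding emeasure_graph_measure[OF G conjunct1[OF conjunct2[OF conjunct2[OF conjunct2[OF conjunct2[OF H]]]]]]
    proof (rule nn_integral_cong_AE, rule AE_mp[OF AE_coord_space[of "{..m} - {k}"]], simp, intro AE_I2 impI)
      fix z assume "z \<in> coord_space ({..m} - {k})"
      then have "z \<in> M" using coord_spaceD by blast
      then show "indicator B (z + ?g z *\<^sub>R v k) * ennreal (graph_density k ?g' z) =
        indicator B (z + \<gamma> z *\<^sub>R v k) * ennreal (sqrt (1 + (\<Sum>s\<in>{..m} - {k}. (partial v s \<gamma> z)\<^sup>2)))"
        by (simp add: graph_density_def proj_id)
    qed
    finally show "emeasure \<mu> B = (\<integral>\<^sup>+ z. indicator B (z + \<gamma> z *\<^sub>R v k) * ennreal (sqrt (1 + (\<Sum>s\<in>{..m} - {k}. (partial v s \<gamma> z)\<^sup>2)))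
       \<partial>coord_lebesgue v ({..m} - {k}))" .
  qed (use R in auto)
qed

lemma emeasure_finite_partition:
  fixes n :: nat
  assumes "sets \<mu> = sets borel" "B \<in> sets borel" "\<And>i. i < n \<Longrightarrow> P i \<in> sets borel"
    "disjoint_family_on P {..<n}" "B \<subseteq> (\<Union>i<n. P i)"
  shows "emeasure \<mu> B = (\<Sum>i<n. emeasure \<mu> (B \<inter> P i))"
proof -
  have "B = (\<Union>i\<in>{..<n}. B \<inter> P i)" using assms(5) by blast
  moreover have "(\<Sum>i<n. emeasure \<mu> (B \<inter> P i)) = emeasure \<mu> (\<Union>i\<in>{..<n}. B \<inter> P i)"
  proof (rule sum_emeasure)
    show "disjoint_family_on (\<lambda>i. B \<inter> P i) {..<n}" using assms(4) unfolding disjoint_family_on_def by fast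
  qed (use assms in auto)
  ultimately show ?thesis by simp
qed

text \<open>Existence: glue the graph measures along a finite disjoint partition; consistency of
  overlapping graphs gives the prescribed value on every other piece. Uniqueness: a candidate
  ignores the complement of \<Gamma> and is prescribed on each part of the partition.\<close>

lemma ex1_surface_measure:
  assumes \<Gamma>: "compact_hypersurface \<Gamma>"
  shows "\<exists>!\<mu>. is_surface_measure M v m \<Gamma> \<mu>"
proof -
  have cpt: "compact \<Gamma>" using \<Gamma> by (simp add: compact_hypersurface_def)
  then have bd: "bounded \<Gamma>" and B\<Gamma>: "\<Gamma> \<in> sets borel" by (auto simp: compact_imp_bounded borel_compact)
  obtain n :: nat and k \<gamma> \<gamma>' U P where P0:
    "\<forall>i<n. graph_piece \<Gamma> (k i) (\<gamma> i) (\<gamma>' i) (U i) \<and> P i \<in> sets borel \<and> P i \<subseteq> \<Gamma> \<inter> U i"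
    "disjoint_family_on P {..<n}" "(\<Union>i<n. P i) = \<Gamma>"
    by (rule hypersurface_partition[OF \<Gamma>])
  have P: "\<And>i. i < n \<Longrightarrow> graph_piece \<Gamma> (k i) (\<gamma> i) (\<gamma>' i) (U i)" 
    "\<And>i. i < n \<Longrightarrow> P i \<in> sets borel" "\<And>i. i < n \<Longrightarrow> P i \<subseteq> \<Gamma> \<inter> U i"
    "disjoint_family_on P {..<n}" "(\<Union>i<n. P i) = \<Gamma>"
    using P0 by simp_all
  define \<nu> where "\<nu> i = graph_measure (k i) (\<gamma> i) (\<gamma>' i)" for i
  have s\<nu>: "sets (\<nu> i) = sets borel" for i by (simp add: \<nu>_def)
  \<comment> \<open>Each part of the partition is measured by the graph measure of its own
    piece.\<close>
  define \<mu> where "\<mu> = measure_of UNIV (sets borel) (\<lambda>B. \<Sum>i<n. emeasure (\<nu> i) (B \<inter> P i))"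
  have s\<mu>: "sets \<mu> = sets borel" unfolding \<mu>_def
    by (simp add: sets_measure_of_conv sets.sigma_sets_eq[of borel, simplified])
  have e\<mu>: "emeasure \<mu> B = (\<Sum>i<n. emeasure (\<nu> i) (B \<inter> P i))" if "B \<in> sets borel" for B
    unfolding \<mu>_def
  proof (rule emeasure_measure_of_sigma)
    show "sigma_algebra UNIV (sets borel)" using sets.sigma_algebra_axioms[of borel] by simp
    show "positive (sets borel) (\<lambda>B. \<Sum>i<n. emeasure (\<nu> i) (B \<inter> P i))" by (simp add: positive_def)
    show "countably_additive (sets borel) (\<lambda>B. \<Sum>i<n. emeasure (\<nu> i) (B \<inter> P i))"
    proof (rule countably_additiveI)
      fix A :: "nat \<Rightarrow> 'a set" assume A: "range A \<subseteq> sets borel" "disjoint_family A"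
      have "(\<Sum>j. \<Sum>i<n. emeasure (\<nu> i) (A j \<inter> P i)) = (\<Sum>i<n. \<Sum>j. emeasure (\<nu> i) (A j \<inter> P i))"
        by (rule suminf_sum) simp
      also have "\<dots> = (\<Sum>i<n. emeasure (\<nu> i) (\<Union>j. A j \<inter> P i))"
        using A P(2) by (intro sum.cong refl suminf_emeasure) (auto simp: s\<nu> disjoint_family_on_def)
      finally show "(\<Sum>j. \<Sum>i<n. emeasure (\<nu> i) (A j \<inter> P i)) = (\<Sum>i<n. emeasure (\<nu> i) (\<Union> (range A) \<inter> P i))"
        by simp
    qed
  qed fact
  show ?thesis
  proof (rule ex1I[of _ \<mu>])
    show "is_surface_measure M v m \<Gamma> \<mu>"
      unfolding is_surface_measure_iff
    proof (intro conjI allI impI s\<mu>)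
      have "- \<Gamma> \<inter> P i = {}" if "i < n" for i using P(3)[OF that] by blast
      then show "emeasure \<mu> (- \<Gamma>) = 0" using B\<Gamma> by (subst e\<mu>) auto
    next
      fix l \<delta> \<delta>' V B
      assume H: "graph_piece \<Gamma> l \<delta> \<delta>' V \<and> B \<in> sets borel \<and> B \<subseteq> \<Gamma> \<inter> V"
      have "emeasure \<mu> B = (\<Sum>i<n. emeasure (\<nu> i) (B \<inter> P i))" using H by (intro e\<mu>) blast
      also have "\<dots> = (\<Sum>i<n. emeasure (graph_measure l \<delta> \<delta>') (B \<inter> P i))"
      proof (rule sum.cong[OF refl])
        fix i assume "i \<in> {..<n}"
        then have i: "i < n" by simp
        \<comment> \<open>Consistency is available for bounded sets, and compactness of \<Gamma>
          supplies the bound.\<close>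
        have "bounded (B \<inter> P i)" using bd P(3)[OF i] by (meson bounded_subset inf.coboundedI2 le_inf_iff)
        then show "emeasure (\<nu> i) (B \<inter> P i) = emeasure (graph_measure l \<delta> \<delta>') (B \<inter> P i)"
          using P(1)[OF i] P(2)[OF i] P(3)[OF i] H unfolding \<nu>_def graph_piece_def
          by (intro graph_measure_consistent[of _ _ _ _ _ _ "U i" V \<Gamma>]) auto
      qed
      also have "\<dots> = emeasure (graph_measure l \<delta> \<delta>') B"
        by (rule emeasure_finite_partition[symmetric]) (use P H in auto)
      finally show "emeasure \<mu> B = emeasure (graph_measure l \<delta> \<delta>') B" .
    qed
  next
    fix \<mu>' assume "is_surface_measure M v m \<Gamma> \<mu>'"
    then have \<mu>': "sets \<mu>' = sets borel" "emeasure \<mu>' (- \<Gamma>) = 0"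
      "\<And>k \<gamma> \<gamma>' U B. graph_piece \<Gamma> k \<gamma> \<gamma>' U \<Longrightarrow> B \<in> sets borel \<Longrightarrow> B \<subseteq> \<Gamma> \<inter> U \<Longrightarrow>
        emeasure \<mu>' B = emeasure (graph_measure k \<gamma> \<gamma>') B"
      unfolding is_surface_measure_iff by blast+
    show "\<mu>' = \<mu>"
    proof (rule measure_eqI)
      fix B assume "B \<in> sets \<mu>'"
      then have B: "B \<in> sets borel" by (simp add: \<mu>')
      have "emeasure \<mu>' B = emeasure \<mu>' (B \<inter> \<Gamma>)"
      proof (rule emeasure_eq_AE)
        have "- \<Gamma> \<in> null_sets \<mu>'" using \<mu>' B\<Gamma> by (simp add: null_sets_def)
        then have "AE x in \<mu>'. x \<notin> - \<Gamma>" by (rule AE_not_in)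
        then show "AE x in \<mu>'. x \<in> B \<longleftrightarrow> x \<in> B \<inter> \<Gamma>" by (rule AE_mp) simp
      qed (use B B\<Gamma> \<mu>' in auto)
      also have "\<dots> = (\<Sum>i<n. emeasure \<mu>' (B \<inter> \<Gamma> \<inter> P i))"
        by (rule emeasure_finite_partition) (use \<mu>' B B\<Gamma> P in auto)
      also have "\<dots> = (\<Sum>i<n. emeasure (\<nu> i) (B \<inter> P i))"
      proof (rule sum.cong[OF refl])
        fix i assume "i \<in> {..<n}"
        then have i: "i < n" by simp
        have "B \<inter> \<Gamma> \<inter> P i = B \<inter> P i" using P(3)[OF i] by blast
        moreover have "emeasure \<mu>' (B \<inter> P i) = emeasure (\<nu> i) (B \<inter> P i)"
          unfolding \<nu>_def by (rule \<mu>'(3)[OF P(1)[OF i]]) (use P(2,3)[OF i] B in auto)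
        ultimately show "emeasure \<mu>' (B \<inter> \<Gamma> \<inter> P i) = emeasure (\<nu> i) (B \<inter> P i)" by simp
      qed
      also have "\<dots> = emeasure \<mu> B" by (rule e\<mu>[OF B, symmetric])
      finally show "emeasure \<mu>' B = emeasure \<mu> B" .
    qed (simp add: \<mu>' s\<mu>)
  qed
qed

lemma surface_measure:
  assumes \<Gamma>: "compact_hypersurface \<Gamma>"
  shows "sets (surface_measure M v m \<Gamma>) = sets borel" "emeasure (surface_measure M v m \<Gamma>) (- \<Gamma>) = 0"
    "graph_piece \<Gamma> k \<gamma> \<gamma>' U \<Longrightarrow> B \<in> sets borel \<Longrightarrow> B \<subseteq> \<Gamma> \<inter> U \<Longrightarrow>
        emeasure (surface_measure M v m \<Gamma>) B = emeasure (graph_measure k \<gamma> \<gamma>') B"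
  using theI'[OF ex1_surface_measure[OF \<Gamma>], folded surface_measure_def] unfolding is_surface_measure_iff by blast+

lemma emeasure_surface_finite:
  assumes \<Gamma>: "compact_hypersurface \<Gamma>"
  shows "emeasure (surface_measure M v m \<Gamma>) \<Gamma> < \<infinity>"
proof -
  have cpt: "compact \<Gamma>" using \<Gamma> by (simp add: compact_hypersurface_def)
  obtain n :: nat and k \<gamma> \<gamma>' U P where P0:
    "\<forall>i<n. graph_piece \<Gamma> (k i) (\<gamma> i) (\<gamma>' i) (U i) \<and> P i \<in> sets borel \<and> P i \<subseteq> \<Gamma> \<inter> U i"
    "disjoint_family_on P {..<n}" "(\<Union>i<n. P i) = \<Gamma>"
    by (rule hypersurface_partition[OF \<Gamma>])
  have P: "\<And>i. i < n \<Longrightarrow> graph_piece \<Gamma> (k i) (\<gamma> i) (\<gamma>' i) (U i)" 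
    "\<And>i. i < n \<Longrightarrow> P i \<in> sets borel" "\<And>i. i < n \<Longrightarrow> P i \<subseteq> \<Gamma> \<inter> U i"
    "disjoint_family_on P {..<n}" "(\<Union>i<n. P i) = \<Gamma>"
    using P0 by simp_all
  have "emeasure (surface_measure M v m \<Gamma>) (P i) < \<infinity>" if i: "i < n" for i
  proof -
    have "bounded (P i)" using cpt P(3)[OF i] by (meson bounded_subset compact_imp_bounded le_inf_iff)
    then show ?thesis using surface_measure(3)[OF \<Gamma> P(1,2,3)[OF i]] P(1,2)[OF i] emeasure_graph_measure_bounded
      by (auto simp: graph_piece_def)
  qed
  moreover have "emeasure (surface_measure M v m \<Gamma>) \<Gamma> = (\<Sum>i<n. emeasure (surface_measure M v m \<Gamma>) (\<Gamma> \<inter> P i))"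
    by (rule emeasure_finite_partition) (use P cpt in \<open>auto simp: surface_measure[OF \<Gamma>] borel_compact\<close>)
  moreover have "\<Gamma> \<inter> P i = P i" if "i < n" for i using P(3)[OF that] by blast
  ultimately show ?thesis by simp
qed

text \<open>The surface measure and the graph measure agree only on Borel subsets of \<Gamma>
  \<inter> U. Cutting both down by the indicator of that set as density makes them equal as
  measures, and an F supported there does not notice the cut.\<close>

lemma integral_surface_measure_piece:
  fixes F :: "'a \<Rightarrow> 'b::euclidean_space"
  assumes \<Gamma>: "compact_hypersurface \<Gamma>" and gp: "graph_piece \<Gamma> k \<gamma> \<gamma>' U"
    and F: "F \<in> borel_measurable borel" "\<And>z. z \<notin> \<Gamma> \<inter> U \<Longrightarrow> F z = 0"
  shows "(\<integral>z. F z \<partial>surface_measure M v m \<Gamma>) =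
    (\<integral>z. graph_density k \<gamma>' z *\<^sub>R F (z + \<gamma> z *\<^sub>R v k) \<partial>coord_lebesgue v ({..m} - {k}))"
proof -
  let ?\<mu> = "surface_measure M v m \<Gamma>" and ?\<nu> = "graph_measure k \<gamma> \<gamma>'" and ?G = "\<Gamma> \<inter> U"
  have G: "C1_graph k \<gamma> \<gamma>'" using gp by (simp add: graph_piece_def)
  note [measurable] = C1_graph_measurable[OF G] F(1)
  note [measurable_cong] = surface_measure(1)[OF \<Gamma>]
  have [measurable]: "?G \<in> sets borel"
    using \<Gamma> gp by (intro sets.Int borel_compact borel_open) (simp_all add: compact_hypersurface_def graph_piece_def)
  have emb: "emeasure (density N (\<lambda>x. ennreal (indicator ?G x))) B = emeasure N (B \<inter> ?G)"
    if "sets N = sets borel" "B \<in> sets borel" for N B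
  proof -
    note [measurable_cong] = that(1)
    have "emeasure (density N (\<lambda>x. ennreal (indicator ?G x))) B = (\<integral>\<^sup>+x. ennreal (indicator ?G x) * indicator B x \<partial>N)"
      using that by (intro emeasure_density) auto
    also have "\<dots> = (\<integral>\<^sup>+x. indicator (B \<inter> ?G) x \<partial>N)"
      by (intro nn_integral_cong) (auto split: split_indicator)
    also have "\<dots> = emeasure N (B \<inter> ?G)" using that by (intro nn_integral_indicator) auto
    finally show ?thesis .
  qed
  have eq: "density ?\<mu> (\<lambda>x. ennreal (indicator ?G x)) = density ?\<nu> (\<lambda>x. ennreal (indicator ?G x))"
  proof (rule measure_eqI)
    fix B assume "B \<in> sets (density ?\<mu> (\<lambda>x. ennreal (indicator ?G x)))"
    then have B: "B \<in> sets borel" by (simp add: surface_measure(1)[OF \<Gamma>])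
    have "emeasure ?\<mu> (B \<inter> ?G) = emeasure ?\<nu> (B \<inter> ?G)"
      by (rule surface_measure(3)[OF \<Gamma> gp]) (use B in auto)
    then show "emeasure (density ?\<mu> (\<lambda>x. ennreal (indicator ?G x))) B = emeasure (density ?\<nu> (\<lambda>x. ennreal (indicator ?G x))) B"
      using B by (simp add: emb surface_measure(1)[OF \<Gamma>])
  qed (simp add: surface_measure(1)[OF \<Gamma>])
  have dens: "(\<integral>z. F z \<partial>density N (\<lambda>x. ennreal (indicator ?G x))) = (\<integral>z. F z \<partial>N)"
    if N: "sets N = sets borel" for N
  proof -
    note [measurable_cong] = N
    have "(\<integral>z. F z \<partial>density N (\<lambda>x. ennreal (indicator ?G x))) = (\<integral>z. indicator ?G z *\<^sub>R F z \<partial>N)"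
      by (rule integral_density) auto
    also have "(\<lambda>z. indicator ?G z *\<^sub>R F z) = F" using F(2) by (auto simp: fun_eq_iff split: split_indicator)
    finally show ?thesis .
  qed
  have "(\<integral>z. F z \<partial>?\<mu>) = (\<integral>z. F z \<partial>?\<nu>)"
    using dens[of ?\<mu>] dens[of ?\<nu>] eq surface_measure(1)[OF \<Gamma>] by simp
  also have "\<dots> = (\<integral>z. F (z + \<gamma> z *\<^sub>R v k) \<partial>density (coord_lebesgue v ({..m} - {k})) (\<lambda>z. ennreal (graph_density k \<gamma>' z)))"
    unfolding graph_measure_def by (rule integral_distr) auto
  also have "\<dots> = (\<integral>z. graph_density k \<gamma>' z *\<^sub>R F (z + \<gamma> z *\<^sub>R v k) \<partial>coord_lebesgue v ({..m} - {k}))"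
    using graph_density_ge_1[of k \<gamma>'] by (intro integral_density) (auto intro!: AE_I2 order_trans[OF zero_le_one])
  finally show ?thesis .
qed

end

section \<open>Charts and the exterior normal\<close>

context orthonormal_frame
begin

definition chart :: "'a set \<Rightarrow> 'a \<Rightarrow> real \<Rightarrow> nat \<Rightarrow> real \<Rightarrow> ('a \<Rightarrow> real) \<Rightarrow> (nat \<Rightarrow> 'a \<Rightarrow> real) \<Rightarrow> bool" where
  "chart \<Omega> p r k \<sigma> \<gamma> \<gamma>' \<longleftrightarrow> r > 0 \<and> (\<sigma> = 1 \<or> \<sigma> = -1) \<and> C1_graph k \<gamma> \<gamma>' \<and>
     \<Omega> \<inter> ball p r = side k \<sigma> \<gamma> \<inter> ball p r"

lemma boundary_in_eq:
  assumes "openin (top_of_set M) \<Omega>"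
  shows "boundary_in M \<Omega> = closure \<Omega> - \<Omega>" "closure \<Omega> \<subseteq> M"
proof -
  have sub: "\<Omega> \<subseteq> M" using assms by (rule openin_imp_subset)
  then show cl: "closure \<Omega> \<subseteq> M" using closed_frame by (rule closure_minimal)
  have "(top_of_set M) closure_of \<Omega> = closure \<Omega>"
    using sub cl by (simp add: closure_of_subtopology Int_absorb1)
  then show "boundary_in M \<Omega> = closure \<Omega> - \<Omega>"
    using assms by (simp add: boundary_in_def frontier_of_def interior_of_openin)
qed

text \<open>Points strictly below the graph have a neighbourhood missing \<Omega>. Points on or
  above it are approached from inside the side along \<sigma> v_k.\<close>

lemma chart_closure:
  assumes op: "openin (top_of_set M) \<Omega>" and ch: "chart \<Omega> p r k \<sigma> \<gamma> \<gamma>'"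
  shows "closure \<Omega> \<inter> ball p r = closed_side k \<sigma> \<gamma> \<inter> ball p r"
proof -
  have G: "C1_graph k \<gamma> \<gamma>'" and \<sigma>: "\<sigma> = 1 \<or> \<sigma> = -1" and side: "\<Omega> \<inter> ball p r = side k \<sigma> \<gamma> \<inter> ball p r"
    using ch by (auto simp: chart_def)
  note k = C1_graphD(1)[OF G]
  show ?thesis
  proof (intro equalityI subsetI)
    fix z assume z: "z \<in> closure \<Omega> \<inter> ball p r"
    have zM: "z \<in> M" using z boundary_in_eq(2)[OF op] by blast
    have "\<sigma> * (z \<bullet> v k - \<gamma> z) \<ge> 0"
    proof (rule ccontr)
      assume neg: "\<not> \<sigma> * (z \<bullet> v k - \<gamma> z) \<ge> 0"
      let ?W = "{y. \<sigma> * (y \<bullet> v k - \<gamma> y) < 0} \<inter> ball p r"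
      have "open ?W"
        by (intro open_Int open_ball open_Collect_less continuous_intros C1_graphD(2)[OF G])
      moreover have "z \<in> ?W" using neg z by auto
      ultimately obtain y where "y \<in> \<Omega>" "y \<in> ?W"
        using z open_Int_closure_eq_empty[of ?W \<Omega>] by blast
      then have "y \<in> side k \<sigma> \<gamma>" using side by blast
      then show False using \<open>y \<in> ?W\<close> by (simp add: side_def)
    qed
    then show "z \<in> closed_side k \<sigma> \<gamma> \<inter> ball p r" using z zM by (simp add: closed_side_def)
  next
    fix z assume z: "z \<in> closed_side k \<sigma> \<gamma> \<inter> ball p r"
    then have zM: "z \<in> M" and z0: "\<sigma> * (z \<bullet> v k - \<gamma> z) \<ge> 0" and zb: "dist p z < r"
      by (auto simp: closed_side_def)
    have "z \<in> closure \<Omega>" unfolding closure_approachable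
    proof (intro allI impI)
      fix e :: real assume e: "e > 0"
      \<comment> \<open>The halves keep the shifted point strictly within e of z and strictly inside
        the chart ball.\<close>
      define t where "t = min (e / 2) ((r - dist p z) / 2)"
      have t: "t > 0" "t < e" "t < r - dist p z" using e zb by (auto simp: t_def min_def)
      define y where "y = z + (\<sigma> * t) *\<^sub>R v k"
      have dy: "dist y z = t" using t k \<sigma> by (auto simp: y_def dist_norm abs_mult)
      have "\<sigma> * (y \<bullet> v k - \<gamma> y) = \<sigma> * (z \<bullet> v k - \<gamma> z) + t"
        using \<sigma> k by (auto simp: y_def C1_graphD(3)[OF G] inner_add_left frame_orthonormal)
      then have "y \<in> side k \<sigma> \<gamma>" using z0 t zM k by (simp add: side_def y_def)
      moreover have "dist p y < r" using dist_triangle[of p y z] dy t by (simp add: dist_commute)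
      ultimately have "y \<in> \<Omega>" using side by (metis IntD1 IntI mem_ball)
      then show "\<exists>y\<in>\<Omega>. dist y z < e" using dy t by blast
    qed
    then show "z \<in> closure \<Omega> \<inter> ball p r" using z by blast
  qed
qed

lemma chart_boundary:
  assumes op: "openin (top_of_set M) \<Omega>" and ch: "chart \<Omega> p r k \<sigma> \<gamma> \<gamma>'"
  shows "boundary_in M \<Omega> \<inter> ball p r = {z \<in> M \<inter> ball p r. z \<bullet> v k = \<gamma> z}"
proof -
  have "boundary_in M \<Omega> \<inter> ball p r = closure \<Omega> \<inter> ball p r - \<Omega> \<inter> ball p r"
    using boundary_in_eq[OF op] by blast
  also have "\<dots> = closed_side k \<sigma> \<gamma> \<inter> ball p r - side k \<sigma> \<gamma> \<inter> ball p r"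
    using chart_closure[OF op ch] ch by (simp add: chart_def)
  also have "\<dots> = {z \<in> M \<inter> ball p r. z \<bullet> v k = \<gamma> z}"
  proof -
    have "\<sigma> = 1 \<or> \<sigma> = -1" using ch unfolding chart_def by blast
    then have "(\<sigma> * x \<ge> 0 \<and> \<not> \<sigma> * x > 0) = (x = 0)" for x by auto
    from this[of "_ \<bullet> v k - \<gamma> _"] show ?thesis unfolding side_def closed_side_def by fastforce
  qed
  finally show ?thesis .
qed

lemma chart_graph_piece:
  assumes op: "openin (top_of_set M) \<Omega>" and ch: "chart \<Omega> p r k \<sigma> \<gamma> \<gamma>'"
  shows "graph_piece (boundary_in M \<Omega>) k \<gamma> \<gamma>' (ball p r)"
  using chart_boundary[OF assms] ch by (auto simp: graph_piece_def chart_def)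

text \<open>The gradient of x_k - \<gamma>; the coefficient of \<open>v k\<close> is 1 because
  \<gamma> does not depend on x_k.\<close>

definition conormal :: "nat \<Rightarrow> (nat \<Rightarrow> 'a \<Rightarrow> real) \<Rightarrow> 'a \<Rightarrow> 'a" where
  "conormal k \<gamma>' y = (\<Sum>s\<le>m. (if s = k then 1 else - \<gamma>' s y) *\<^sub>R v s)"

text \<open>\<Omega> lies where \<sigma> (x_k - \<gamma>) is positive, hence the outward sign -
  \<sigma>. The normalising factor is the surface density (\<open>norm_conormal\<close>), so the two
  cancel in the boundary integral.\<close>

definition graph_normal :: "nat \<Rightarrow> real \<Rightarrow> (nat \<Rightarrow> 'a \<Rightarrow> real) \<Rightarrow> 'a \<Rightarrow> 'a" where
  "graph_normal k \<sigma> \<gamma>' y = (- \<sigma> / graph_density k \<gamma>' y) *\<^sub>R conormal k \<gamma>' y"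

lemma conormal_in [simp]: "conormal k \<gamma>' y \<in> M"
  unfolding conormal_def by (rule frame_sum) simp

lemma inner_conormal: "s \<le> m \<Longrightarrow> conormal k \<gamma>' y \<bullet> v s = (if s = k then 1 else - \<gamma>' s y)"
  unfolding conormal_def by (subst inner_sum_frame) auto

lemma inner_conormal_left:
  assumes "C1_graph k \<gamma> \<gamma>'" "y \<in> M"
  shows "conormal k \<gamma>' y \<bullet> w = w \<bullet> v k - (\<Sum>s\<le>m. (w \<bullet> v s) * \<gamma>' s y)"
proof -
  note k = C1_graphD(1)[OF assms(1)]
  have "conormal k \<gamma>' y \<bullet> w = (\<Sum>s\<le>m. (if s = k then 1 else - \<gamma>' s y) * (v s \<bullet> w))"
    unfolding conormal_def inner_sum_left by simp
  also have "\<dots> = (\<Sum>s\<le>m. (if s = k then w \<bullet> v k else 0) - (w \<bullet> v s) * \<gamma>' s y)"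
    using C1_graph_self_derivative[OF assms] by (intro sum.cong) (auto simp: inner_commute)
  also have "\<dots> = w \<bullet> v k - (\<Sum>s\<le>m. (w \<bullet> v s) * \<gamma>' s y)" using k by (simp add: sum_subtractf)
  finally show ?thesis .
qed

lemma norm_conormal:
  assumes "k \<le> m"
  shows "norm (conormal k \<gamma>' y) = graph_density k \<gamma>' y"
proof -
  have "(norm (conormal k \<gamma>' y))\<^sup>2 = (\<Sum>s\<le>m. (if s = k then 1 else - \<gamma>' s y)\<^sup>2)"
    unfolding conormal_def by (rule norm_frame_sum) simp
  also have "\<dots> = 1 + (\<Sum>s\<in>{..m} - {k}. (\<gamma>' s y)\<^sup>2)"
    using assms by (subst sum.remove[of _ k]) (auto intro!: sum.cong)
  also have "\<dots> = (graph_density k \<gamma>' y)\<^sup>2"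
    unfolding graph_density_def by (subst real_sqrt_pow2) (auto simp: sum_nonneg add_nonneg_nonneg)
  finally show ?thesis using graph_density_ge_1[of k \<gamma>' y] by (simp add: power2_eq_iff_nonneg)
qed

text \<open>The gradient of the defining function annihilates all velocities in the boundary, and
  the strict decrease of \<sigma> (x_k - \<gamma>) along the normal line gives the two one-sided
  conditions. Conversely the lifted curves already force a candidate to be a multiple of the
  conormal; unit length leaves two signs, and the one-sided conditions exclude the wrong
  one.\<close>

lemma exterior_normal_eq:
  assumes op: "openin (top_of_set M) \<Omega>" and ch: "chart \<Omega> p r k \<sigma> \<gamma> \<gamma>'"
    and y: "y \<in> boundary_in M \<Omega>" "y \<in> ball p r"
  shows "exterior_normal M \<Omega> y = graph_normal k \<sigma> \<gamma>' y"
proof -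
  let ?\<Gamma> = "boundary_in M \<Omega>" and ?\<nu> = "graph_normal k \<sigma> \<gamma>' y" and ?N = "conormal k \<gamma>' y" and ?d = "graph_density k \<gamma>' y"
  have G: "C1_graph k \<gamma> \<gamma>'" and \<sigma>: "\<sigma> = 1 \<or> \<sigma> = -1" and side: "\<Omega> \<inter> ball p r = side k \<sigma> \<gamma> \<inter> ball p r"
    using ch by (auto simp: chart_def)
  note k = C1_graphD(1)[OF G]
  note bd = chart_boundary[OF op ch]
  have "y \<in> {z \<in> M \<inter> ball p r. z \<bullet> v k = \<gamma> z}" using y unfolding bd[symmetric] by blast
  then have yM: "y \<in> M" "y \<bullet> v k = \<gamma> y" by simp_all
  have d1: "?d \<ge> 1" by (rule graph_density_ge_1)
  have \<nu>M: "?\<nu> \<in> M" unfolding graph_normal_def by (rule frame_scale) simp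
  have n\<nu>: "norm ?\<nu> = 1" using \<sigma> d1 by (auto simp: graph_normal_def norm_conormal[OF k])
  have tan: "?N \<bullet> w = 0" if w: "w \<in> tangent_vectors ?\<Gamma> y" for w
  proof -
    obtain c where c: "c 0 = y" "eventually (\<lambda>t. c t \<in> ?\<Gamma>) (at 0)" "(c has_vector_derivative w) (at 0)"
      using w unfolding tangent_vectors_def by blast
    have "(c \<longlongrightarrow> y) (at 0)" using has_vector_derivative_continuous[OF c(3)] c(1) by (simp add: isCont_def)
    then have "eventually (\<lambda>t. c t \<in> ball p r) (at 0)" using y(2) by (intro topological_tendstoD) auto
    with c(2) have ev: "eventually (\<lambda>t. c t \<in> M \<and> c t \<bullet> v k = \<gamma> (c t)) (at 0)"
    proof eventually_elim
      case (elim t)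
      then have "c t \<in> {z \<in> M \<inter> ball p r. z \<bullet> v k = \<gamma> z}" unfolding bd[symmetric] by blast
      then show ?case by simp
    qed
    have "((\<lambda>t. \<gamma> (c t)) has_vector_derivative (\<Sum>s\<le>m. (w \<bullet> v s) *\<^sub>R \<gamma>' s y)) (at 0)"
      by (rule vector_derivative_along_curve[OF _ c(3)])
        (use C1_graph_has_derivative[OF G yM(1)] c(1) yM ev in \<open>auto elim: eventually_mono\<close>)
    then have "((\<lambda>t. c t \<bullet> v k) has_vector_derivative (\<Sum>s\<le>m. (w \<bullet> v s) *\<^sub>R \<gamma>' s y)) (at 0)"
      unfolding has_vector_derivative_def
      by (rule has_derivative_transform_eventually) (use ev c(1) yM in \<open>auto elim: eventually_mono\<close>)
    moreover have "((\<lambda>t. c t \<bullet> v k) has_vector_derivative w \<bullet> v k) (at 0)"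
      by (rule bounded_linear.has_vector_derivative[OF bounded_linear_inner_left c(3)])
    ultimately have "w \<bullet> v k = (\<Sum>s\<le>m. (w \<bullet> v s) *\<^sub>R \<gamma>' s y)" using vector_derivative_unique_at by blast
    then show ?thesis by (simp add: inner_conormal_left[OF G yM(1)])
  qed
  \<comment> \<open>The defining function along the normal line; its derivative at 0 is minus the
    density, hence negative.\<close>
  define \<phi> where "\<phi> t = \<sigma> * ((y + t *\<^sub>R ?\<nu>) \<bullet> v k - \<gamma> (y + t *\<^sub>R ?\<nu>))" for t
  have \<phi>0: "\<phi> 0 = 0" using yM by (simp add: \<phi>_def)
  have d\<phi>: "(\<phi> has_real_derivative - ?d) (at 0)"
  proof -
    have dl: "((\<lambda>t. y + t *\<^sub>R ?\<nu>) has_vector_derivative ?\<nu>) (at 0)"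
      by (auto intro!: derivative_eq_intros simp: has_vector_derivative_def)
    have 1: "((\<lambda>t. (y + t *\<^sub>R ?\<nu>) \<bullet> v k) has_vector_derivative ?\<nu> \<bullet> v k) (at 0)"
      by (rule bounded_linear.has_vector_derivative[OF bounded_linear_inner_left dl])
    have 2: "((\<lambda>t. \<gamma> (y + t *\<^sub>R ?\<nu>)) has_vector_derivative (\<Sum>s\<le>m. (?\<nu> \<bullet> v s) *\<^sub>R \<gamma>' s y)) (at 0)"
    proof (rule vector_derivative_along_curve[OF _ dl])
      show "\<forall>\<^sub>F t in at 0. y + t *\<^sub>R ?\<nu> \<in> M"
        by (intro always_eventually allI frame_add yM frame_scale \<nu>M)
    qed (use C1_graph_has_derivative[OF G yM(1)] yM in auto)
    have "(\<phi> has_real_derivative \<sigma> * (?\<nu> \<bullet> v k - (\<Sum>s\<le>m. (?\<nu> \<bullet> v s) *\<^sub>R \<gamma>' s y))) (at 0)"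
      unfolding \<phi>_def using 1 2
      by (auto intro!: derivative_eq_intros simp: has_real_derivative_iff_has_vector_derivative[symmetric])
    also have "?\<nu> \<bullet> v k - (\<Sum>s\<le>m. (?\<nu> \<bullet> v s) *\<^sub>R \<gamma>' s y) = ?N \<bullet> ?\<nu>"
      by (simp add: inner_conormal_left[OF G yM(1)])
    also have "\<sigma> * (?N \<bullet> ?\<nu>) = - ?d"
      using \<sigma> d1 by (auto simp: graph_normal_def power2_norm_eq_inner[symmetric] norm_conormal[OF k] power2_eq_square)
    finally show ?thesis .
  qed
  obtain e1 where e1: "e1 > 0" "\<And>h. 0 < h \<Longrightarrow> h < e1 \<Longrightarrow> \<phi> h < 0"
    using DERIV_neg_dec_right[OF d\<phi>] d1 \<phi>0 by auto
  obtain e2 where e2: "e2 > 0" "\<And>h. 0 < h \<Longrightarrow> h < e2 \<Longrightarrow> 0 < \<phi> (- h)"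
    using DERIV_neg_dec_left[OF d\<phi>] d1 \<phi>0 by auto
  \<comment> \<open>The last term keeps y + t \<nu> and y - t \<nu> in the ball where \<Omega> is
    described by the chart.\<close>
  define \<epsilon> where "\<epsilon> = min (min e1 e2) (r - dist p y)"
  have \<epsilon>: "\<epsilon> > 0" using e1 e2 y by (simp add: \<epsilon>_def)
  have cross: "y - t *\<^sub>R ?\<nu> \<in> \<Omega> \<and> y + t *\<^sub>R ?\<nu> \<notin> closure \<Omega>" if t: "0 < t" "t < \<epsilon>" for t
  proof
    have b: "y + u *\<^sub>R ?\<nu> \<in> ball p r" if "\<bar>u\<bar> = t" for u
    proof -
      have "dist y (y + u *\<^sub>R ?\<nu>) = t" using that n\<nu> by (simp add: dist_norm)
      then show ?thesis using dist_triangle[of p "y + u *\<^sub>R ?\<nu>" y] t by (simp add: \<epsilon>_def)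
    qed
    have "y + (- t) *\<^sub>R ?\<nu> \<in> side k \<sigma> \<gamma>"
      using e2(2)[of t] t frame_add[OF yM(1) frame_scale[OF \<nu>M, of "-t"]] unfolding side_def \<phi>_def \<epsilon>_def by simp
    moreover have "y + (- t) *\<^sub>R ?\<nu> \<in> ball p r" using t by (intro b) simp
    ultimately have "y + (- t) *\<^sub>R ?\<nu> \<in> \<Omega>" using side by blast
    then show "y - t *\<^sub>R ?\<nu> \<in> \<Omega>" by simp
    have "y + t *\<^sub>R ?\<nu> \<notin> closed_side k \<sigma> \<gamma>"
      using e1(2)[of t] t unfolding closed_side_def \<phi>_def \<epsilon>_def by simp
    moreover have "y + t *\<^sub>R ?\<nu> \<in> ball p r" using t by (intro b) simp
    ultimately show "y + t *\<^sub>R ?\<nu> \<notin> closure \<Omega>" using chart_closure[OF op ch] by blast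
  qed
  show ?thesis unfolding exterior_normal_def
  proof (rule the_equality)
    show "?\<nu> \<in> M \<and> norm ?\<nu> = 1 \<and> (\<forall>w\<in>tangent_vectors ?\<Gamma> y. ?\<nu> \<bullet> w = 0) \<and>
      (\<exists>\<epsilon>>0. \<forall>t. 0 < t \<and> t < \<epsilon> \<longrightarrow> y - t *\<^sub>R ?\<nu> \<in> \<Omega> \<and> y + t *\<^sub>R ?\<nu> \<notin> closure \<Omega>)"
      using \<nu>M n\<nu> tan \<epsilon> cross by (auto simp: graph_normal_def)
  next
    fix \<nu> assume "\<nu> \<in> M \<and> norm \<nu> = 1 \<and> (\<forall>w\<in>tangent_vectors ?\<Gamma> y. \<nu> \<bullet> w = 0) \<and>
      (\<exists>\<epsilon>>0. \<forall>t. 0 < t \<and> t < \<epsilon> \<longrightarrow> y - t *\<^sub>R \<nu> \<in> \<Omega> \<and> y + t *\<^sub>R \<nu> \<notin> closure \<Omega>)"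
    then obtain \<delta> where \<nu>: "\<nu> \<in> M" "norm \<nu> = 1" "\<And>w. w \<in> tangent_vectors ?\<Gamma> y \<Longrightarrow> \<nu> \<bullet> w = 0"
      and \<delta>: "\<delta> > 0" "\<And>t. 0 < t \<Longrightarrow> t < \<delta> \<Longrightarrow> y - t *\<^sub>R \<nu> \<in> \<Omega>" by blast
    \<comment> \<open>Orthogonality to the velocity v_s + \<gamma>'_s v_k of the lifted
      curve.\<close>
    have "\<nu> \<bullet> v s = - \<gamma>' s y * (\<nu> \<bullet> v k)" if s: "s \<le> m" "s \<noteq> k" for s
    proof -
      note c = graph_curve[OF G open_ball[of p r] yM(1) y(2) yM(2) s]
      have "v s + \<gamma>' s y *\<^sub>R v k \<in> tangent_vectors ?\<Gamma> y"
        unfolding tangent_vectors_def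
      proof (rule CollectI, intro exI conjI)
        show "eventually (\<lambda>u. y + u *\<^sub>R v s + (\<gamma> (y + u *\<^sub>R v s) - \<gamma> y) *\<^sub>R v k \<in> ?\<Gamma>) (at 0)"
          using c(5)
        proof eventually_elim
          case (elim u)
          then have "y + u *\<^sub>R v s + (\<gamma> (y + u *\<^sub>R v s) - \<gamma> y) *\<^sub>R v k \<in> {z \<in> M \<inter> ball p r. z \<bullet> v k = \<gamma> z}"
            using c(2,3)[of u] by blast
          then show ?case unfolding bd[symmetric] by blast
        qed
      qed (use c in auto)
      from \<nu>(3)[OF this] show ?thesis by (simp add: inner_add_right)
    qed
    then have "\<nu> = (\<Sum>s\<le>m. ((\<nu> \<bullet> v k) * (if s = k then 1 else - \<gamma>' s y)) *\<^sub>R v s)"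
      by (subst frame_expand[OF \<nu>(1), symmetric]) (auto intro!: sum.cong)
    also have "\<dots> = (\<nu> \<bullet> v k) *\<^sub>R ?N" by (simp add: conormal_def scaleR_sum_right)
    finally have \<nu>N: "\<nu> = (\<nu> \<bullet> v k) *\<^sub>R ?N" .
    have "norm \<nu> = \<bar>\<nu> \<bullet> v k\<bar> * ?d" by (subst \<nu>N) (simp add: norm_conormal[OF k])
    then have "\<bar>\<nu> \<bullet> v k\<bar> = 1 / ?d" using \<nu>(2) d1 by (simp add: field_simps)
    then have "\<nu> \<bullet> v k = - \<sigma> / ?d \<or> \<nu> \<bullet> v k = - (- \<sigma> / ?d)" using \<sigma> by (auto simp: abs_if split: if_splits)
    then have "\<nu> = ?\<nu> \<or> \<nu> = - ?\<nu>" using \<nu>N by (metis graph_normal_def scaleR_minus_left)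
    moreover have "\<nu> \<noteq> - ?\<nu>"
    proof
      assume eq: "\<nu> = - ?\<nu>"
      \<comment> \<open>Small enough for both conditions: the same point would lie in \<Omega> and
        outside its closure.\<close>
      define t where "t = min \<epsilon> \<delta> / 2"
      have t: "0 < t" "t < \<epsilon>" "t < \<delta>" using \<epsilon> \<delta> by (auto simp: t_def min_def)
      then have "y + t *\<^sub>R ?\<nu> \<in> \<Omega>" using \<delta>(2)[of t] eq by simp
      then show False using cross[OF t(1,2)] closure_subset by blast
    qed
    ultimately show "\<nu> = ?\<nu>" by blast
  qed
qed

lemma C1_graph_conormal_continuous:
  assumes "C1_graph k \<gamma> \<gamma>'"
  shows "continuous_on UNIV (graph_normal k \<sigma> \<gamma>')"
proof -
  have "continuous_on UNIV (\<lambda>y. if s = k then 1 else - \<gamma>' s y)" if "s \<le> m" for s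
    using C1_graphD(4)[OF assms that] by (cases "s = k") (auto intro!: continuous_intros)
  then have "continuous_on UNIV (conormal k \<gamma>')"
    unfolding conormal_def by (intro continuous_intros) auto
  moreover have "graph_density k \<gamma>' y \<noteq> 0" for y using graph_density_ge_1[of k \<gamma>' y] by linarith
  ultimately show ?thesis
    unfolding graph_normal_def
    by (intro continuous_intros continuous_on_graph_density[OF assms]) auto
qed

lemma continuous_on_exterior_normal:
  assumes op: "openin (top_of_set M) \<Omega>"
    and ch: "\<And>p. p \<in> boundary_in M \<Omega> \<Longrightarrow> \<exists>r k \<sigma> \<gamma> \<gamma>'. chart \<Omega> p r k \<sigma> \<gamma> \<gamma>'"
  shows "continuous_on (boundary_in M \<Omega>) (exterior_normal M \<Omega>)"
  unfolding continuous_on_eq_continuous_within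
proof
  fix p assume p: "p \<in> boundary_in M \<Omega>"
  then obtain r k \<sigma> \<gamma> \<gamma>' where c: "chart \<Omega> p r k \<sigma> \<gamma> \<gamma>'" using ch by blast
  have r: "r > 0" using c by (simp add: chart_def)
  have "continuous (at p within boundary_in M \<Omega>) (graph_normal k \<sigma> \<gamma>')"
    using C1_graph_conormal_continuous[of k \<gamma> \<gamma>' \<sigma>] c unfolding chart_def
    by (metis UNIV_I continuous_at_imp_continuous_within continuous_on_eq_continuous_at open_UNIV)
  then show "continuous (at p within boundary_in M \<Omega>) (exterior_normal M \<Omega>)"
    by (rule continuous_transform_within[OF _ r p])
      (use exterior_normal_eq[OF op c] in \<open>auto simp: dist_commute\<close>)
qed

end

section \<open>The divergence theorem\<close>

lemma has_real_derivative_max_zero_square: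
  "((\<lambda>x::real. (max 0 x)\<^sup>2) has_real_derivative 2 * max 0 x) (at x)"
proof (cases "x = 0")
  case True
  have "((\<lambda>y. (max 0 y)\<^sup>2 / y) \<longlongrightarrow> (0::real)) (at 0)"
  proof (rule Lim_null_comparison)
    show "\<forall>\<^sub>F y in at 0. norm ((max 0 y)\<^sup>2 / y) \<le> \<bar>y::real\<bar>"
      by (rule eventually_at_filter[THEN iffD2], rule always_eventually) (auto simp: max_def power2_eq_square)
    show "((\<lambda>y::real. \<bar>y\<bar>) \<longlongrightarrow> 0) (at 0)" by (rule tendsto_rabs_zero) (rule tendsto_ident_at)
  qed
  then show ?thesis using True by (simp add: has_field_derivative_iff)
next
  case False
  then consider "x > 0" | "x < 0" by linarith
  then show ?thesis
  proof cases
    case 1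
    have "((\<lambda>x. x\<^sup>2) has_real_derivative 2 * max 0 x) (at x)"
      using 1 by (auto intro!: derivative_eq_intros)
    then show ?thesis
      by (rule DERIV_cong_ev[THEN iffD1, rotated 3, OF _ refl _ refl])
        (use eventually_nhds_in_open[of "{0<..}" x] 1 in \<open>auto elim!: eventually_mono\<close>)
  next
    case 2
    have "((\<lambda>x. 0) has_real_derivative 2 * max 0 x) (at x)" using 2 by simp
    then show ?thesis
      by (rule DERIV_cong_ev[THEN iffD1, rotated 3, OF _ refl _ refl])
        (use eventually_nhds_in_open[of "{..<0}" x] 2 in \<open>auto elim!: eventually_mono\<close>)
  qed
qed

text \<open>The square of a positive part is C^1, which is all that a partition of unity for C^1
  functions requires.\<close>

definition bump :: "'a::euclidean_space \<Rightarrow> real \<Rightarrow> 'a \<Rightarrow> real" where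
  "bump p \<rho> z = (max 0 (\<rho>\<^sup>2 - (norm (z - p))\<^sup>2))\<^sup>2"

definition bump_deriv :: "'a::euclidean_space \<Rightarrow> real \<Rightarrow> 'a \<Rightarrow> 'a \<Rightarrow> real" where
  "bump_deriv p \<rho> w z = 2 * max 0 (\<rho>\<^sup>2 - (norm (z - p))\<^sup>2) * (- (2 * ((z - p) \<bullet> w)))"

lemma bump_has_vector_derivative:
  "((\<lambda>t. bump p \<rho> (z + t *\<^sub>R w)) has_vector_derivative bump_deriv p \<rho> w z) (at 0)"
proof -
  have eq: "(norm (z + t *\<^sub>R w - p))\<^sup>2 = (norm (z - p))\<^sup>2 + 2 * t * ((z - p) \<bullet> w) + t\<^sup>2 * (w \<bullet> w)" for t
    unfolding power2_norm_eq_inner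
    by (simp add: inner_add inner_diff inner_commute algebra_simps power2_eq_square)
  have "((\<lambda>t. \<rho>\<^sup>2 - (norm (z + t *\<^sub>R w - p))\<^sup>2) has_real_derivative - (2 * ((z - p) \<bullet> w))) (at 0)"
    unfolding eq by (auto intro!: derivative_eq_intros)
  from DERIV_chain2[OF has_real_derivative_max_zero_square this]
  show ?thesis by (simp add: bump_def bump_deriv_def has_real_derivative_iff_has_vector_derivative)
qed

lemma bump_continuous: "continuous_on S (bump p \<rho>)" "continuous_on S (bump_deriv p \<rho> w)"
  unfolding bump_def bump_deriv_def by (auto intro!: continuous_intros)

lemma bump_nonneg: "0 \<le> bump p \<rho> z"
  by (simp add: bump_def)

lemma bump_pos: "dist p z < \<rho> \<Longrightarrow> 0 < bump p \<rho> z"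
  using power_strict_mono[of "norm (z - p)" \<rho> 2] by (simp add: bump_def dist_norm norm_minus_commute)

lemma bump_zero: 
  assumes "dist p z \<ge> \<rho>" "\<rho> \<ge> 0" shows "bump p \<rho> z = 0" "bump_deriv p \<rho> w z = 0"
proof -
  have "\<rho>\<^sup>2 \<le> (norm (z - p))\<^sup>2" using assms by (intro power_mono) (auto simp: dist_norm norm_minus_commute)
  then show "bump p \<rho> z = 0" "bump_deriv p \<rho> w z = 0" by (auto simp: bump_def bump_deriv_def max_def)
qed

section \<open>Local and global divergence theorem on a bounded domain\<close>

locale smooth_domain = orthonormal_frame +
  fixes \<Omega> :: "'a set"
  assumes openin_domain: "openin (top_of_set M) \<Omega>"
    and bounded_domain: "bounded \<Omega>"
    and smooth_boundary: "smooth_boundary M v m \<Omega>"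
begin

abbreviation \<Gamma> :: "'a set" where "\<Gamma> \<equiv> boundary_in M \<Omega>"
abbreviation vol :: "'a measure" where "vol \<equiv> coord_lebesgue v {..m}"
abbreviation surf :: "'a measure" where "surf \<equiv> surface_measure M v m \<Gamma>"
abbreviation normal :: "'a \<Rightarrow> 'a" where "normal \<equiv> exterior_normal M \<Omega>"

lemma domain_subset: "\<Omega> \<subseteq> M" "closure \<Omega> \<subseteq> M" "\<Gamma> \<subseteq> closure \<Omega>" "\<Gamma> \<subseteq> M"
  using boundary_in_eq[OF openin_domain] closure_subset[of \<Omega>] by auto

lemma compact_closure_domain: "compact (closure \<Omega>)"
  using bounded_domain by (simp add: compact_closure)

lemma compact_boundary: "compact \<Gamma>"
proof -
  obtain T where T: "open T" "\<Omega> = M \<inter> T" using openin_domain unfolding openin_open by blast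
  then have "\<Gamma> = closure \<Omega> - T" using boundary_in_eq[OF openin_domain] by blast
  then show ?thesis using compact_closure_domain T(1) by (simp add: compact_diff)
qed

lemma borel_domain [measurable]: "\<Omega> \<in> sets borel" "\<Gamma> \<in> sets borel" "closure \<Omega> \<in> sets borel"
proof -
  obtain T where "open T" "\<Omega> = M \<inter> T" using openin_domain unfolding openin_open by blast
  then show "\<Omega> \<in> sets borel" by auto
qed (auto simp: borel_compact compact_boundary)

text \<open>An interior point has a chart as well: below it, the domain lies over a graph that
  does not meet the chart.\<close>

lemma chart_exists:
  assumes p: "p \<in> closure \<Omega>"
  shows "\<exists>r k \<sigma> \<gamma> \<gamma>'. chart \<Omega> p r k \<sigma> \<gamma> \<gamma>'"
proof (cases "p \<in> \<Omega>")
  case True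
  then obtain r where r: "r > 0" "ball p r \<inter> M \<subseteq> \<Omega>"
    using openin_domain unfolding openin_contains_ball by blast
  \<comment> \<open>A constant graph at height p_0 - r touches the ball from below, so the whole
    open ball is above it.\<close>
  have "C1_graph 0 (\<lambda>_. p \<bullet> v 0 - r) (\<lambda>_ _. 0)" by (simp add: C1_graph_def)
  moreover have "z \<in> side 0 1 (\<lambda>_. p \<bullet> v 0 - r)" if "z \<in> \<Omega>" "z \<in> ball p r" for z
  proof -
    have "\<bar>(p - z) \<bullet> v 0\<bar> < r" using abs_inner_frame_le[of 0 "p - z"] that by (simp add: dist_norm)
    then show ?thesis using that domain_subset by (auto simp: side_def inner_diff_left)
  qed
  moreover have "z \<in> \<Omega>" if "z \<in> side 0 1 (\<lambda>_. p \<bullet> v 0 - r)" "z \<in> ball p r" for z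
    using that r side_subset(3) by blast
  ultimately have "chart \<Omega> p r 0 1 (\<lambda>_. p \<bullet> v 0 - r) (\<lambda>_ _. 0)"
    using r(1) unfolding chart_def by blast
  then show ?thesis by blast
next
  case False
  then have "p \<in> \<Gamma>" using p boundary_in_eq[OF openin_domain] by blast
  from bspec[OF smooth_boundary[unfolded smooth_boundary_def] this]
  obtain r k \<sigma> \<gamma> where r: "r > 0" "k \<le> m" "\<sigma> \<in> {1, -1}" "smooth_on v m M \<gamma>" "indep_coord M v k \<gamma>"
    "\<Omega> \<inter> ball p r = {z \<in> M \<inter> ball p r. \<sigma> * (z \<bullet> v k - \<gamma> z) > 0}"
    by blast
  have "C1_graph k (\<lambda>z. \<gamma> (proj z)) (\<lambda>s z. partial v s \<gamma> (proj z))"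
    using r by (intro C1_graph_extend) (auto simp: smooth_on_def simp del: Ck_on.simps)
  moreover have "\<Omega> \<inter> ball p r = side k \<sigma> (\<lambda>z. \<gamma> (proj z)) \<inter> ball p r"
    unfolding r(6) side_def using proj_id by auto
  ultimately have "chart \<Omega> p r k \<sigma> (\<lambda>z. \<gamma> (proj z)) (\<lambda>s z. partial v s \<gamma> (proj z))"
    using r(1,3) unfolding chart_def by blast
  then show ?thesis by blast
qed

lemma compact_hypersurface_boundary: "compact_hypersurface \<Gamma>"
  unfolding compact_hypersurface_def
proof (intro conjI ballI compact_boundary)
  fix p assume "p \<in> \<Gamma>"
  then obtain r k \<sigma> \<gamma> \<gamma>' where c: "chart \<Omega> p r k \<sigma> \<gamma> \<gamma>'" using chart_exists domain_subset by blast
  then show "\<exists>U k \<gamma> \<gamma>'. p \<in> U \<and> graph_piece \<Gamma> k \<gamma> \<gamma>' U"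
    using chart_graph_piece[OF openin_domain c] unfolding chart_def by (metis centre_in_ball)
qed

lemma sets_surf [simp, measurable_cong]: "sets surf = sets borel"
  by (rule surface_measure(1)[OF compact_hypersurface_boundary])

lemma continuous_on_normal: "continuous_on \<Gamma> normal"
  by (rule continuous_on_exterior_normal[OF openin_domain]) (use chart_exists domain_subset in blast)

lemma normal_in: "y \<in> \<Gamma> \<Longrightarrow> normal y \<in> M"
proof -
  assume y: "y \<in> \<Gamma>"
  then obtain r k \<sigma> \<gamma> \<gamma>' where c: "chart \<Omega> y r k \<sigma> \<gamma> \<gamma>'" using chart_exists domain_subset by blast
  then have "normal y = graph_normal k \<sigma> \<gamma>' y"
    using exterior_normal_eq[OF openin_domain c y] by (simp add: chart_def)
  then show ?thesis unfolding graph_normal_def by (simp only: frame_scale conormal_in)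
qed

lemma set_integrable_domain:
  fixes q :: "'a \<Rightarrow> 'b::euclidean_space"
  assumes q: "continuous_on (closure \<Omega>) q"
  shows "set_integrable vol \<Omega> q"
proof -
  obtain B where B: "\<And>z. z \<in> closure \<Omega> \<Longrightarrow> norm (q z) \<le> B"
    using compact_imp_bounded[OF compact_continuous_image[OF q compact_closure_domain]]
    unfolding bounded_iff by blast
  obtain R where R: "\<And>z. z \<in> \<Omega> \<Longrightarrow> norm z \<le> R" using bounded_domain unfolding bounded_iff by blast
  show ?thesis unfolding set_integrable_def
  proof (rule integrable_coord_bounded[of _ _ "max B 0" R])
    have "continuous_on \<Omega> q" using q closure_subset by (rule continuous_on_subset)
    then show "(\<lambda>x. indicat_real \<Omega> x *\<^sub>R q x) \<in> borel_measurable borel"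
      by (intro borel_measurable_continuous_on_indicator) auto
    show "norm (indicat_real \<Omega> z *\<^sub>R q z) \<le> max B 0" for z
      using B[of z] closure_subset[of \<Omega>] by (auto split: split_indicator)
    show "indicat_real \<Omega> z *\<^sub>R q z = 0" if "norm z > R" for z
      using R[of z] that by (auto split: split_indicator)
  qed simp
qed

lemma set_integrable_boundary:
  fixes q :: "'a \<Rightarrow> 'b::euclidean_space"
  assumes q: "continuous_on \<Gamma> q"
  shows "set_integrable surf \<Gamma> q"
proof -
  obtain B where B: "\<And>z. z \<in> \<Gamma> \<Longrightarrow> norm (q z) \<le> B"
    using compact_imp_bounded[OF compact_continuous_image[OF q compact_boundary]]
    unfolding bounded_iff by blast
  have "(\<lambda>x. indicat_real \<Gamma> x *\<^sub>R q x) \<in> borel_measurable borel"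
    by (intro borel_measurable_continuous_on_indicator q) auto
  then show ?thesis unfolding set_integrable_def
    by (intro integrableI_bounded_set[of \<Gamma> _ _ B] emeasure_surface_finite[OF compact_hypersurface_boundary])
      (use B in \<open>auto simp: measurable_def\<close>)
qed

text \<open>Carries the continuous extensions f' of the partial derivatives to the closure; they are
  tied to derivatives of f only inside \<Omega>.\<close>

definition C1_pair :: "('a \<Rightarrow> 'b::euclidean_space) \<Rightarrow> (nat \<Rightarrow> 'a \<Rightarrow> 'b) \<Rightarrow> bool" where
  "C1_pair f f' \<longleftrightarrow> continuous_on (closure \<Omega>) f \<and> (\<forall>s\<le>m. continuous_on (closure \<Omega>) (f' s) \<and>
     (\<forall>z\<in>\<Omega>. ((\<lambda>t. f (z + t *\<^sub>R v s)) has_vector_derivative f' s z) (at 0)))"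

lemma C1_pairD:
  assumes "C1_pair f f'"
  shows "continuous_on (closure \<Omega>) f" "s \<le> m \<Longrightarrow> continuous_on (closure \<Omega>) (f' s)"
    "s \<le> m \<Longrightarrow> z \<in> \<Omega> \<Longrightarrow> ((\<lambda>t. f (z + t *\<^sub>R v s)) has_vector_derivative f' s z) (at 0)"
  using assms by (auto simp: C1_pair_def)

lemma eventually_in_domain:
  assumes "z \<in> \<Omega>" "s \<le> m" "open U" "z \<in> U"
  shows "eventually (\<lambda>t. z + t *\<^sub>R v s \<in> \<Omega> \<inter> U) (at 0)"
proof -
  obtain T where T: "open T" "\<Omega> = M \<inter> T" using openin_domain unfolding openin_open by blast
  have "((\<lambda>t. z + t *\<^sub>R v s) \<longlongrightarrow> z + 0 *\<^sub>R v s) (at 0)" by (intro tendsto_intros)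
  then have "eventually (\<lambda>t. z + t *\<^sub>R v s \<in> T \<inter> U) (at 0)"
    using T assms by (intro topological_tendstoD) auto
  then show ?thesis
    by eventually_elim (use T assms domain_subset in auto)
qed

text \<open>Support within r/2 of p leaves a margin inside the chart ball, so h extends by zero to
  the closed side of the entire graph. The formulas for one side of a graph then apply, and their
  boundary weights are exactly the density times the s-th component of the normal.\<close>

lemma local_divergence:
  fixes h :: "'a \<Rightarrow> 'b::euclidean_space"
  assumes ch: "chart \<Omega> p r k \<sigma> \<gamma> \<gamma>'" and h: "C1_pair h h'" and s: "s \<le> m"
    and supp: "\<And>z. z \<in> closure \<Omega> \<Longrightarrow> dist p z \<ge> r / 2 \<Longrightarrow> h z = 0"
      "\<And>z s. z \<in> closure \<Omega> \<Longrightarrow> dist p z \<ge> r / 2 \<Longrightarrow> s \<le> m \<Longrightarrow> h' s z = 0"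
  shows "(LINT z:\<Omega>|vol. h' s z) = (LINT z:\<Gamma>|surf. (normal z \<bullet> v s) *\<^sub>R h z)"
proof -
  have r: "r > 0" and G: "C1_graph k \<gamma> \<gamma>'" and \<sigma>: "\<sigma> = 1 \<or> \<sigma> = -1" and side: "\<Omega> \<inter> ball p r = side k \<sigma> \<gamma> \<inter> ball p r"
    using ch by (auto simp: chart_def)
  note k = C1_graphD(1)[OF G] and \<gamma>c = C1_graphD(2)[OF G, of UNIV]
  let ?C = "closed_side k \<sigma> \<gamma>" and ?D = "side k \<sigma> \<gamma>"
  let ?X = "\<lambda>z. z + \<gamma> z *\<^sub>R v k" and ?F = "\<lambda>y. indicator \<Gamma> y *\<^sub>R ((normal y \<bullet> v s) *\<^sub>R h y)"
  have cl: "closure \<Omega> \<inter> ball p r = ?C \<inter> ball p r" by (rule chart_closure[OF openin_domain ch])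
  \<comment> \<open>Zero extension off the chart ball; the same operator serves h and its
    derivatives.\<close>
  define E where "E q z = (if z \<in> closure \<Omega> \<inter> ball p r then q z else 0)" for q :: "'a \<Rightarrow> 'b" and z
  define R where "R = norm p + r"
  have E0: "E q z = 0" if "z \<notin> ?C \<or> norm z > R" for q z
  proof -
    have "z \<notin> ?C \<inter> ball p r"
      using that norm_triangle_ineq2[of z p] by (auto simp: R_def dist_norm norm_minus_commute)
    then have "z \<notin> closure \<Omega> \<inter> ball p r" unfolding cl .
    then show ?thesis unfolding E_def by (rule if_not_P)
  qed
  \<comment> \<open>Continuity is glued from two closed sets: the part within r/2 of p, where
    \<open>E q\<close> is q, and the part at distance at least r/2, where it is 0.\<close>
  have Ec: "continuous_on ?C (E q)"
    if q: "continuous_on (closure \<Omega>) q" and q0: "\<And>z. z \<in> closure \<Omega> \<Longrightarrow> dist p z \<ge> r / 2 \<Longrightarrow> q z = 0" for q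
  proof -
    have C: "closed ?C" by (rule closed_closed_side[OF \<gamma>c])
    have sub: "cball p (r / 2) \<subseteq> ball p r" using r by auto
    have "continuous_on (?C \<inter> cball p (r / 2)) (E q)"
    proof (rule continuous_on_cong[THEN iffD1, OF refl _ continuous_on_subset[OF q]])
      show "?C \<inter> cball p (r / 2) \<subseteq> closure \<Omega>" using cl sub by blast
      show "q x = E q x" if "x \<in> ?C \<inter> cball p (r / 2)" for x
        unfolding E_def cl using that sub by auto
    qed
    moreover have "continuous_on (?C - ball p (r / 2)) (E q)"
      by (rule continuous_on_cong[THEN iffD1, OF refl _ continuous_on_const[of _ 0]])
        (use q0 in \<open>auto simp: E_def not_less\<close>)
    ultimately have "continuous_on ((?C \<inter> cball p (r / 2)) \<union> (?C - ball p (r / 2))) (E q)"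
      using C by (intro continuous_on_closed_Un) (auto simp: closed_Diff)
    also have "(?C \<inter> cball p (r / 2)) \<union> (?C - ball p (r / 2)) = ?C" by (auto simp: not_less)
    finally show ?thesis .
  qed
  have Ech: "continuous_on ?C (E h)" by (rule Ec[OF C1_pairD(1)[OF h] supp(1)])
  have Ech': "continuous_on ?C (E (h' j))" if "j \<le> m" for j
    by (rule Ec[OF C1_pairD(2)[OF h that] supp(2)]) (use that in auto)
  \<comment> \<open>Inside the chart ball \<open>E h\<close> is h near z along the line; a point
    outside the ball has a neighbourhood missing \<open>cball p (r / 2)\<close>, where
    \<open>E h\<close> is 0.\<close>
  have der: "((\<lambda>t. E h (z + t *\<^sub>R v j)) has_vector_derivative E (h' j) z) (at 0)" if z: "z \<in> ?D" and j: "j \<le> m" for z j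
  proof (cases "z \<in> ball p r")
    case True
    then have z\<Omega>: "z \<in> \<Omega>" using side z by blast
    have "eventually (\<lambda>t. h (z + t *\<^sub>R v j) = E h (z + t *\<^sub>R v j)) (at 0)"
      using eventually_in_domain[OF z\<Omega> j open_ball True]
      by eventually_elim (use closure_subset[of \<Omega>] in \<open>auto simp: E_def\<close>)
    moreover have "h (z + 0 *\<^sub>R v j) = E h (z + 0 *\<^sub>R v j)" "E (h' j) z = h' j z"
      using True z\<Omega> closure_subset[of \<Omega>] by (auto simp: E_def)
    ultimately show ?thesis using C1_pairD(3)[OF h j z\<Omega>] unfolding has_vector_derivative_def
      by (auto intro: has_derivative_transform_eventually)
  next
    case False
    have "((\<lambda>t. z + t *\<^sub>R v j) \<longlongrightarrow> z + 0 *\<^sub>R v j) (at 0)" by (intro tendsto_intros)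
    then have "eventually (\<lambda>t. z + t *\<^sub>R v j \<in> - cball p (r / 2)) (at 0)"
      using False r by (intro topological_tendstoD) (auto simp: not_less)
    then have "eventually (\<lambda>t. 0 = E h (z + t *\<^sub>R v j)) (at 0)"
      by eventually_elim (use supp(1) in \<open>auto simp: E_def not_le\<close>)
    moreover have "0 = E h (z + 0 *\<^sub>R v j)" "E (h' j) z = 0" using False by (auto simp: E_def)
    ultimately have "((\<lambda>t. E h (z + t *\<^sub>R v j)) has_derivative (\<lambda>x. 0)) (at 0)"
      by (intro has_derivative_transform_eventually[OF has_derivative_const]) auto
    then show ?thesis using \<open>E (h' j) z = 0\<close> by (simp add: has_vector_derivative_def)
  qed
  \<comment> \<open>Equal to the density times the s-th component of the normal at the graph point;
    it unifies the normal and tangential cases.\<close>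
  define w where "w z = - \<sigma> * (if s = k then 1 else - \<gamma>' s z)" for z
  have "(LINT z:\<Omega>|vol. h' s z) = (\<integral>z. indicator ?D z *\<^sub>R E (h' s) z \<partial>vol)"
    unfolding set_lebesgue_integral_def
  proof (rule Bochner_Integration.integral_cong[OF refl])
    fix z
    show "indicator \<Omega> z *\<^sub>R h' s z = indicator ?D z *\<^sub>R E (h' s) z"
    proof (cases "z \<in> ball p r")
      case True
      then have "z \<in> \<Omega> \<longleftrightarrow> z \<in> ?D" using side by blast
      then show ?thesis using True closure_subset[of \<Omega>] by (auto simp: E_def split: split_indicator)
    next
      case False
      then show ?thesis using supp(2)[of z s] s r closure_subset[of \<Omega>] 
        by (auto simp: E_def split: split_indicator)
    qed
  qed
  also have "\<dots> = (\<integral>z. w z *\<^sub>R E h (z + \<gamma> z *\<^sub>R v k) \<partial>coord_lebesgue v ({..m} - {k}))"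
  proof (cases "s = k")
    case True
    have "(\<integral>z. indicator ?D z *\<^sub>R (1 *\<^sub>R E (h' k) z) \<partial>vol) =
       - \<sigma> *\<^sub>R (\<integral>z. 1 *\<^sub>R E h (z + \<gamma> z *\<^sub>R v k) \<partial>coord_lebesgue v ({..m} - {k}))"
      by (rule integral_side_normal_weighted[OF G \<sigma> _ _ Ech _ Ech'[OF k], where R = R])
        (use E0 der k in auto)
    then show ?thesis using True by (simp add: w_def)
  next
    case False
    have "(\<integral>z. indicator ?D z *\<^sub>R E (h' s) z \<partial>vol) =
       \<sigma> *\<^sub>R (\<integral>z. \<gamma>' s z *\<^sub>R E h (z + \<gamma> z *\<^sub>R v k) \<partial>coord_lebesgue v ({..m} - {k}))"
      by (rule integral_side_tangential[OF G \<sigma> s False Ech _ Ech', where R = R])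
        (use E0 der in auto)
    also have "\<dots> = (\<integral>z. \<sigma> *\<^sub>R (\<gamma>' s z *\<^sub>R E h (z + \<gamma> z *\<^sub>R v k)) \<partial>coord_lebesgue v ({..m} - {k}))"
      by (rule integral_scaleR_right[symmetric])
    finally show ?thesis using False by (simp add: w_def)
  qed
  also have "\<dots> = (\<integral>z. graph_density k \<gamma>' z *\<^sub>R ?F (?X z) \<partial>coord_lebesgue v ({..m} - {k}))"
  proof (rule integral_cong_AE)
    note [measurable] = C1_graph_measurable[OF G]
    have "E h \<in> borel_measurable borel"
      by (rule supported_continuous(1)[OF closed_closed_side[OF \<gamma>c] Ech E0])
    moreover have "\<gamma>' s \<in> borel_measurable borel"
      using C1_graphD(4)[OF G s] by (rule borel_measurable_continuous_onI)
    then have "w \<in> borel_measurable borel" unfolding w_def by measurable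
    ultimately have [measurable]: "E h \<in> borel_measurable borel" "w \<in> borel_measurable borel" by auto
    show "(\<lambda>z. w z *\<^sub>R E h (?X z)) \<in> borel_measurable (coord_lebesgue v ({..m} - {k}))"
      by measurable
    have "(\<lambda>z. indicator \<Gamma> z *\<^sub>R ((normal z \<bullet> v s) *\<^sub>R h z)) \<in> borel_measurable borel"
      by (rule borel_measurable_continuous_on_indicator)
        (auto intro!: continuous_intros continuous_on_normal continuous_on_subset[OF C1_pairD(1)[OF h] domain_subset(3)])
    then have [measurable]: "?F \<in> borel_measurable borel" .
    show "(\<lambda>z. graph_density k \<gamma>' z *\<^sub>R ?F (?X z)) \<in> borel_measurable (coord_lebesgue v ({..m} - {k}))"
      by measurable
    show "AE z in coord_lebesgue v ({..m} - {k}). w z *\<^sub>R E h (?X z) = graph_density k \<gamma>' z *\<^sub>R ?F (?X z)"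
    proof (rule AE_mp[OF AE_coord_space[of "{..m} - {k}"]], simp, intro AE_I2 impI)
      fix z assume "z \<in> coord_space ({..m} - {k})"
      then have z: "z \<in> M" "z \<bullet> v k = 0" using coord_spaceD k by auto
      define y where "y = ?X z"
      have y: "y \<in> M" "y \<bullet> v k = \<gamma> y" using graph_point[OF G z] by (auto simp: y_def)
      have gd: "graph_density k \<gamma>' z = graph_density k \<gamma>' y"
        unfolding graph_density_def y_def using C1_graphD(5)[OF G] by simp
      have g': "\<gamma>' s z = \<gamma>' s y" unfolding y_def using C1_graphD(5)[OF G s] by simp
      have "w z *\<^sub>R E h y = graph_density k \<gamma>' z *\<^sub>R (indicator \<Gamma> y *\<^sub>R ((normal y \<bullet> v s) *\<^sub>R h y))"
      proof (cases "y \<in> ball p r")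
        case True
        have "y \<in> {z \<in> M \<inter> ball p r. z \<bullet> v k = \<gamma> z}" using True y by blast
        then have y\<Gamma>: "y \<in> \<Gamma>" unfolding chart_boundary[OF openin_domain ch, symmetric] by blast
        have "normal y \<bullet> v s = (- \<sigma> / graph_density k \<gamma>' y) * (if s = k then 1 else - \<gamma>' s y)"
          unfolding exterior_normal_eq[OF openin_domain ch y\<Gamma> True] graph_normal_def
          by (simp add: inner_conormal[OF s])
        then have "graph_density k \<gamma>' z * (normal y \<bullet> v s) = w z"
          using graph_density_ge_1[of k \<gamma>' y] by (simp add: w_def gd g')
        then show ?thesis using True y\<Gamma> domain_subset(3) by (auto simp: E_def)
      next
        case False
        then show ?thesis using supp(1)[of y] domain_subset(3) r 
          by (auto simp: E_def split: split_indicator)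
      qed
      then show "w z *\<^sub>R E h (?X z) = graph_density k \<gamma>' z *\<^sub>R ?F (?X z)" by (simp only: y_def)
    qed
  qed
  also have "\<dots> = (\<integral>z. indicator \<Gamma> z *\<^sub>R ((normal z \<bullet> v s) *\<^sub>R h z) \<partial>surf)"
  proof (rule integral_surface_measure_piece[OF compact_hypersurface_boundary chart_graph_piece[OF openin_domain ch], symmetric])
    show "(\<lambda>z. indicator \<Gamma> z *\<^sub>R ((normal z \<bullet> v s) *\<^sub>R h z)) \<in> borel_measurable borel"
      by (rule borel_measurable_continuous_on_indicator)
        (auto intro!: continuous_intros continuous_on_normal continuous_on_subset[OF C1_pairD(1)[OF h] domain_subset(3)])
    fix z assume "z \<notin> \<Gamma> \<inter> ball p r"
    then show "indicator \<Gamma> z *\<^sub>R ((normal z \<bullet> v s) *\<^sub>R h z) = 0"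
      using supp(1)[of z] domain_subset(3) r by (auto split: split_indicator)
  qed
  finally show ?thesis by (simp add: set_lebesgue_integral_def)
qed

text \<open>The functions u_p are bumps divided by their sum B, which is positive on the closure
  because the half-radius balls cover it. Since the u_p sum to 1 and their derivatives to 0, adding
  the local identities for u_p h returns the identity for h.\<close>

theorem divergence:
  fixes h :: "'a \<Rightarrow> 'b::euclidean_space"
  assumes h: "C1_pair h h'" and s: "s \<le> m"
  shows "(LINT z:\<Omega>|vol. h' s z) = (LINT z:\<Gamma>|surf. (normal z \<bullet> v s) *\<^sub>R h z)"
proof -
  have "\<forall>p\<in>closure \<Omega>. \<exists>r. \<exists>k \<sigma> \<gamma> \<gamma>'. chart \<Omega> p r k \<sigma> \<gamma> \<gamma>'" using chart_exists by blast
  from bchoice[OF this] obtain r where r: "\<And>p. p \<in> closure \<Omega> \<Longrightarrow> \<exists>k \<sigma> \<gamma> \<gamma>'. chart \<Omega> p (r p) k \<sigma> \<gamma> \<gamma>'"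
    by blast
  have rpos: "r p > 0" if "p \<in> closure \<Omega>" for p using r[OF that] by (auto simp: chart_def)
  have cov: "closure \<Omega> \<subseteq> (\<Union>p\<in>closure \<Omega>. ball p (r p / 2))" using rpos by force
  obtain D where D: "D \<subseteq> closure \<Omega>" "finite D" "closure \<Omega> \<subseteq> (\<Union>p\<in>D. ball p (r p / 2))"
    by (rule compactE_image[OF compact_closure_domain open_ball cov])
  define b where "b p = bump p (r p / 2)" for p
  define b' where "b' p j = bump_deriv p (r p / 2) (v j)" for p j
  define B where "B z = (\<Sum>p\<in>D. b p z)" for z
  define B' where "B' j z = (\<Sum>p\<in>D. b' p j z)" for j z
  have Bpos: "B z > 0" if z: "z \<in> closure \<Omega>" for z
  proof -
    obtain p where p: "p \<in> D" "z \<in> ball p (r p / 2)" using D(3) z by blast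
    then have "b p z > 0" by (simp add: b_def bump_pos)
    then show ?thesis unfolding B_def by (intro sum_pos2[OF D(2) p(1)]) (auto simp: b_def bump_nonneg)
  qed
  define u where "u p z = b p z / B z" for p z
  \<comment> \<open>Quotient rule, extended to the closure, where B is still positive.\<close>
  define u' where "u' p j z = (b' p j z * B z - b p z * B' j z) / (B z * B z)" for p j z
  have bc: "continuous_on S (b p)" "continuous_on S (b' p j)" for S p j
    by (auto simp: b_def b'_def bump_continuous)
  have Bc: "continuous_on S B" "continuous_on S (B' j)" for S j
    unfolding B_def B'_def by (intro continuous_intros bc)+
  have uc: "continuous_on (closure \<Omega>) (u p)" "continuous_on (closure \<Omega>) (u' p j)" for p j
  proof -
    have "\<forall>z\<in>closure \<Omega>. B z \<noteq> 0" using Bpos by force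
    then show "continuous_on (closure \<Omega>) (u p)" "continuous_on (closure \<Omega>) (u' p j)"
      unfolding u_def u'_def by (auto intro!: continuous_intros bc Bc)
  qed
  have db: "((\<lambda>t. b p (z + t *\<^sub>R v j)) has_real_derivative b' p j z) (at 0)" for p j z
    using bump_has_vector_derivative[of p "r p / 2" z "v j"]
    by (simp add: b_def b'_def has_real_derivative_iff_has_vector_derivative)
  have dB: "((\<lambda>t. B (z + t *\<^sub>R v j)) has_real_derivative B' j z) (at 0)" for j z
    unfolding B_def B'_def by (rule DERIV_sum) (rule db)
  have du: "((\<lambda>t. u p (z + t *\<^sub>R v j)) has_real_derivative u' p j z) (at 0)" if "z \<in> \<Omega>" for p j z
  proof -
    have "B z \<noteq> 0" using Bpos[of z] that closure_subset[of \<Omega>] by force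
    then show ?thesis unfolding u_def u'_def using DERIV_divide[OF db dB, of z j p] by simp
  qed
  define H where "H p z = u p z *\<^sub>R h z" for p z
  define H' where "H' p j z = u p z *\<^sub>R h' j z + u' p j z *\<^sub>R h z" for p j z
  have HC: "C1_pair (H p) (H' p)" for p
    unfolding C1_pair_def
  proof (intro conjI allI impI ballI)
    show "continuous_on (closure \<Omega>) (H p)"
      unfolding H_def by (intro continuous_intros uc C1_pairD(1)[OF h])
    fix j assume j: "j \<le> m"
    show "continuous_on (closure \<Omega>) (H' p j)"
      unfolding H'_def by (intro continuous_intros uc C1_pairD(1)[OF h] C1_pairD(2)[OF h j])
    fix z assume z: "z \<in> \<Omega>"
    from has_vector_derivative_scaleR[OF du[OF z] C1_pairD(3)[OF h j z], of p]
    show "((\<lambda>t. H p (z + t *\<^sub>R v j)) has_vector_derivative H' p j z) (at 0)"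
      by (simp add: H_def H'_def)
  qed
  have loc: "(LINT z:\<Omega>|vol. H' p s z) = (LINT z:\<Gamma>|surf. (normal z \<bullet> v s) *\<^sub>R H p z)" if p: "p \<in> D" for p
  proof -
    obtain k \<sigma> \<gamma> \<gamma>' where ch: "chart \<Omega> p (r p) k \<sigma> \<gamma> \<gamma>'" using r p D(1) by blast
    have "b p z = 0 \<and> b' p j z = 0" if "dist p z \<ge> r p / 2" for z j
      using that rpos[of p] p D(1) by (auto simp: b_def b'_def intro!: bump_zero)
    then show ?thesis
      by (intro local_divergence[OF ch HC s]) (auto simp: H_def H'_def u_def u'_def)
  qed
  have sumu: "(\<Sum>p\<in>D. u p z) = 1" "(\<Sum>p\<in>D. u' p j z) = 0" if "z \<in> closure \<Omega>" for z j
  proof -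
    have "B z \<noteq> 0" using Bpos[OF that] by simp
    then show "(\<Sum>p\<in>D. u p z) = 1" unfolding u_def sum_divide_distrib[symmetric] B_def[symmetric] by simp
    show "(\<Sum>p\<in>D. u' p j z) = 0"
      unfolding u'_def sum_divide_distrib[symmetric] sum_subtractf sum_distrib_right[symmetric]
        B_def[symmetric] B'_def[symmetric] by simp
  qed
  have sumH: "(\<Sum>p\<in>D. H p z) = h z" "(\<Sum>p\<in>D. H' p s z) = h' s z" if "z \<in> closure \<Omega>" for z
    unfolding H_def H'_def sum.distrib scaleR_sum_left[symmetric] sumu[OF that] by simp_all
  have "(LINT z:\<Omega>|vol. h' s z) = (LINT z:\<Omega>|vol. (\<Sum>p\<in>D. H' p s z))"
    using sumH(2) closure_subset[of \<Omega>] by (intro set_lebesgue_integral_cong) auto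
  also have "\<dots> = (\<Sum>p\<in>D. (LINT z:\<Omega>|vol. H' p s z))"
    unfolding set_lebesgue_integral_def scaleR_sum_right
    by (rule Bochner_Integration.integral_sum)
      (use set_integrable_domain[OF C1_pairD(2)[OF HC s]] in \<open>simp add: set_integrable_def\<close>)
  also have "\<dots> = (\<Sum>p\<in>D. (LINT z:\<Gamma>|surf. (normal z \<bullet> v s) *\<^sub>R H p z))"
    by (intro sum.cong refl loc)
  also have "\<dots> = (LINT z:\<Gamma>|surf. (\<Sum>p\<in>D. (normal z \<bullet> v s) *\<^sub>R H p z))"
    unfolding set_lebesgue_integral_def scaleR_sum_right
  proof (rule Bochner_Integration.integral_sum[symmetric])
    fix p
    have "continuous_on \<Gamma> (\<lambda>z. (normal z \<bullet> v s) *\<^sub>R H p z)"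
      by (intro continuous_intros continuous_on_normal continuous_on_subset[OF C1_pairD(1)[OF HC] domain_subset(3)])
    from set_integrable_boundary[OF this]
    show "integrable surf (\<lambda>x. indicat_real \<Gamma> x *\<^sub>R (normal x \<bullet> v s) *\<^sub>R H p x)" by (simp add: set_integrable_def)
  qed
  also have "\<dots> = (LINT z:\<Gamma>|surf. (normal z \<bullet> v s) *\<^sub>R h z)"
    using sumH(1) domain_subset(3) 
    by (intro set_lebesgue_integral_cong) (auto simp: scaleR_sum_right[symmetric])
  finally show ?thesis .
qed

end

section \<open>The smoothed Cauchy kernel\<close>

text \<open>The power u^(-n/2), continued below u = 1 by its tangent at 1. It is applied to u =
  |w|^2 / \<epsilon>^2 with n = m + 1, where the power is \<epsilon>^n / |w|^n.\<close>

definition profile :: "real \<Rightarrow> real \<Rightarrow> real" where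
  "profile n u = (if u \<le> 1 then 1 + n / 2 * (1 - u) else u powr (- n / 2))"

definition profile_deriv :: "real \<Rightarrow> real \<Rightarrow> real" where
  "profile_deriv n u = (if u \<le> 1 then - n / 2 else - n / 2 * u powr (- n / 2 - 1))"

lemma profile_has_derivative: "(profile n has_real_derivative profile_deriv n u) (at u)"
proof -
  have "((\<lambda>u. if u \<in> {..1} then 1 + n / 2 * (1 - u) else u powr (- n / 2)) has_vector_derivative
      (if u \<in> {..1} then - n / 2 else - n / 2 * u powr (- n / 2 - 1))) (at u within UNIV)"
  proof (rule has_vector_derivative_If_within_closures[where T = "{1..}"])
    show "((\<lambda>u. 1 + n / 2 * (1 - u)) has_vector_derivative - n / 2) (at u within A)" for A
      unfolding has_real_derivative_iff_has_vector_derivative[symmetric]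
      by (auto intro!: derivative_eq_intros)
    assume "u \<in> {1..} \<union> closure {..1} \<inter> closure {1..}"
    then show "((\<lambda>u. u powr (- n / 2)) has_vector_derivative - n / 2 * u powr (- n / 2 - 1)) 
      (at u within {1..} \<union> closure {..1} \<inter> closure {1..})"
      unfolding has_real_derivative_iff_has_vector_derivative[symmetric]
      by (intro has_field_derivative_at_within[OF has_real_derivative_powr]) auto
  qed auto
  then show ?thesis
    by (simp add: profile_def[abs_def] profile_deriv_def has_real_derivative_iff_has_vector_derivative)
qed

lemma continuous_on_profile: "continuous_on S (profile n)" "continuous_on S (profile_deriv n)"
proof -
  show "continuous_on S (profile n)"
    by (intro continuous_at_imp_continuous_on ballI DERIV_isCont[OF profile_has_derivative])
  have "continuous_on ({..1} \<union> {1..}) (profile_deriv n)"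
    unfolding profile_deriv_def by (intro continuous_on_cases) (auto intro!: continuous_intros)
  moreover have "{..1} \<union> {1..} = (UNIV :: real set)" by auto
  ultimately have "continuous_on UNIV (profile_deriv n)" by simp
  then show "continuous_on S (profile_deriv n)" by (rule continuous_on_subset) simp
qed

text \<open>A bound by the pure power is scale invariant, so the smoothed kernels will be dominated
  uniformly in \<epsilon>.\<close>

lemma profile_bounds:
  assumes "0 < u" "0 \<le> n"
  shows "0 \<le> profile n u" "profile n u \<le> (1 + n / 2) * u powr (- n / 2)"
proof -
  show "0 \<le> profile n u" using assms by (simp add: profile_def)
  show "profile n u \<le> (1 + n / 2) * u powr (- n / 2)"
  proof (cases "u \<le> 1")
    case True
    have "1 powr (- n / 2) \<le> u powr (- n / 2)" using assms True by (intro powr_mono2') auto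
    then have "(1 + n / 2) * 1 \<le> (1 + n / 2) * u powr (- n / 2)"
      using assms by (intro mult_left_mono) auto
    moreover have "1 + n / 2 * (1 - u) \<le> 1 + n / 2" using assms by (simp add: mult_left_le)
    ultimately show ?thesis using True by (simp add: profile_def)
  qed (use assms in \<open>simp add: profile_def algebra_simps\<close>)
qed

text \<open>The left side is the factor produced when the Cauchy-Riemann operator meets
  profile(|w|^2 / \<epsilon>^2) times star w. It annihilates the homogeneous power u^(-n/2), and on
  the tangent it leaves a multiple of 1 - u.\<close>

lemma profile_euler:
  assumes "0 \<le> u"
  shows "n * profile n u + 2 * u * profile_deriv n u = (if u \<le> 1 then n * (n + 2) / 2 * (1 - u) else 0)"
proof (cases "u \<le> 1")
  case True
  then show ?thesis by (simp add: profile_def profile_deriv_def field_simps power2_eq_square)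
next
  case False
  then have "u * u powr (- n / 2 - 1) = u powr (- n / 2)" by (subst powr_mult_base) auto
  then have "2 * u * profile_deriv n u = - n * u powr (- n / 2)" using False by (simp add: profile_deriv_def)
  then show ?thesis using False by (simp add: profile_def)
qed

lemma powr_square_quotient:
  assumes "a > 0" "e > 0"
  shows "(a\<^sup>2 / e\<^sup>2) powr (- real n / 2) = e ^ n / a ^ n"
proof -
  have "(a\<^sup>2 / e\<^sup>2) powr (- real n / 2) = ((a / e) powr 2) powr (- real n / 2)"
    using assms by (simp add: power_divide powr_numeral)
  also have "\<dots> = (a / e) powr (- real n)" by (simp add: powr_powr)
  also have "\<dots> = e ^ n / a ^ n"
    using assms by (simp add: powr_minus powr_realpow power_divide inverse_eq_divide)
  finally show ?thesis .
qed

text \<open>The area of the unit sphere is the dimension times the volume of the unit ball. In this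
  form the normalisation of the mollifier can be computed from ball volumes.\<close>

lemma sigma_eq: "sigma m = (real m + 1) * unit_ball_vol (real m + 1)"
proof -
  have 1: "Gamma ((real m + 1) / 2 + 1) = (real m + 1) / 2 * Gamma ((real m + 1) / 2)"
    by (rule Gamma_plus1) (auto simp: nonpos_Ints_def)
  have 2: "pi powr ((real m + 1) / 2) = sqrt pi ^ (m + 1)"
  proof -
    have "sqrt pi ^ (m + 1) = sqrt pi powr real (m + 1)" by (subst powr_realpow) auto
    also have "\<dots> = pi powr ((real m + 1) / 2)"
      by (simp add: powr_half_sqrt[symmetric] powr_powr add.commute)
    finally show ?thesis by simp
  qed
  have 3: "2 * p / g = n * (p / (n / 2 * g))" if "n > 0" "g > 0" for p g n :: real
    using that by (simp add: field_simps)
  have "Gamma ((real m + 1) / 2) > 0" by (rule Gamma_real_pos) simp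
  then show ?thesis
    unfolding sigma_def unit_ball_vol_def Gamma_one_half_real 1 2 by (intro 3) auto
qed

lemma sigma_pos: "sigma m > 0"
  by (simp add: sigma_eq)

section \<open>Volume and second moment of a ball\<close>

context orthonormal_frame
begin

lemma volume_cball: "r > 0 \<Longrightarrow> measure (coord_lebesgue v {..m}) (cball 0 r) = unit_ball_vol (real m + 1) * r ^ (m + 1)"
  by (simp add: measure_def emeasure_volume_cball)

lemma integrable_cball_poly:
  fixes q :: "'a \<Rightarrow> real"
  assumes "continuous_on UNIV q"
  shows "integrable (coord_lebesgue v {..m}) (\<lambda>z. indicator (cball 0 r) z * q z)"
proof -
  have c: "continuous_on (cball 0 r) q" using assms by (rule continuous_on_subset) simp
  have supp: "\<And>z. z \<notin> cball 0 r \<or> norm z > r \<Longrightarrow> indicator (cball 0 r) z * q z = 0" by (auto split: split_indicator)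
  have c': "continuous_on (cball 0 r) (\<lambda>z. indicator (cball 0 r) z * q z)"
    by (rule continuous_on_cong[THEN iffD1, OF refl _ c]) auto
  have "(\<lambda>z. indicator (cball 0 r) z * q z) \<in> borel_measurable borel"
    by (rule supported_continuous(1)[OF closed_cball c', where R = r]) (rule supp)
  moreover have "\<exists>B. \<forall>z. norm (indicator (cball 0 r) z * q z) \<le> B"
    by (rule supported_continuous(2)[OF closed_cball c', where R = r]) (rule supp)
  then obtain B where "\<forall>z. norm (indicator (cball 0 r) z * q z) \<le> B" by blast
  ultimately show ?thesis
    using supp by (intro integrable_coord_bounded[where C = B and R = r]) auto
qed

text \<open>The integrand is the derivative in x_s of (r^2 - |z|^2) x_s, which vanishes on the
  sphere. On the chord over z it is c - 3 t^2 with antiderivative c t - t^3, zero at both ends t^2 =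
  c.\<close>

lemma integral_ball_radial_moment:
  assumes s: "s \<le> m"
  shows "(\<integral>z. indicator (cball 0 r) z * (r\<^sup>2 - (norm z)\<^sup>2 - 2 * (z \<bullet> v s)\<^sup>2) \<partial>coord_lebesgue v {..m}) = 0"
    (is "(\<integral>z. ?F z \<partial>_) = 0")
proof -
  let ?I = "{..m} - {s}"
  have int: "integrable (coord_lebesgue v (insert s ?I)) ?F"
    unfolding atMost_insert[OF s] by (rule integrable_cball_poly) (auto intro!: continuous_intros)
  have [measurable]: "cball (0::'a) r \<in> sets borel" by simp
  have "(\<integral>z. ?F z \<partial>coord_lebesgue v {..m}) = (\<integral>z. ?F z \<partial>coord_lebesgue v (insert s ?I))"
    by (simp only: atMost_insert[OF s])
  also have "\<dots> = (\<integral>z. (\<integral>t. ?F (z + t *\<^sub>R v s) \<partial>lborel) \<partial>coord_lebesgue v ?I)"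
    by (rule integral_coord_insert[OF _ _ int]) auto
  also have "\<dots> = (\<integral>z. 0 \<partial>coord_lebesgue v ?I)"
  proof (rule integral_cong_AE)
    show "AE z in coord_lebesgue v ?I. (\<integral>t. ?F (z + t *\<^sub>R v s) \<partial>lborel) = 0"
    proof (rule AE_mp[OF AE_coord_space[of ?I]], simp, intro AE_I2 impI)
      fix z assume "z \<in> coord_space ?I"
      then have z: "z \<in> M" "z \<bullet> v s = 0" using coord_spaceD s by auto
      define c where "c = r\<^sup>2 - (norm z)\<^sup>2"
      have nz: "(norm (z + t *\<^sub>R v s))\<^sup>2 = (norm z)\<^sup>2 + t\<^sup>2" for t
        unfolding power2_norm_eq_inner
        using z s by (simp add: inner_add inner_commute frame_orthonormal power2_eq_square)
      have inner: "(z + t *\<^sub>R v s) \<bullet> v s = t" for t using z s by (simp add: inner_add_left frame_orthonormal)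
      show "(\<integral>t. ?F (z + t *\<^sub>R v s) \<partial>lborel) = 0"
      proof (cases "r \<ge> 0 \<and> c \<ge> 0")
        case False
        have "z + t *\<^sub>R v s \<notin> cball 0 r" for t
        proof
          assume "z + t *\<^sub>R v s \<in> cball 0 r"
          then have "norm (z + t *\<^sub>R v s) \<le> r" by simp
          moreover from this have "r \<ge> 0" using norm_ge_zero order_trans by blast
          ultimately have "(norm (z + t *\<^sub>R v s))\<^sup>2 \<le> r\<^sup>2" by (intro power_mono) auto
          moreover have "t\<^sup>2 \<ge> 0" by simp
          ultimately show False using False \<open>r \<ge> 0\<close> unfolding nz c_def by linarith
        qed
        then show ?thesis by simp
      next
        case True
        \<comment> \<open>Half the length of the chord of the ball over z.\<close>
        define a where "a = sqrt c"
        have a: "a \<ge> 0" "a\<^sup>2 = c" using True by (auto simp: a_def)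
        have iff: "z + t *\<^sub>R v s \<in> cball 0 r \<longleftrightarrow> t \<in> {-a..a}" for t
        proof -
          have "z + t *\<^sub>R v s \<in> cball 0 r \<longleftrightarrow> (norm (z + t *\<^sub>R v s))\<^sup>2 \<le> r\<^sup>2"
            using True by (simp add: abs_le_square_iff[symmetric])
          also have "\<dots> \<longleftrightarrow> t\<^sup>2 \<le> a\<^sup>2" unfolding nz a(2) c_def by auto
          also have "\<dots> \<longleftrightarrow> t \<in> {-a..a}" using a(1) by (auto simp: abs_le_square_iff[symmetric])
          finally show ?thesis .
        qed
        have "(\<integral>t. ?F (z + t *\<^sub>R v s) \<partial>lborel) = (\<integral>t. indicator {-a..a} t *\<^sub>R (c - 3 * t\<^sup>2) \<partial>lborel)"
        proof (intro Bochner_Integration.integral_cong refl)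
          fix t
          have "indicator (cball 0 r) (z + t *\<^sub>R v s) = (indicator {-a..a} t :: real)"
            by (simp only: indicator_def iff)
          then show "?F (z + t *\<^sub>R v s) = indicator {-a..a} t *\<^sub>R (c - 3 * t\<^sup>2)"
            by (simp only: nz inner) (simp add: c_def algebra_simps)
        qed
        also have "\<dots> = (c * a - a ^ 3) - (c * (- a) - (- a) ^ 3)"
        proof -
          have "(\<integral>t. (c - 3 * t\<^sup>2) * indicator {-a..a} t \<partial>lborel) = (c * a - a ^ 3) - (c * (- a) - (- a) ^ 3)"
            by (rule integral_FTC_Icc_real)
              (use a(1) in \<open>auto intro!: derivative_eq_intros continuous_intros\<close>)
          then show ?thesis by (simp add: mult.commute)
        qed
        also have "\<dots> = 0" using a(2) by (simp add: power3_eq_cube power2_eq_square flip: a(2))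
        finally show ?thesis .
      qed
    qed
  qed measurable
  finally show ?thesis by simp
qed

text \<open>Summing the m + 1 moment identities over s turns the squares of the coordinates into
  |z|^2; with V the integral of r^2 and I that of |z|^2 this reads (m + 1) (V - I) = 2 I. Polar
  coordinates are avoided.\<close>

lemma integral_ball_norm_square:
  assumes "r > 0"
  shows "(real m + 3) * (\<integral>z. indicator (cball 0 r) z * (norm z)\<^sup>2 \<partial>coord_lebesgue v {..m}) =
    (real m + 1) * r\<^sup>2 * measure (coord_lebesgue v {..m}) (cball 0 r)"
proof -
  let ?vol = "coord_lebesgue v {..m}" and ?i = "indicator (cball 0 r) :: 'a \<Rightarrow> real"
  let ?I = "\<integral>z. ?i z * (norm z)\<^sup>2 \<partial>?vol" and ?V = "\<integral>z. ?i z * r\<^sup>2 \<partial>?vol"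
  have i1: "integrable ?vol (\<lambda>z. ?i z * r\<^sup>2)" "integrable ?vol (\<lambda>z. ?i z * (norm z)\<^sup>2)"
    "integrable ?vol (\<lambda>z. ?i z * (z \<bullet> v s)\<^sup>2)" for s
    by (rule integrable_cball_poly; intro continuous_intros)+
  have e: "?V - ?I - 2 * (\<integral>z. ?i z * (z \<bullet> v s)\<^sup>2 \<partial>?vol) = 0" if "s \<le> m" for s
  proof -
    have "0 = (\<integral>z. ?i z * r\<^sup>2 - ?i z * (norm z)\<^sup>2 - 2 * (?i z * (z \<bullet> v s)\<^sup>2) \<partial>?vol)"
      using integral_ball_radial_moment[OF that, of r] by (simp add: right_diff_distrib mult_ac)
    also have "\<dots> = ?V - ?I - 2 * (\<integral>z. ?i z * (z \<bullet> v s)\<^sup>2 \<partial>?vol)"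
      using i1 by simp
    finally show ?thesis by simp
  qed
  have "?I = (\<integral>z. (\<Sum>s\<le>m. ?i z * (z \<bullet> v s)\<^sup>2) \<partial>?vol)"
  proof (rule integral_cong_AE)
    show "AE z in ?vol. ?i z * (norm z)\<^sup>2 = (\<Sum>s\<le>m. ?i z * (z \<bullet> v s)\<^sup>2)"
      by (rule AE_mp[OF AE_coord_space[of "{..m}"]], simp, intro AE_I2 impI)
        (auto simp: sum_distrib_left[symmetric] norm_sq_frame coord_spaceD)
  qed (use i1 in auto)
  also have "\<dots> = (\<Sum>s\<le>m. \<integral>z. ?i z * (z \<bullet> v s)\<^sup>2 \<partial>?vol)"
    by (rule Bochner_Integration.integral_sum) (rule i1(3))
  also have "\<dots> = (\<Sum>s\<le>m. (?V - ?I) / 2)" using e by (intro sum.cong refl) (auto simp: field_simps)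
  also have "\<dots> = (real m + 1) * (?V - ?I) / 2" by simp
  finally have "(real m + 3) * ?I = (real m + 1) * ?V" by (simp add: algebra_simps)
  also have "?V = r\<^sup>2 * measure ?vol (cball 0 r)" by simp
  finally show ?thesis by (simp add: mult_ac)
qed

end

locale hypercomplex_domain = hypercomplex_subspace mul e star M m v + smooth_domain M m v \<Omega>
  for mul :: "'a::euclidean_space \<Rightarrow> 'a \<Rightarrow> 'a" and e star M m v \<Omega>

text \<open>Independence of the m + 1 basis vectors keeps every index up to m below the dimension,
  where orthonormality of the completed basis applies.\<close>

lemma (in hypercomplex_subspace) orthonormal_frame: "orthonormal_frame M m v"
proof
  have b: "inj_on v {..m}" "independent (v ` {..m})" "span (v ` {..m}) = M"
    using basis_M by (auto simp: vector_basis_def)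
  have "card (v ` {..m}) \<le> DIM('a)" using independent_bound[OF b(2)] by blast
  then have "m < DIM('a)" using card_image[OF b(1)] by simp
  then show "v i \<bullet> v j = (if i = j then 1 else 0)" if "i \<le> m" "j \<le> m" for i j
    using that by (intro orthonormal) auto
  show "M = span (v ` {..m})" using b by simp
qed

sublocale hypercomplex_subspace \<subseteq> orthonormal_frame M m v
  by (rule orthonormal_frame)

section \<open>Norm identities of the algebra and the smoothed kernel\<close>

context hypercomplex_subspace
begin

lemma bounded_bilinear_mul: "bounded_bilinear mul"
  using bilinear_mul bilinear_conv_bounded_bilinear by blast

lemma bounded_linear_star: "bounded_linear star"
  using linear_star linear_conv_bounded_linear by blast

interpretation mul: bounded_bilinear mul by (rule bounded_bilinear_mul)
interpretation star: bounded_linear star by (rule bounded_linear_star)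

lemma star_e: "star e = e"
  using star_real[of 1] by simp

lemma star_basis: "1 \<le> s \<Longrightarrow> s \<le> m \<Longrightarrow> star (v s) = - v s"
  using v_unit_sphere[of s] by (simp add: unit_sphere_def eq_neg_iff_add_eq_0 add.commute)

text \<open>The polarised form of star x x = |x|^2 on basis vectors: \<open>star\<close> flips the
  sign of the imaginary units, so anticommutation cancels the mixed terms, and against
  \<open>v 0\<close> the two signs cancel.\<close>

lemma mul_star_basis:
  assumes "s \<le> m" "t \<le> m"
  shows "mul (star (v s)) (v t) + mul (star (v t)) (v s) = (if s = t then 2 *\<^sub>R e else 0)"
proof -
  have ss: "mul (star (v s)) (v s) = e" if "s \<le> m" for s
  proof (cases "s = 0")
    case False
    then have "mul (v s) (star (v s)) = e" using v_unit_sphere[of s] that by (simp add: unit_sphere_def)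
    then show ?thesis using False that by (simp add: star_basis mul.minus_left mul.minus_right)
  qed (simp add: v_0 star_e unit_left)
  show ?thesis
  proof (cases "s = t")
    case True
    then show ?thesis using ss[OF assms(1)] by (simp add: scaleR_2)
  next
    case False
    show ?thesis
    proof (cases "s = 0 \<or> t = 0")
      case True
      then show ?thesis using False assms
        by (auto simp: v_0 star_e star_basis unit_left unit_right mul.minus_left)
    next
      case nz: False
      then show ?thesis using False assms v_anticommute[of s t]
        by (simp add: star_basis mul.minus_left)
    qed
  qed
qed

lemma mul_star_self:
  assumes "x \<in> M"
  shows "mul (star x) x = (norm x)\<^sup>2 *\<^sub>R e"
proof -
  let ?c = "\<lambda>s. x \<bullet> v s"
  have x: "x = (\<Sum>s\<le>m. ?c s *\<^sub>R v s)" by (rule frame_expand[OF assms, symmetric])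
  have sx: "star x = (\<Sum>s\<le>m. ?c s *\<^sub>R star (v s))"
    by (subst x) (simp add: star.sum star.scaleR)
  let ?P = "\<lambda>s t. (?c s * ?c t) *\<^sub>R mul (star (v s)) (v t)"
  have 1: "mul (star x) x = (\<Sum>s\<le>m. \<Sum>t\<le>m. ?P s t)"
    by (subst (2) x, subst sx) (simp only: mul.sum_left, simp only: mul.sum_right mul.scaleR_left mul.scaleR_right scaleR_scaleR, simp add: mult.commute)
  \<comment> \<open>Doubling symmetrises the double sum in s and t, so that each pair of terms is
    given by \<open>mul_star_basis\<close>.\<close>
  have "mul (star x) x + mul (star x) x = (\<Sum>s\<le>m. \<Sum>t\<le>m. ?P s t) + (\<Sum>s\<le>m. \<Sum>t\<le>m. ?P t s)"
    unfolding 1 by (subst (2) sum.swap) simp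
  also have "\<dots> = (\<Sum>s\<le>m. \<Sum>t\<le>m. (?c s * ?c t) *\<^sub>R (mul (star (v s)) (v t) + mul (star (v t)) (v s)))"
    by (simp add: sum.distrib[symmetric] scaleR_add_right mult.commute)
  also have "\<dots> = (\<Sum>s\<le>m. \<Sum>t\<le>m. if s = t then (2 * (?c s)\<^sup>2) *\<^sub>R e else 0)"
    by (intro sum.cong refl) (auto simp: mul_star_basis power2_eq_square)
  also have "\<dots> = (\<Sum>s\<le>m. (2 * (?c s)\<^sup>2) *\<^sub>R e)" by simp
  also have "\<dots> = (2 * (norm x)\<^sup>2) *\<^sub>R e"
    by (simp add: norm_sq_frame[OF assms] scaleR_sum_left sum_distrib_left)
  finally have "2 *\<^sub>R mul (star x) x = 2 *\<^sub>R ((norm x)\<^sup>2 *\<^sub>R e)" by (simp add: scaleR_2[symmetric])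
  then show ?thesis by (simp only: scaleR_cancel_left) simp
qed

lemma star_frame:
  assumes "x \<in> M"
  shows "star x = (2 * (x \<bullet> v 0)) *\<^sub>R e - x"
proof -
  have "star x + x = (\<Sum>s\<le>m. (x \<bullet> v s) *\<^sub>R (star (v s) + v s))"
    by (subst (1 2) frame_expand[OF assms, symmetric]) (simp add: star.sum star.scaleR scaleR_add_right sum.distrib)
  also have "\<dots> = (\<Sum>s\<le>m. if s = 0 then (2 * (x \<bullet> v 0)) *\<^sub>R e else 0)"
    using star_basis by (intro sum.cong refl) (auto simp: v_0 star_e scaleR_2[symmetric] mult.commute)
  also have "\<dots> = (2 * (x \<bullet> v 0)) *\<^sub>R e" by simp
  finally show ?thesis by (simp add: algebra_simps)
qed

text \<open>Left alternativity suffices because \<open>x\<close> and \<open>star x\<close> differ by sign and a real summand.\<close>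

lemma mul_star_mul:
  assumes "x \<in> M"
  shows "mul (star x) (mul x a) = (norm x)\<^sup>2 *\<^sub>R a"
proof -
  have alt: "mul x (mul x a) = mul (mul x x) a"
    using associator_alternating[of x x a] by (simp add: associator_def)
  have "mul (star x) (mul x a) = mul (mul (star x) x) a"
    unfolding star_frame[OF assms] by (simp add: mul.diff_left mul.scaleR_left unit_left alt)
  then show ?thesis by (simp add: mul_star_self[OF assms] mul.scaleR_left unit_left)
qed

text \<open>The Cauchy kernel with its singularity replaced by a \<open>C\<^sup>1\<close> profile in the ball of radius
  \<open>\<epsilon>\<close>. The profile is chosen so that applying the Cauchy-Riemann operator yields a probability
  density \<open>mollifier \<epsilon>\<close>.\<close>

definition kernel :: "real \<Rightarrow> 'a \<Rightarrow> 'a" where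
  "kernel \<epsilon> w = (profile (real m + 1) ((norm w)\<^sup>2 / \<epsilon>\<^sup>2) / (sigma m * \<epsilon> ^ (m + 1))) *\<^sub>R star w"

definition kernel_deriv :: "real \<Rightarrow> nat \<Rightarrow> 'a \<Rightarrow> 'a" where
  "kernel_deriv \<epsilon> s w =
     (profile (real m + 1) ((norm w)\<^sup>2 / \<epsilon>\<^sup>2) / (sigma m * \<epsilon> ^ (m + 1))) *\<^sub>R star (v s) +
     (profile_deriv (real m + 1) ((norm w)\<^sup>2 / \<epsilon>\<^sup>2) * (2 * (w \<bullet> v s) / \<epsilon>\<^sup>2) / (sigma m * \<epsilon> ^ (m + 1))) *\<^sub>R star w"

text \<open>The constant is n (n + 2) / 2 from \<open>profile_euler\<close> with n = m + 1, divided
  by the scale factor of \<open>kernel\<close>.\<close>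

definition mollifier :: "real \<Rightarrow> 'a \<Rightarrow> real" where
  "mollifier \<epsilon> w = indicator (cball 0 \<epsilon>) w *
     ((real m + 1) * (real m + 3) / 2 * (1 - (norm w)\<^sup>2 / \<epsilon>\<^sup>2) / (sigma m * \<epsilon> ^ (m + 1)))"

lemma kernel_has_vector_derivative:
  assumes s: "s \<le> m"
  shows "((\<lambda>t. kernel \<epsilon> (w + t *\<^sub>R v s)) has_vector_derivative kernel_deriv \<epsilon> s w) (at 0)"
proof -
  have eq: "(norm (w + t *\<^sub>R v s))\<^sup>2 / \<epsilon>\<^sup>2 = ((norm w)\<^sup>2 + 2 * t * (w \<bullet> v s) + t\<^sup>2) / \<epsilon>\<^sup>2" for t
    unfolding power2_norm_eq_inner using s
    by (simp add: inner_add inner_commute frame_orthonormal algebra_simps power2_eq_square)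
  have "((\<lambda>t. (norm (w + t *\<^sub>R v s))\<^sup>2 / \<epsilon>\<^sup>2) has_real_derivative 2 * (w \<bullet> v s) / \<epsilon>\<^sup>2) (at 0)"
    unfolding eq unfolding divide_inverse by (auto intro!: derivative_eq_intros)
  from DERIV_cdivide[OF DERIV_chain2[OF profile_has_derivative this], of "real m + 1" "sigma m * \<epsilon> ^ (m + 1)"]
  have 1: "((\<lambda>t. profile (real m + 1) ((norm (w + t *\<^sub>R v s))\<^sup>2 / \<epsilon>\<^sup>2) / (sigma m * \<epsilon> ^ (m + 1))) has_real_derivative
     profile_deriv (real m + 1) ((norm w)\<^sup>2 / \<epsilon>\<^sup>2) * (2 * (w \<bullet> v s) / \<epsilon>\<^sup>2) / (sigma m * \<epsilon> ^ (m + 1))) (at 0)"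
    by simp
  have "((\<lambda>t. w + t *\<^sub>R v s) has_vector_derivative v s) (at 0)"
    by (auto intro!: derivative_eq_intros simp: has_vector_derivative_def)
  then have 2: "((\<lambda>t. star (w + t *\<^sub>R v s)) has_vector_derivative star (v s)) (at 0)"
    by (rule star.has_vector_derivative)
  from has_vector_derivative_scaleR[OF 1 2] show ?thesis
    by (simp add: kernel_def kernel_deriv_def)
qed

lemma continuous_on_kernel:
  "continuous_on S g \<Longrightarrow> continuous_on S (\<lambda>y. kernel \<epsilon> (g y))"
  "continuous_on S g \<Longrightarrow> continuous_on S (\<lambda>y. kernel_deriv \<epsilon> s (g y))"
  unfolding kernel_def kernel_deriv_def divide_inverse
  by (intro continuous_intros star.continuous_on 
      continuous_on_compose2[OF continuous_on_profile(1)[of UNIV]] continuous_on_compose2[OF continuous_on_profile(2)[of UNIV]]; simp)+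

text \<open>Differentiating star w yields the sum of star(v_s) (v_s a), that is (m + 1) a.
  Differentiating the profile yields w_s times star w (v_s a), which sums to star w (w a) = |w|^2 a.
  Both values come from \<open>mul_star_mul\<close>; together they form the expression in
  \<open>profile_euler\<close>.\<close>

lemma sum_kernel_deriv:
  assumes w: "w \<in> M" and \<epsilon>: "\<epsilon> > 0"
  shows "(\<Sum>s\<le>m. mul (kernel_deriv \<epsilon> s w) (mul (v s) a)) = mollifier \<epsilon> w *\<^sub>R a"
proof -
  let ?u = "(norm w)\<^sup>2 / \<epsilon>\<^sup>2" and ?c = "sigma m * \<epsilon> ^ (m + 1)" and ?n = "real m + 1"
  have A: "(\<Sum>s\<le>m. mul (star (v s)) (mul (v s) a)) = ?n *\<^sub>R a"
  proof -
    have "(\<Sum>s\<le>m. mul (star (v s)) (mul (v s) a)) = (\<Sum>s\<le>m. a)"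
      by (intro sum.cong refl) (simp add: mul_star_mul)
    then show ?thesis by (simp add: sum_constant_scaleR add.commute)
  qed
  have B: "(\<Sum>s\<le>m. (w \<bullet> v s) *\<^sub>R mul (star w) (mul (v s) a)) = (norm w)\<^sup>2 *\<^sub>R a"
  proof -
    have "(\<Sum>s\<le>m. (w \<bullet> v s) *\<^sub>R mul (star w) (mul (v s) a)) = mul (star w) (mul (\<Sum>s\<le>m. (w \<bullet> v s) *\<^sub>R v s) a)"
      by (simp add: mul.sum_left mul.sum_right mul.scaleR_left mul.scaleR_right)
    then show ?thesis by (simp add: frame_expand[OF w] mul_star_mul[OF w])
  qed
  have "(\<Sum>s\<le>m. mul (kernel_deriv \<epsilon> s w) (mul (v s) a)) =
     (profile ?n ?u / ?c) *\<^sub>R (\<Sum>s\<le>m. mul (star (v s)) (mul (v s) a)) +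
     (profile_deriv ?n ?u * (2 / \<epsilon>\<^sup>2) / ?c) *\<^sub>R (\<Sum>s\<le>m. (w \<bullet> v s) *\<^sub>R mul (star w) (mul (v s) a))"
    unfolding kernel_deriv_def scaleR_sum_right sum.distrib[symmetric]
    by (intro sum.cong refl) (simp add: mul.add_left mul.scaleR_left)
  also have "\<dots> = ((?n * profile ?n ?u + 2 * ?u * profile_deriv ?n ?u) / ?c) *\<^sub>R a"
    unfolding A B by (simp add: scaleR_add_left[symmetric] add_divide_distrib mult_ac)
  also have "?n * profile ?n ?u + 2 * ?u * profile_deriv ?n ?u = (if ?u \<le> 1 then ?n * (?n + 2) / 2 * (1 - ?u) else 0)"
    by (rule profile_euler) simp
  also have "?u \<le> 1 \<longleftrightarrow> w \<in> cball 0 \<epsilon>" using \<epsilon> by (simp add: abs_le_square_iff[symmetric] divide_le_eq_1)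
  finally show ?thesis by (auto simp: mollifier_def add.commute)
qed

lemma mollifier_nonneg: "\<epsilon> > 0 \<Longrightarrow> 0 \<le> mollifier \<epsilon> w"
  using sigma_pos[of m] by (auto simp: mollifier_def abs_le_square_iff[symmetric] divide_le_eq_1 split: split_indicator)

lemma integrable_mollifier: "integrable (coord_lebesgue v {..m}) (mollifier \<epsilon>)"
  unfolding mollifier_def divide_inverse by (rule integrable_cball_poly) (intro continuous_intros)

text \<open>This is where the value of sigma_m matters: the second moment turns the mass into (m +
  1) vol(B_\<epsilon>) / (sigma_m \<epsilon>^(m+1)), which is 1 by \<open>sigma_eq\<close>.\<close>

lemma integral_mollifier:
  assumes \<epsilon>: "\<epsilon> > 0"
  shows "(\<integral>w. mollifier \<epsilon> w \<partial>coord_lebesgue v {..m}) = 1"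
proof -
  let ?vol = "coord_lebesgue v {..m}" and ?i = "indicator (cball 0 \<epsilon>) :: 'a \<Rightarrow> real"
  let ?V = "measure ?vol (cball 0 \<epsilon>)" and ?I = "\<integral>z. ?i z * (norm z)\<^sup>2 \<partial>?vol"
  let ?k = "(real m + 1) * (real m + 3) / 2 / (sigma m * \<epsilon> ^ (m + 1))"
  have int: "integrable ?vol (\<lambda>z. ?i z * 1)" "integrable ?vol (\<lambda>z. ?i z * (norm z)\<^sup>2)"
    by (rule integrable_cball_poly; intro continuous_intros)+
  have "mollifier \<epsilon> w = ?k * (?i w * 1 - ?i w * (norm w)\<^sup>2 / \<epsilon>\<^sup>2)" for w
    by (cases "w \<in> cball 0 \<epsilon>") (simp_all add: mollifier_def)
  then have "(\<integral>w. mollifier \<epsilon> w \<partial>?vol) = (\<integral>w. ?k * (?i w * 1 - ?i w * (norm w)\<^sup>2 / \<epsilon>\<^sup>2) \<partial>?vol)"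
    by (simp only:)
  also have "\<dots> = ?k * (\<integral>w. ?i w * 1 - ?i w * (norm w)\<^sup>2 / \<epsilon>\<^sup>2 \<partial>?vol)"
    by (rule integral_mult_right_zero)
  also have "\<dots> = ?k * (?V - ?I / \<epsilon>\<^sup>2)"
    using int by (subst Bochner_Integration.integral_diff) auto
  also have "?I = (real m + 1) * \<epsilon>\<^sup>2 * ?V / (real m + 3)"
    using integral_ball_norm_square[OF \<epsilon>] by (simp add: field_simps)
  also have "?V - (real m + 1) * \<epsilon>\<^sup>2 * ?V / (real m + 3) / \<epsilon>\<^sup>2 = ?V * 2 / (real m + 3)"
  proof -
    have "V - a * d * V / b / d = V * 2 / b" if "b = a + 2" "b > 0" "d > 0" for V a b d :: real
    proof -
      have "a * d * V / b / d = a * V / b" using that by simp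
      then show ?thesis using that by (simp add: field_simps)
    qed
    from this[of "real m + 3" "real m + 1" "\<epsilon>\<^sup>2" ?V] show ?thesis using \<epsilon> by simp
  qed
  also have "?k * (?V * 2 / (real m + 3)) = (real m + 1) * ?V / (sigma m * \<epsilon> ^ (m + 1))"
  proof -
    have "a * b / 2 / c * (V * 2 / b) = a * V / c" if "b > 0" for V a b c :: real
      using that by (simp add: field_simps)
    from this[of "real m + 3" "real m + 1" "sigma m * \<epsilon> ^ (m + 1)" ?V] show ?thesis by simp
  qed
  also have "\<dots> = 1"
    unfolding volume_cball[OF \<epsilon>] using \<epsilon> unit_ball_vol_pos[of "real m + 1"]
    by (simp add: sigma_eq less_imp_neq[THEN not_sym])
  finally show ?thesis .
qed

text \<open>At w = 0 both sides are 0 because star 0 = 0. Including this point makes the smoothed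
  kernels converge everywhere, not merely almost everywhere.\<close>

lemma kernel_eq_cauchy_kernel:
  assumes \<epsilon>: "\<epsilon> > 0" and w: "norm w \<ge> \<epsilon> \<or> w = 0"
  shows "kernel \<epsilon> w = cauchy_kernel star m w"
proof (cases "w = 0")
  case True
  then show ?thesis by (simp add: kernel_def cauchy_kernel_def star.zero)
next
  case False
  then have nw: "norm w \<ge> \<epsilon>" using w by blast
  have "profile (real m + 1) ((norm w)\<^sup>2 / \<epsilon>\<^sup>2) = ((norm w)\<^sup>2 / \<epsilon>\<^sup>2) powr (- real (m + 1) / 2)"
  \<comment> \<open>On the sphere itself the linear branch of \<open>profile\<close> applies, with
    the common value 1.\<close>
  proof (cases "norm w = \<epsilon>")
    case True
    then show ?thesis using \<epsilon> by (simp add: profile_def)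
  next
    case False
    then have "\<epsilon>\<^sup>2 < (norm w)\<^sup>2" using nw \<epsilon> by (intro power_strict_mono) auto
    then have "1 < (norm w)\<^sup>2 / \<epsilon>\<^sup>2" using \<epsilon> by (simp add: less_divide_eq_1)
    then have "profile (real m + 1) ((norm w)\<^sup>2 / \<epsilon>\<^sup>2) = ((norm w)\<^sup>2 / \<epsilon>\<^sup>2) powr (- (real m + 1) / 2)"
      unfolding profile_def by (intro if_not_P) simp
    also have "- (real m + 1) = - real (m + 1)" by simp
    finally show ?thesis .
  qed
  also have "\<dots> = \<epsilon> ^ (m + 1) / norm w ^ (m + 1)"
    by (rule powr_square_quotient) (use \<epsilon> False in auto)
  finally show ?thesis using \<epsilon> by (simp add: kernel_def cauchy_kernel_def)
qed

text \<open>One constant serves every \<epsilon>, as dominated convergence requires. The bound for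
  the Cauchy kernel at w \<noteq> 0 is the case \<epsilon> = |w|, where the two kernels
  coincide.\<close>

lemma kernel_bound:
  obtains C where "C \<ge> 0" "\<And>\<epsilon> w. \<epsilon> > 0 \<Longrightarrow> norm (kernel \<epsilon> w) \<le> C * (1 / norm w ^ m)"
    "\<And>w. norm (cauchy_kernel star m w) \<le> C * (1 / norm w ^ m)"
proof -
  obtain K where K: "K \<ge> 0" "\<And>w. norm (star w) \<le> norm w * K" using star.nonneg_bounded by blast
  define C where "C = (1 + (real m + 1) / 2) * K / sigma m"
  have sg: "sigma m > 0" by (rule sigma_pos)
  have k1: "norm (kernel \<epsilon> w) \<le> C * (1 / norm w ^ m)" if \<epsilon>: "\<epsilon> > 0" for \<epsilon> w
  proof (cases "w = 0")
    case True
    then show ?thesis using K(1) sg by (simp add: kernel_def star.zero C_def)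
  next
    case False
    let ?p = "profile (real m + 1) ((norm w)\<^sup>2 / \<epsilon>\<^sup>2)"
    have "?p \<ge> 0" "?p \<le> (1 + (real m + 1) / 2) * ((norm w)\<^sup>2 / \<epsilon>\<^sup>2) powr (- (real m + 1) / 2)"
      using profile_bounds[of "(norm w)\<^sup>2 / \<epsilon>\<^sup>2" "real m + 1"] False \<epsilon> by simp_all
    moreover have "((norm w)\<^sup>2 / \<epsilon>\<^sup>2) powr (- (real m + 1) / 2) = \<epsilon> ^ (m + 1) / norm w ^ (m + 1)"
      using powr_square_quotient[of "norm w" \<epsilon> "m + 1"] False \<epsilon> by (simp add: add.commute)
    ultimately have p: "?p \<ge> 0" "?p \<le> (1 + (real m + 1) / 2) * (\<epsilon> ^ (m + 1) / norm w ^ (m + 1))" by auto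
    have "norm (kernel \<epsilon> w) = ?p / (sigma m * \<epsilon> ^ (m + 1)) * norm (star w)"
      using p(1) sg \<epsilon> by (simp add: kernel_def)
    also have "\<dots> \<le> ((1 + (real m + 1) / 2) * (\<epsilon> ^ (m + 1) / norm w ^ (m + 1))) / (sigma m * \<epsilon> ^ (m + 1)) * (norm w * K)"
      using p sg \<epsilon> K by (intro mult_mono divide_right_mono) auto
    also have "\<dots> = C * (1 / norm w ^ m)" using False \<epsilon> sg by (simp add: C_def field_simps)
    finally show ?thesis .
  qed
  show thesis
  proof (rule that[OF _ k1])
    show "C \<ge> 0" using K sg by (simp add: C_def)
    show "norm (cauchy_kernel star m w) \<le> C * (1 / norm w ^ m)" for w
    proof (cases "w = 0")
      case True
      then show ?thesis using kernel_eq_cauchy_kernel[of 1 w] k1[of 1 w] by simp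
    next
      case False
      then show ?thesis using kernel_eq_cauchy_kernel[of "norm w" w] k1[of "norm w" w] by simp
    qed
  qed
qed

end

section \<open>The Cauchy formula\<close>

lemma (in orthonormal_frame) volume_translation:
  fixes g :: "'a \<Rightarrow> 'b::euclidean_space"
  assumes g: "integrable (coord_lebesgue v {..m}) g" and x: "x \<in> M"
  shows "integrable (coord_lebesgue v {..m}) (\<lambda>y. g (y - x))"
    "(\<integral>y. g (y - x) \<partial>coord_lebesgue v {..m}) = (\<integral>y. g y \<partial>coord_lebesgue v {..m})"
proof -
  let ?vol = "coord_lebesgue v {..m}"
  have [measurable]: "g \<in> borel_measurable borel" using borel_measurable_integrable[OF g] by simp
  have "- x \<in> M" using x frame_scale[of x "-1"] by simp
  from distr_volume_translation[OF this] have d: "distr ?vol borel (\<lambda>z. z - x) = ?vol" by simp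
  have "integrable (distr ?vol borel (\<lambda>z. z - x)) g" using g by (simp only: d)
  then show "integrable ?vol (\<lambda>y. g (y - x))" by (subst (asm) integrable_distr_eq) auto
  have "(\<integral>y. g y \<partial>distr ?vol borel (\<lambda>z. z - x)) = (\<integral>y. g (y - x) \<partial>?vol)" by (rule integral_distr) auto
  then show "(\<integral>y. g (y - x) \<partial>?vol) = (\<integral>y. g y \<partial>?vol)" by (simp only: d)
qed

lemma (in orthonormal_frame) integrable_inverse_norm_power:
  "integrable (coord_lebesgue v {..m}) (\<lambda>z. indicator (cball 0 R) z * (1 / norm z ^ m))"
proof (rule integrableI_bounded)
  have [measurable]: "cball (0::'a) R \<in> sets borel" by simp
  show "(\<lambda>z. indicator (cball 0 R) z * (1 / norm z ^ m)) \<in> borel_measurable (coord_lebesgue v {..m})"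
    by measurable
  have "(\<integral>\<^sup>+z. ennreal (norm (indicator (cball 0 R) z * (1 / norm z ^ m))) \<partial>coord_lebesgue v {..m}) =
     (\<integral>\<^sup>+z. indicator (cball 0 R) z * ennreal (1 / norm z ^ m) \<partial>coord_lebesgue v {..m})"
    by (intro nn_integral_cong) (auto split: split_indicator)
  then show "(\<integral>\<^sup>+z. ennreal (norm (indicator (cball 0 R) z * (1 / norm z ^ m))) \<partial>coord_lebesgue v {..m}) < \<infinity>"
    using nn_integral_inverse_norm_power_finite[of R] by simp
qed

lemma (in smooth_domain) C1_closure_pair:
  fixes f :: "'a \<Rightarrow> 'b::euclidean_space"
  assumes "C1_closure v m \<Omega> f"
  obtains f' where "C1_pair f f'" "\<forall>s\<le>m. \<forall>y\<in>\<Omega>. f' s y = partial v s f y"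
proof -
  have c: "continuous_on (closure \<Omega>) f"
    and d: "\<And>s y. s \<le> m \<Longrightarrow> y \<in> \<Omega> \<Longrightarrow> (\<lambda>t. f (y + t *\<^sub>R v s)) differentiable (at 0)"
    and g: "\<forall>s\<in>{..m}. \<exists>g. continuous_on (closure \<Omega>) g \<and> (\<forall>y\<in>\<Omega>. g y = partial v s f y)"
    using assms by (auto simp: C1_closure_def)
  from bchoice[OF g] obtain f' where f': "\<And>s. s \<le> m \<Longrightarrow> continuous_on (closure \<Omega>) (f' s)"
    "\<And>s y. s \<le> m \<Longrightarrow> y \<in> \<Omega> \<Longrightarrow> f' s y = partial v s f y" by auto
  have "((\<lambda>t. f (y + t *\<^sub>R v s)) has_vector_derivative f' s y) (at 0)" if "s \<le> m" "y \<in> \<Omega>" for s y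
    unfolding f'(2)[OF that] partial_def by (rule iffD1[OF vector_derivative_works d[OF that]])
  then show thesis using c f' by (intro that[of f']) (auto simp: C1_pair_def)
qed

section \<open>Green's identity for the smoothed kernel and the limit\<close>

context hypercomplex_domain
begin

interpretation mul: bounded_bilinear mul by (rule bounded_bilinear_mul)

text \<open>The divergence theorem is applied to each \<open>H s\<close> in its own direction s and
  the results are added. The product rule keeps the bracketing kernel (v_s f), so the derivatives of
  the kernel collect into the mollifier and those of f into the Cauchy-Riemann operator.\<close>

lemma kernel_green:
  assumes f: "C1_pair f f'" and x: "x \<in> M" and \<epsilon>: "\<epsilon> > 0"
  shows "(LINT y:\<Gamma>|surf. mul (kernel \<epsilon> (y - x)) (mul (normal y) (f y))) =
    (LINT y:\<Omega>|vol. mollifier \<epsilon> (y - x) *\<^sub>R f y) +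
    (LINT y:\<Omega>|vol. mul (kernel \<epsilon> (y - x)) (\<Sum>s\<le>m. mul (v s) (f' s y)))"
proof -
  define H where "H s y = mul (kernel \<epsilon> (y - x)) (mul (v s) (f y))" for s y
  define H' where "H' s j y = mul (kernel \<epsilon> (y - x)) (mul (v s) (f' j y)) +
      mul (kernel_deriv \<epsilon> j (y - x)) (mul (v s) (f y))" for s j y
  have kc: "continuous_on S (\<lambda>y. kernel \<epsilon> (y - x))" "continuous_on S (\<lambda>y. kernel_deriv \<epsilon> j (y - x))" for S j
    by (auto intro!: continuous_on_kernel continuous_intros)
  have HC: "C1_pair (H s) (H' s)" for s
    unfolding C1_pair_def
  proof (intro conjI allI impI ballI)
    show "continuous_on (closure \<Omega>) (H s)"
      unfolding H_def by (intro mul.continuous_on kc continuous_on_const C1_pairD(1)[OF f])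
    fix j assume j: "j \<le> m"
    show "continuous_on (closure \<Omega>) (H' s j)"
      unfolding H'_def by (intro continuous_on_add mul.continuous_on kc continuous_on_const C1_pairD(1)[OF f] C1_pairD(2)[OF f j])
    fix y assume y: "y \<in> \<Omega>"
    have "((\<lambda>t. kernel \<epsilon> ((y - x) + t *\<^sub>R v j)) has_vector_derivative kernel_deriv \<epsilon> j (y - x)) (at 0)"
      by (rule kernel_has_vector_derivative[OF j])
    moreover have "((\<lambda>t. mul (v s) (f (y + t *\<^sub>R v j))) has_vector_derivative mul (v s) (f' j y)) (at 0)"
      by (rule bounded_linear.has_vector_derivative[OF mul.bounded_linear_right C1_pairD(3)[OF f j y]])
    ultimately have "((\<lambda>t. mul (kernel \<epsilon> ((y - x) + t *\<^sub>R v j)) (mul (v s) (f (y + t *\<^sub>R v j)))) has_vector_derivative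
       mul (kernel \<epsilon> ((y - x) + 0 *\<^sub>R v j)) (mul (v s) (f' j y)) +
       mul (kernel_deriv \<epsilon> j (y - x)) (mul (v s) (f (y + 0 *\<^sub>R v j)))) (at 0)"
      by (rule mul.has_vector_derivative)
    then show "((\<lambda>t. H s (y + t *\<^sub>R v j)) has_vector_derivative H' s j y) (at 0)"
      by (simp add: H_def H'_def algebra_simps)
  qed
  have cG: "continuous_on \<Gamma> (\<lambda>y. (normal y \<bullet> v s) *\<^sub>R H s y)" for s
    by (intro continuous_intros continuous_on_normal continuous_on_subset[OF C1_pairD(1)[OF HC] domain_subset(3)])
  have "(LINT y:\<Gamma>|surf. mul (kernel \<epsilon> (y - x)) (mul (normal y) (f y))) =
      (LINT y:\<Gamma>|surf. (\<Sum>s\<le>m. (normal y \<bullet> v s) *\<^sub>R H s y))"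
  proof (rule set_lebesgue_integral_cong)
    show "\<forall>y. y \<in> \<Gamma> \<longrightarrow> mul (kernel \<epsilon> (y - x)) (mul (normal y) (f y)) = (\<Sum>s\<le>m. (normal y \<bullet> v s) *\<^sub>R H s y)"
    proof (intro allI impI)
      fix y assume "y \<in> \<Gamma>"
      then have "normal y = (\<Sum>s\<le>m. (normal y \<bullet> v s) *\<^sub>R v s)" by (intro frame_expand[symmetric] normal_in)
      then have "mul (kernel \<epsilon> (y - x)) (mul (normal y) (f y)) =
         mul (kernel \<epsilon> (y - x)) (mul (\<Sum>s\<le>m. (normal y \<bullet> v s) *\<^sub>R v s) (f y))" by simp
      also have "\<dots> = (\<Sum>s\<le>m. (normal y \<bullet> v s) *\<^sub>R H s y)"
        by (simp add: H_def mul.sum_left mul.sum_right mul.scaleR_left mul.scaleR_right)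
      finally show "mul (kernel \<epsilon> (y - x)) (mul (normal y) (f y)) = (\<Sum>s\<le>m. (normal y \<bullet> v s) *\<^sub>R H s y)" .
    qed
  qed simp
  also have "\<dots> = (\<Sum>s\<le>m. LINT y:\<Gamma>|surf. (normal y \<bullet> v s) *\<^sub>R H s y)"
    unfolding set_lebesgue_integral_def scaleR_sum_right
    by (rule Bochner_Integration.integral_sum)
      (use set_integrable_boundary[OF cG] in \<open>simp add: set_integrable_def\<close>)
  also have "\<dots> = (\<Sum>s\<le>m. LINT y:\<Omega>|vol. H' s s y)"
    by (intro sum.cong refl divergence[OF HC, symmetric]) simp
  also have "\<dots> = (LINT y:\<Omega>|vol. (\<Sum>s\<le>m. H' s s y))"
    unfolding set_lebesgue_integral_def scaleR_sum_right
    by (rule Bochner_Integration.integral_sum[symmetric])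
      (use set_integrable_domain[OF C1_pairD(2)[OF HC]] in \<open>simp add: set_integrable_def\<close>)
  also have "\<dots> = (LINT y:\<Omega>|vol. mollifier \<epsilon> (y - x) *\<^sub>R f y +
      mul (kernel \<epsilon> (y - x)) (\<Sum>s\<le>m. mul (v s) (f' s y)))"
  proof (rule set_lebesgue_integral_cong)
    show "\<forall>y. y \<in> \<Omega> \<longrightarrow> (\<Sum>s\<le>m. H' s s y) = mollifier \<epsilon> (y - x) *\<^sub>R f y +
      mul (kernel \<epsilon> (y - x)) (\<Sum>s\<le>m. mul (v s) (f' s y))"
    proof (intro allI impI)
      fix y assume "y \<in> \<Omega>"
      then have "y - x \<in> M" using x domain_subset by (intro frame_diff) auto
      from sum_kernel_deriv[OF this \<epsilon>, of "f y"]
      show "(\<Sum>s\<le>m. H' s s y) = mollifier \<epsilon> (y - x) *\<^sub>R f y +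
        mul (kernel \<epsilon> (y - x)) (\<Sum>s\<le>m. mul (v s) (f' s y))"
        by (simp add: H'_def sum.distrib mul.sum_right)
    qed
  qed simp
  also have "\<dots> = (LINT y:\<Omega>|vol. mollifier \<epsilon> (y - x) *\<^sub>R f y) +
    (LINT y:\<Omega>|vol. mul (kernel \<epsilon> (y - x)) (\<Sum>s\<le>m. mul (v s) (f' s y)))"
  proof (rule set_integral_add(2))
    show 2: "set_integrable vol \<Omega> (\<lambda>y. mul (kernel \<epsilon> (y - x)) (\<Sum>s\<le>m. mul (v s) (f' s y)))"
      by (intro set_integrable_domain mul.continuous_on kc continuous_on_sum continuous_on_const C1_pairD(2)[OF f]) simp
    \<comment> \<open>On \<Omega> the mollifier term equals this difference of continuous functions,
      so its integrability follows without a separate discussion of the indicator in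
      \<open>mollifier\<close>.\<close>
    have "continuous_on (closure \<Omega>) (\<lambda>y. (\<Sum>s\<le>m. H' s s y) - mul (kernel \<epsilon> (y - x)) (\<Sum>s\<le>m. mul (v s) (f' s y)))"
      by (intro continuous_on_diff continuous_on_sum C1_pairD(2)[OF HC] mul.continuous_on kc continuous_on_const C1_pairD(2)[OF f]) simp_all
    then have "set_integrable vol \<Omega> (\<lambda>y. (\<Sum>s\<le>m. H' s s y) - mul (kernel \<epsilon> (y - x)) (\<Sum>s\<le>m. mul (v s) (f' s y)))"
      by (rule set_integrable_domain)
    moreover have "(\<Sum>s\<le>m. H' s s y) - mul (kernel \<epsilon> (y - x)) (\<Sum>s\<le>m. mul (v s) (f' s y)) = mollifier \<epsilon> (y - x) *\<^sub>R f y"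
      if "y \<in> \<Omega>" for y
    proof -
      have "y - x \<in> M" using that x domain_subset by (intro frame_diff) auto
      from sum_kernel_deriv[OF this \<epsilon>, of "f y"] show ?thesis
        by (simp add: H'_def sum.distrib mul.sum_right)
    qed
    ultimately show "set_integrable vol \<Omega> (\<lambda>y. mollifier \<epsilon> (y - x) *\<^sub>R f y)"
      using set_integrable_cong[of vol vol \<Omega> \<Omega>] by (metis (no_types, lifting))
  qed
  finally show ?thesis .
qed

text \<open>The densities have mass 1 and shrink to x. Once their support within \<open>M\<close>
  lies in \<Omega>, the boundary plays no part and only the oscillation of f near x is left.\<close>

lemma mollifier_limit:
  fixes f :: "'a \<Rightarrow> 'b::euclidean_space"
  assumes f: "continuous_on (closure \<Omega>) f" and x: "x \<in> \<Omega>" and \<epsilon>: "\<And>i::nat. \<epsilon> i > 0" "\<epsilon> \<longlonglongrightarrow> 0"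
  shows "(\<lambda>i. LINT y:\<Omega>|vol. mollifier (\<epsilon> i) (y - x) *\<^sub>R f y) \<longlonglongrightarrow> f x"
proof (rule LIMSEQ_I)
  fix \<delta> :: real assume \<delta>: "\<delta> > 0"
  have xM: "x \<in> M" using x domain_subset by blast
  have xc: "x \<in> closure \<Omega>" using x closure_subset by blast
  obtain d where d: "d > 0" "\<And>y. y \<in> closure \<Omega> \<Longrightarrow> dist y x < d \<Longrightarrow> dist (f y) (f x) < \<delta> / 2"
    using f xc \<delta> unfolding continuous_on_iff by (metis half_gt_zero)
  obtain r where r: "r > 0" "ball x r \<inter> M \<subseteq> \<Omega>"
    using openin_domain x unfolding openin_contains_ball by blast
  \<comment> \<open>Below d the oscillation of f is small; below r the supporting ball, cut with
    \<open>M\<close>, lies in \<Omega>.\<close>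
  obtain N where N: "\<And>i. i \<ge> N \<Longrightarrow> \<epsilon> i < min d r"
    using LIMSEQ_D[OF \<epsilon>(2), of "min d r"] d r \<epsilon>(1) by (auto simp: abs_of_pos)
  show "\<exists>N. \<forall>i\<ge>N. norm ((LINT y:\<Omega>|vol. mollifier (\<epsilon> i) (y - x) *\<^sub>R f y) - f x) < \<delta>"
  proof (intro exI allI impI)
    fix i assume "i \<ge> N"
    then have ei: "\<epsilon> i < d" "\<epsilon> i < r" using N by auto
    let ?\<rho> = "\<lambda>y. mollifier (\<epsilon> i) (y - x)"
    have i\<rho>: "integrable vol ?\<rho>" "(\<integral>y. ?\<rho> y \<partial>vol) = 1"
      using volume_translation[OF integrable_mollifier xM, of "\<epsilon> i"] integral_mollifier[OF \<epsilon>(1)] by auto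
    have \<rho>0: "?\<rho> y = 0" if "dist y x > \<epsilon> i" for y     proof -
      have "y - x \<notin> cball 0 (\<epsilon> i)" using that by (simp add: dist_norm norm_minus_commute)
      from indicator_simps(2)[OF this] show ?thesis unfolding mollifier_def by (metis mult_zero_left)
    qed
    have near: "y \<in> \<Omega> \<and> dist (f y) (f x) < \<delta> / 2" if "y \<in> M" "dist y x \<le> \<epsilon> i" for y
    proof -
      have "y \<in> \<Omega>" using r(2) that ei by (auto simp: dist_commute)
      then show ?thesis using d(2)[of y] that ei closure_subset by auto
    qed
    have meas: "(\<lambda>y. indicator \<Omega> y *\<^sub>R f y) \<in> borel_measurable borel"
      by (rule borel_measurable_continuous_on_indicator)
        (auto intro: continuous_on_subset[OF f closure_subset])
    note [measurable] = meas borel_measurable_integrable[OF i\<rho>(1)]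
    \<comment> \<open>Subtracting f x against the full unit mass puts the whole error into one
      integrand.\<close>
    define g where "g y = ?\<rho> y *\<^sub>R (indicator \<Omega> y *\<^sub>R f y - f x)" for y
    have gm: "g \<in> borel_measurable vol" unfolding g_def by measurable
    have bnd: "AE y in vol. norm (g y) \<le> ?\<rho> y * (\<delta> / 2)"
    proof (rule AE_mp[OF AE_coord_space[of "{..m}"]], simp, intro AE_I2 impI)
      fix y assume "y \<in> coord_space {..m}"
      then have yM: "y \<in> M" by (rule coord_spaceD)
      show "norm (g y) \<le> ?\<rho> y * (\<delta> / 2)"
      proof (cases "dist y x \<le> \<epsilon> i")
        case True
        have "y \<in> \<Omega>" "dist (f y) (f x) \<le> \<delta> / 2" using near[OF yM True] by auto
        then show ?thesis
          using mollifier_nonneg[OF \<epsilon>(1), of i "y - x"] mult_left_mono[of "norm (f y - f x)" "\<delta> / 2" "?\<rho> y"]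
          by (simp add: g_def dist_norm)
      qed (use \<rho>0[of y] in \<open>simp add: g_def\<close>)
    qed
    have ig: "integrable vol g"
    proof (rule Bochner_Integration.integrable_bound[OF _ gm])
      show "integrable vol (\<lambda>y. ?\<rho> y * (\<delta> / 2))" using i\<rho>(1) by simp
      show "AE y in vol. norm (g y) \<le> norm (?\<rho> y * (\<delta> / 2))"
        using bnd by (rule AE_mp) (auto intro!: AE_I2)
    qed
    have "(LINT y:\<Omega>|vol. ?\<rho> y *\<^sub>R f y) = (\<integral>y. g y + ?\<rho> y *\<^sub>R f x \<partial>vol)"
      unfolding set_lebesgue_integral_def
      by (intro Bochner_Integration.integral_cong refl) (simp add: g_def scaleR_diff_right mult.commute)
    also have "\<dots> = (\<integral>y. g y \<partial>vol) + f x"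
      using ig i\<rho> by simp
    finally have "norm ((LINT y:\<Omega>|vol. ?\<rho> y *\<^sub>R f y) - f x) = norm (\<integral>y. g y \<partial>vol)" by simp
    also have "\<dots> \<le> (\<integral>y. norm (g y) \<partial>vol)" by (rule integral_norm_bound)
    also have "\<dots> \<le> (\<integral>y. ?\<rho> y * (\<delta> / 2) \<partial>vol)"
      by (rule integral_mono_AE) (use ig i\<rho> bnd in auto)
    also have "\<dots> = \<delta> / 2" using i\<rho> by simp
    finally show "norm ((LINT y:\<Omega>|vol. ?\<rho> y *\<^sub>R f y) - f x) < \<delta>" using \<delta> by simp
  qed
qed

text \<open>For each y the sequence is eventually constant: the kernels agree once \<epsilon> drops
  below |y - x|, and always at y = x. The locally integrable 1 / |y - x|^m dominates, which also
  yields integrability of the singular integrand.\<close>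

lemma kernel_limit:
  assumes D: "continuous_on (closure \<Omega>) D" and x: "x \<in> \<Omega>" and \<epsilon>: "\<And>i::nat. \<epsilon> i > 0" "\<epsilon> \<longlonglongrightarrow> 0"
  shows "set_integrable vol \<Omega> (\<lambda>y. mul (cauchy_kernel star m (y - x)) (D y))"
    "(\<lambda>i. LINT y:\<Omega>|vol. mul (kernel (\<epsilon> i) (y - x)) (D y)) \<longlonglongrightarrow>
      (LINT y:\<Omega>|vol. mul (cauchy_kernel star m (y - x)) (D y))"
proof -
  have xM: "x \<in> M" using x domain_subset by blast
  let ?s = "\<lambda>i y. indicat_real \<Omega> y *\<^sub>R mul (kernel (\<epsilon> i) (y - x)) (D y)"
  let ?f = "\<lambda>y. indicat_real \<Omega> y *\<^sub>R mul (cauchy_kernel star m (y - x)) (D y)"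
  have kc: "continuous_on S (\<lambda>y. kernel e (y - x))" for S e
    by (auto intro!: continuous_on_kernel continuous_intros)
  have sm: "?s i \<in> borel_measurable vol" for i
  proof -
    have "set_integrable vol \<Omega> (\<lambda>y. mul (kernel (\<epsilon> i) (y - x)) (D y))"
      by (intro set_integrable_domain mul.continuous_on kc D)
    then show ?thesis unfolding set_integrable_def by (rule borel_measurable_integrable)
  qed
  have lim: "(\<lambda>i. ?s i y) \<longlonglongrightarrow> ?f y" for y
  proof (rule tendsto_eventually)
    show "eventually (\<lambda>i. ?s i y = ?f y) sequentially"
    proof (cases "y = x")
      case True
      then show ?thesis using kernel_eq_cauchy_kernel[OF \<epsilon>(1)] by simp
    next
      case False
      have "eventually (\<lambda>i. \<epsilon> i < norm (y - x)) sequentially"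
        using order_tendstoD(2)[OF \<epsilon>(2), of "norm (y - x)"] False by simp
      then show ?thesis by eventually_elim (simp add: kernel_eq_cauchy_kernel[OF \<epsilon>(1)])
    qed
  qed
  \<comment> \<open>Measurability of the singular integrand is inherited from the smoothed ones as a
    pointwise limit.\<close>
  have fm: "?f \<in> borel_measurable vol"
    by (rule borel_measurable_LIMSEQ_metric[OF sm lim])
  obtain C where C: "C \<ge> 0" "\<And>e w. e > 0 \<Longrightarrow> norm (kernel e w) \<le> C * (1 / norm w ^ m)"
    by (rule kernel_bound) blast
  obtain K where K: "K \<ge> 0" "\<And>a b. norm (mul a b) \<le> norm a * norm b * K" using mul.nonneg_bounded by blast
  obtain B where B: "\<And>y. y \<in> closure \<Omega> \<Longrightarrow> norm (D y) \<le> B"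
    using compact_imp_bounded[OF compact_continuous_image[OF D compact_closure_domain]]
    unfolding bounded_iff by blast
  have B0: "B \<ge> 0" using order_trans[OF norm_ge_zero B[of x]] x closure_subset[of \<Omega>] by blast
  obtain R where R: "\<And>y. y \<in> \<Omega> \<Longrightarrow> dist x y \<le> R"
    using bounded_domain unfolding bounded_any_center[of \<Omega> x] by blast
  define w where "w y = (indicator (cball 0 R) (y - x) * (1 / norm (y - x) ^ m)) * (C * B * K)" for y
  have iw: "integrable vol w" unfolding w_def
    by (intro integrable_mult_left volume_translation(1)[OF integrable_inverse_norm_power xM])
  have bound: "norm (?s i y) \<le> w y" for i y
  proof (cases "y \<in> \<Omega>")
    case True
    have "norm (mul (kernel (\<epsilon> i) (y - x)) (D y)) \<le> norm (kernel (\<epsilon> i) (y - x)) * norm (D y) * K" by (rule K(2))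
    also have "\<dots> \<le> (C * (1 / norm (y - x) ^ m)) * B * K"
      using C B[of y] True closure_subset[of \<Omega>] K(1) B0 \<epsilon>(1) by (intro mult_mono) auto
    also have "\<dots> = w y" using R[OF True] by (simp add: w_def dist_norm norm_minus_commute)
    finally show ?thesis using True by simp
  qed (use C B0 K in \<open>simp add: w_def\<close>)
  show "set_integrable vol \<Omega> (\<lambda>y. mul (cauchy_kernel star m (y - x)) (D y))"
    unfolding set_integrable_def
    by (rule integrable_dominated_convergence[OF fm sm iw AE_I2[OF lim] AE_I2[OF bound]])
  show "(\<lambda>i. LINT y:\<Omega>|vol. mul (kernel (\<epsilon> i) (y - x)) (D y)) \<longlonglongrightarrow>
      (LINT y:\<Omega>|vol. mul (cauchy_kernel star m (y - x)) (D y))"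
    unfolding set_lebesgue_integral_def
    by (rule integral_dominated_convergence[OF fm sm iw AE_I2[OF lim] AE_I2[OF bound]])
qed

text \<open>With \<epsilon> no larger than the distance from x to the boundary, the smoothed kernel
  is the Cauchy kernel on \<Gamma>. The boundary term of \<open>kernel_green\<close> is then
  constant in i, and only the two volume terms pass to the limit.\<close>

theorem cauchy_formula:
  assumes f: "C1_closure v m \<Omega> f" and x: "x \<in> \<Omega>"
  shows "set_integrable surf \<Gamma> (\<lambda>y. mul (cauchy_kernel_at star m y x) (mul (normal y) (f y)))"
    "set_integrable vol \<Omega> (\<lambda>y. mul (cauchy_kernel_at star m y x) (dbar mul v m f y))"
    "f x = (LINT y:\<Gamma>|surf. mul (cauchy_kernel_at star m y x) (mul (normal y) (f y)))
         - (LINT y:\<Omega>|vol. mul (cauchy_kernel_at star m y x) (dbar mul v m f y))"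
proof -
  obtain f' where f': "C1_pair f f'" "\<forall>s\<le>m. \<forall>y\<in>\<Omega>. f' s y = partial v s f y"
    by (rule C1_closure_pair[OF f])
  define D where "D y = (\<Sum>s\<le>m. mul (v s) (f' s y))" for y
  have Dc: "continuous_on (closure \<Omega>) D"
    unfolding D_def by (intro continuous_on_sum mul.continuous_on continuous_on_const C1_pairD(2)[OF f'(1)]) simp
  have dbar: "dbar mul v m f y = D y" if "y \<in> \<Omega>" for y
    unfolding dbar_def D_def using f'(2) that by (intro sum.cong) auto
  have xM: "x \<in> M" using x domain_subset by blast
  obtain r where r: "r > 0" "ball x r \<inter> M \<subseteq> \<Omega>"
    using openin_domain x unfolding openin_contains_ball by blast
  \<comment> \<open>A null sequence starting at r, so every member, including the first, is at most
    r.\<close>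
  define \<epsilon> where "\<epsilon> i = r / real (Suc i)" for i
  have \<epsilon>: "\<epsilon> i > 0" for i using r by (simp add: \<epsilon>_def)
  have \<epsilon>0: "\<epsilon> \<longlonglongrightarrow> 0" unfolding \<epsilon>_def by (rule LIMSEQ_Suc) (rule lim_const_over_n)
  have \<epsilon>r: "\<epsilon> i \<le> r" for i using r by (simp add: \<epsilon>_def field_simps)
  have away: "kernel (\<epsilon> i) (y - x) = cauchy_kernel star m (y - x)" if y: "y \<in> \<Gamma>" for i y
  proof -
    have "y \<in> M" "y \<notin> \<Omega>" using y domain_subset boundary_in_eq[OF openin_domain] by auto
    then have "y \<notin> ball x r" using r(2) by blast
    then have "norm (y - x) \<ge> \<epsilon> i" using \<epsilon>r[of i] by (simp add: dist_norm norm_minus_commute)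
    then show ?thesis by (intro kernel_eq_cauchy_kernel[OF \<epsilon>]) simp
  qed
  have eq: "(LINT y:\<Gamma>|surf. mul (kernel (\<epsilon> i) (y - x)) (mul (normal y) (f y))) =
    (LINT y:\<Gamma>|surf. mul (cauchy_kernel_at star m y x) (mul (normal y) (f y)))" for i
    by (rule set_lebesgue_integral_cong) (auto simp: away cauchy_kernel_at_def)
  have kc: "continuous_on S (\<lambda>y. kernel e (y - x))" for S e
    by (auto intro!: continuous_on_kernel continuous_intros)
  have "set_integrable surf \<Gamma> (\<lambda>y. mul (kernel (\<epsilon> 0) (y - x)) (mul (normal y) (f y)))"
    by (intro set_integrable_boundary mul.continuous_on kc continuous_on_normal
        continuous_on_subset[OF C1_pairD(1)[OF f'(1)] domain_subset(3)])
  then show "set_integrable surf \<Gamma> (\<lambda>y. mul (cauchy_kernel_at star m y x) (mul (normal y) (f y)))"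
    by (subst (asm) set_integrable_cong[OF refl refl]) (auto simp: away cauchy_kernel_at_def)
  have "set_integrable vol \<Omega> (\<lambda>y. mul (cauchy_kernel star m (y - x)) (D y))"
    by (rule kernel_limit(1)[OF Dc x \<epsilon> \<epsilon>0])
  then show "set_integrable vol \<Omega> (\<lambda>y. mul (cauchy_kernel_at star m y x) (dbar mul v m f y))"
    by (subst (asm) set_integrable_cong[OF refl refl]) (auto simp: dbar cauchy_kernel_at_def)
  have "(\<lambda>i. (LINT y:\<Omega>|vol. mollifier (\<epsilon> i) (y - x) *\<^sub>R f y) +
      (LINT y:\<Omega>|vol. mul (kernel (\<epsilon> i) (y - x)) (D y))) \<longlonglongrightarrow>
    f x + (LINT y:\<Omega>|vol. mul (cauchy_kernel star m (y - x)) (D y))"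
    by (intro tendsto_add mollifier_limit[OF C1_pairD(1)[OF f'(1)] x \<epsilon> \<epsilon>0] kernel_limit(2)[OF Dc x \<epsilon> \<epsilon>0])
  moreover have "(LINT y:\<Omega>|vol. mollifier (\<epsilon> i) (y - x) *\<^sub>R f y) + (LINT y:\<Omega>|vol. mul (kernel (\<epsilon> i) (y - x)) (D y)) =
      (LINT y:\<Gamma>|surf. mul (cauchy_kernel_at star m y x) (mul (normal y) (f y)))" for i
    using kernel_green[OF f'(1) xM \<epsilon>, of i] unfolding eq D_def by simp
  ultimately have "(LINT y:\<Gamma>|surf. mul (cauchy_kernel_at star m y x) (mul (normal y) (f y))) =
      f x + (LINT y:\<Omega>|vol. mul (cauchy_kernel star m (y - x)) (D y))"
    by (simp add: LIMSEQ_const_iff)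
  also have "(LINT y:\<Omega>|vol. mul (cauchy_kernel star m (y - x)) (D y)) =
      (LINT y:\<Omega>|vol. mul (cauchy_kernel_at star m y x) (dbar mul v m f y))"
    by (rule set_lebesgue_integral_cong) (auto simp: dbar cauchy_kernel_at_def)
  finally show "f x = (LINT y:\<Gamma>|surf. mul (cauchy_kernel_at star m y x) (mul (normal y) (f y)))
         - (LINT y:\<Omega>|vol. mul (cauchy_kernel_at star m y x) (dbar mul v m f y))" by simp
qed

end

theorem theorem3p6:
  fixes mul :: "'a::euclidean_space \<Rightarrow> 'a \<Rightarrow> 'a"
    and e :: 'a
    and star :: "'a \<Rightarrow> 'a"
    and M :: "'a set"
    and m :: nat
    and v :: "nat \<Rightarrow> 'a"
    and \<Omega> :: "'a set"
    and f :: "'a \<Rightarrow> 'a"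
    and x :: 'a
  assumes "hypercomplex_subspace mul e star M m v"
    and "bounded_domain M \<Omega>"
    and "smooth_boundary M v m \<Omega>"
    and "C1_closure v m \<Omega> f"
    and "x \<in> \<Omega>"
  shows "set_integrable (surface_measure M v m (boundary_in M \<Omega>)) (boundary_in M \<Omega>)
           (\<lambda>y. mul (cauchy_kernel_at star m y x) (mul (exterior_normal M \<Omega> y) (f y))) \<and>
         set_integrable (volume_measure v m) \<Omega>
           (\<lambda>y. mul (cauchy_kernel_at star m y x) (dbar mul v m f y)) \<and>
         f x =
           (LINT y:boundary_in M \<Omega>|surface_measure M v m (boundary_in M \<Omega>).
              mul (cauchy_kernel_at star m y x) (mul (exterior_normal M \<Omega> y) (f y)))
           - (LINT y:\<Omega>|volume_measure v m.
              mul (cauchy_kernel_at star m y x) (dbar mul v m f y))"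
proof -
  interpret hypercomplex_subspace mul e star M m v by fact
  interpret hypercomplex_domain mul e star M m v \<Omega>
    by unfold_locales (use assms in \<open>auto simp: bounded_domain_def\<close>)
  show ?thesis
    unfolding volume_measure_def using cauchy_formula[OF assms(4,5)] by blast
qed

end
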